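(* Let $\lambda\in\mathbb{C}$ with $|\lambda|<1$, let $d\ge1$, and let $R(z)\in\mathbb{C}(z)^{m\times m}$ be a para-Hermitian rational matrix of the form $$R(z)=R_\lambda(z)+R_0+R_\lambda^*(1/z),\qquad R_\lambda(z)=\sum_{j=1}^d\frac{R_j}{(z-\lambda)^j},\qquad R_0^*=R_0,$$ with constant matrices $R_0,R_1,\dots,R_d\in\mathbb{C}^{m\times m}$ and $R_d\neq0$. Let $H\in\mathbb{C}^{dm\times dm}$ be the block Hankel matrix $$H:=\begin{bmatrix}&&&R_d\\ &&\cdot^{\cdot^{\cdot}}&R_{d-1}\\ &R_d&\cdot^{\cdot^{\cdot}}&\vdots\\ R_d&R_{d-1}&\cdots&R_1\end{bmatrix}$$ and let $r:=\mathrm{rank}(H)$. Let $U=[U_1\ U_2]$ and $V=[V_1\ V_2]$ be unitary matrices such that $$U^*HV=\begin{bmatrix}0&0\\0&U_2^*HV_2\end{bmatrix}=:\begin{bmatrix}0&0\\0&\widehat H\end{bmatrix},$$ where $\widehat H$ is $r\times r$ and invertible. Let $\widehat L_\lambda(z)$ be the pencil $$\widehat L_\lambda(z)=\left[\begin{array}{cc|c}0&M_\lambda(z)&F\\ \mathrm{rev}_1M_\lambda^*(z)&0&(1+z)G\\ \hline zF^*&(1+z)G^*&(1+z)R_0\end{array}\right]$$ with $M_\lambda(z),F,G$ as defined in the context, and set $$\widetilde L_\lambda(z):=\mathrm{diag}(U^*,V^*,I_m)\ \widehat L_\lambda(z)\ \mathrm{diag}(U,V,I_m).$$ Then $\widetilde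 L_\lambda(z)$ is of the form $$\widetilde L_\lambda(z)=\left[\begin{array}{cccc|c}0&0&0&0&0\\ 0&0&0&A_c(z)&F_c\\ 0&0&0&0&0\\ 0&\mathrm{rev}_1A_c^*(z)&0&0&(1+z)G_c\\ \hline 0&zF_c^*&0&(1+z)G_c^*&(1+z)R_0\end{array}\right],$$ where $A_c(z)\in\mathbb{C}[z]^{r\times r}$ is a regular pencil and $F_c,G_c\in\mathbb{C}^{r\times m}$ are constant (the first four block rows and block columns having sizes $dm-r,\,r,\,dm-r,\,r$), and $$L_c(z):=\left[\begin{array}{cc|c}0&A_c(z)&F_c\\ \mathrm{rev}_1A_c^*(z)&0&(1+z)G_c\\ \hline zF_c^*&(1+z)G_c^*&(1+z)R_0\end{array}\right]$$ is a strongly minimal $*$-palindromic linearization of $(1+z)R(z)$.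
   Context: For a rational matrix $R(t)$ with complex coefficients, $R^*(t):=[R(\overline{t})]^*$ (the coefficients are conjugate-transposed, the variable is not conjugated). A square rational matrix $R(z)$ is para-Hermitian if $R^*(z)=R(1/z)$. For constant matrices $^*$ is the conjugate transpose. Block matrices. Use the convention $R_k=0$ for $k>d$. The block Hankel matrix $H$ has $(i,j)$ block $R_{2d+1-i-j}$, $1\le i,j\le d$. The pencil $M_\lambda(z)$ is the $dm\times dm$ block matrix whose $(i,j)$ block is $R_{2d+2-i-j}+(\lambda-z)R_{2d+1-i-j}$, $1\le i,j\le d$ (so it has zero blocks above the block anti-diagonal, $(\lambda-z)R_d$ on the anti-diagonal, and $R_2+(\lambda-z)R_1$ in position $(d,d)$). Also $$F:=\begin{bmatrix}R_d\\ R_{d-1}\\ \vdots\\ R_1\end{bmatrix},\qquad G:=\begin{bmatrix}R_d^*\\ R_{d-1}^*\\ \vdots\\ R_1^*\end{bmatrix}.$$ A pencil is a polynomial matrix of the form $L(z)=zL_1+L_0$; a square pencil is regular if its determinant is not identically zero. For a rational matrix $Q(z)$, $\mathrm{rev}_1 Q(z):=zQ(1/z)$; a square pencil $L(z)$ is $*$-palindromic if $\mathrm{rev}_1L^*(z)=L(z)$. A linear system matrix is a block-partitioned complex pencil $$L(z)=\begin{bmatrix}-A(z)&B(z)\\ C(z)&D(z)\end{bmatrix}=\begin{bmatrix}-zA_1+A_0& zB_1-B_0\\ zC_1-C_0& zD_1-D_0\end{bmatrix}$$ with $A(z)$ a square regular pencil. Its transfer function is $D(z)+C(z)A(z)^{-1}B(z)$.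 It is minimal if $\begin{bmatrix}-A(z_0)&B(z_0)\end{bmatrix}$ has full row rank and $\begin{bmatrix}-A(z_0)\\ C(z_0)\end{bmatrix}$ has full column rank for all $z_0\in\mathbb{C}$; minimal at $\infty$ if $\begin{bmatrix}-A_1&B_1\end{bmatrix}$ has full row rank and $\begin{bmatrix}-A_1\\ C_1\end{bmatrix}$ has full column rank; strongly minimal if both hold. A strongly minimal linearization of a rational matrix is a strongly minimal linear system matrix having it as transfer function. In $L_c(z)$ the partition lines indicate the blocks: the top-left block is $-A(z)$. *)

theory Defs
  imports
    "HOL-Computational_Algebra.Polynomial_Factorial"
    "HOL-Computational_Algebra.Field_as_Ring"
    "Jordan_Normal_Form.Schur_Decomposition"
    "Jordan_Normal_Form.Gauss_Jordan_Elimination"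
    "Jordan_Normal_Form.DL_Rank"
begin

section \<open>Rational functions and rational matrices\<close>

type_synonym ratfun = "complex poly fract"

definition rconst :: "complex \<Rightarrow> ratfun" where
  "rconst c = to_fract [:c:]"

definition zvar :: ratfun where
  "zvar = to_fract [:0, 1:]"

text \<open>The rational function $f(1/z)$.  Both the numerator and the denominator are evaluated at
  the element $1/z$ of the field $\<complex>(z)$.\<close>

definition rat_recip :: "ratfun \<Rightarrow> ratfun" where
  "rat_recip f = (case quot_of_fract f of (p, q) \<Rightarrow>
     poly (map_poly rconst p) (1 / zvar) / poly (map_poly rconst q) (1 / zvar))"

text \<open>Conjugation of the coefficients only: the function $t \mapsto \overline{f(\overline{t})}$.\<close>

definition rat_cnj :: "ratfun \<Rightarrow> ratfun" where
  "rat_cnj f = (case quot_of_fract f of (p, q) \<Rightarrow>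
     to_fract (map_poly cnj p) / to_fract (map_poly cnj q))"

text \<open>The value at a point. It is only used at points which are not poles (for polynomials).\<close>

definition rat_eval :: "ratfun \<Rightarrow> complex \<Rightarrow> complex" where
  "rat_eval f z0 = (case quot_of_fract f of (p, q) \<Rightarrow> poly p z0 / poly q z0)"

abbreviation cmat :: "complex mat \<Rightarrow> ratfun mat" where
  "cmat A \<equiv> map_mat rconst A"

definition mat_recip :: "ratfun mat \<Rightarrow> ratfun mat" where
  "mat_recip Q = map_mat rat_recip Q"

definition mat_star :: "ratfun mat \<Rightarrow> ratfun mat" where
  "mat_star Q = map_mat rat_cnj (transpose_mat Q)"

definition mat_eval :: "ratfun mat \<Rightarrow> complex \<Rightarrow> complex mat" where
  "mat_eval Q z0 = map_mat (\<lambda>f. rat_eval f z0) Q"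

definition para_hermitian :: "ratfun mat \<Rightarrow> bool" where
  "para_hermitian Q \<longleftrightarrow> square_mat Q \<and> mat_star Q = mat_recip Q"

definition unitary_mat :: "complex mat \<Rightarrow> bool" where
  "unitary_mat U \<longleftrightarrow> square_mat U \<and>
     U * mat_adjoint U = 1\<^sub>m (dim_row U) \<and> mat_adjoint U * U = 1\<^sub>m (dim_row U)"

section \<open>Block matrices\<close>

definition append_cols :: "'a :: zero mat \<Rightarrow> 'a mat \<Rightarrow> 'a mat" (infixr \<open>@\<^sub>c\<close> 66) where
  "A @\<^sub>c B = four_block_mat A B (0\<^sub>m 0 (dim_col A)) (0\<^sub>m 0 (dim_col B))"

fun hconcat :: "'a :: zero mat list \<Rightarrow> 'a mat" where
  "hconcat [] = 0\<^sub>m 0 0"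
| "hconcat [A] = A"
| "hconcat (A # As) = A @\<^sub>c hconcat As"

fun vconcat :: "'a :: zero mat list \<Rightarrow> 'a mat" where
  "vconcat [] = 0\<^sub>m 0 0"
| "vconcat [A] = A"
| "vconcat (A # As) = A @\<^sub>r vconcat As"

definition block_matrix :: "'a :: zero mat list list \<Rightarrow> 'a mat" where
  "block_matrix Bs = vconcat (map hconcat Bs)"

text \<open>The matrix with \<open>p \<times> q\<close> blocks \<open>B i j\<close> of equal size \<open>m \<times> n\<close>;
  the blocks are numbered from 1.\<close>

definition uniform_block_matrix ::
    "nat \<Rightarrow> nat \<Rightarrow> nat \<Rightarrow> nat \<Rightarrow> (nat \<Rightarrow> nat \<Rightarrow> 'a mat) \<Rightarrow> 'a mat" where
  "uniform_block_matrix p q m n B =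
     mat (p * m) (q * n) (\<lambda>(a, b). B (a div m + 1) (b div n + 1) $$ (a mod m, b mod n))"

section \<open>Pencils and linear system matrices\<close>

definition pencil :: "complex mat \<Rightarrow> complex mat \<Rightarrow> ratfun mat" where
  "pencil L1 L0 = zvar \<cdot>\<^sub>m cmat L1 + cmat L0"

definition pencil_coeffs :: "ratfun mat \<Rightarrow> complex mat \<Rightarrow> complex mat \<Rightarrow> bool" where
  "pencil_coeffs L L1 L0 \<longleftrightarrow>
     L1 \<in> carrier_mat (dim_row L) (dim_col L) \<and> L0 \<in> carrier_mat (dim_row L) (dim_col L) \<and>
     L = pencil L1 L0"

definition is_pencil :: "ratfun mat \<Rightarrow> bool" where
  "is_pencil L \<longleftrightarrow> (\<exists>L1 L0. pencil_coeffs L L1 L0)"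

definition regular_pencil :: "ratfun mat \<Rightarrow> bool" where
  "regular_pencil L \<longleftrightarrow> is_pencil L \<and> square_mat L \<and> det L \<noteq> 0"

definition rev1 :: "ratfun mat \<Rightarrow> ratfun mat" where
  "rev1 Q = zvar \<cdot>\<^sub>m mat_recip Q"

definition star_palindromic :: "ratfun mat \<Rightarrow> bool" where
  "star_palindromic L \<longleftrightarrow> is_pencil L \<and> square_mat L \<and> rev1 (mat_star L) = L"

definition full_row_rank :: "complex mat \<Rightarrow> bool" where
  "full_row_rank M \<longleftrightarrow> vec_space.rank (dim_row M) M = dim_row M"

definition full_col_rank :: "complex mat \<Rightarrow> bool" where
  "full_col_rank M \<longleftrightarrow> vec_space.rank (dim_row M) M = dim_col M"

definition linear_system_matrix ::
    "ratfun mat \<Rightarrow> ratfun mat \<Rightarrow> ratfun mat \<Rightarrow> ratfun mat \<Rightarrow> bool" where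
  "linear_system_matrix A B C D \<longleftrightarrow>
     regular_pencil A \<and> is_pencil B \<and> is_pencil C \<and> is_pencil D \<and>
     dim_row B = dim_row A \<and> dim_col C = dim_col A \<and>
     dim_row D = dim_row C \<and> dim_col D = dim_col B"

text \<open>The inverse exists over $\<complex>(z)$ whenever A is regular.\<close>

definition transfer_function ::
    "ratfun mat \<Rightarrow> ratfun mat \<Rightarrow> ratfun mat \<Rightarrow> ratfun mat \<Rightarrow> ratfun mat" where
  "transfer_function A B C D = D + C * the (mat_inverse A) * B"

definition minimal_system :: "ratfun mat \<Rightarrow> ratfun mat \<Rightarrow> ratfun mat \<Rightarrow> bool" where
  "minimal_system A B C \<longleftrightarrow>
     (\<forall>z0. full_row_rank (- mat_eval A z0 @\<^sub>c mat_eval B z0) \<and>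
           full_col_rank (- mat_eval A z0 @\<^sub>r mat_eval C z0))"

definition minimal_system_at_infinity :: "ratfun mat \<Rightarrow> ratfun mat \<Rightarrow> ratfun mat \<Rightarrow> bool" where
  "minimal_system_at_infinity A B C \<longleftrightarrow>
     (\<exists>A1 A0 B1 B0 C1 C0.
        pencil_coeffs A A1 (- A0) \<and> pencil_coeffs B B1 (- B0) \<and> pencil_coeffs C C1 (- C0) \<and>
        full_row_rank (- A1 @\<^sub>c B1) \<and> full_col_rank (- A1 @\<^sub>r C1))"

text \<open>A system matrix is given as a single matrix L together with the size n of
  its state block A, which determine the partition.\<close>

definition strongly_minimal_linearization :: "nat \<Rightarrow> ratfun mat \<Rightarrow> ratfun mat \<Rightarrow> bool" where
  "strongly_minimal_linearization n L Q \<longleftrightarrow>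
     (\<exists>A B C D. A \<in> carrier_mat n n \<and> linear_system_matrix A B C D \<and>
        L = block_matrix [[- A, B], [C, D]] \<and>
        minimal_system A B C \<and> minimal_system_at_infinity A B C \<and>
        transfer_function A B C D = Q)"

section \<open>The matrices built from the coefficients\<close>

text \<open>The convention $R_k = 0$ for $k > d$.\<close>

definition coef :: "nat \<Rightarrow> nat \<Rightarrow> (nat \<Rightarrow> complex mat) \<Rightarrow> nat \<Rightarrow> complex mat" where
  "coef d m R k = (if k \<le> d then R k else 0\<^sub>m m m)"

definition polar_part :: "complex \<Rightarrow> nat \<Rightarrow> nat \<Rightarrow> (nat \<Rightarrow> complex mat) \<Rightarrow> ratfun mat" where
  "polar_part lam d m R =
     mat m m (\<lambda>(a, b). \<Sum>j = 1..d. rconst (R j $$ (a, b)) / (zvar - rconst lam) ^ j)"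

definition hankel_mat :: "nat \<Rightarrow> nat \<Rightarrow> (nat \<Rightarrow> complex mat) \<Rightarrow> complex mat" where
  "hankel_mat d m R = uniform_block_matrix d d m m (\<lambda>i j. coef d m R (2 * d + 1 - i - j))"

definition M_pencil :: "complex \<Rightarrow> nat \<Rightarrow> nat \<Rightarrow> (nat \<Rightarrow> complex mat) \<Rightarrow> ratfun mat" where
  "M_pencil lam d m R = uniform_block_matrix d d m m
     (\<lambda>i j. cmat (coef d m R (2 * d + 2 - i - j)) +
            (rconst lam - zvar) \<cdot>\<^sub>m cmat (coef d m R (2 * d + 1 - i - j)))"

definition F_mat :: "nat \<Rightarrow> nat \<Rightarrow> (nat \<Rightarrow> complex mat) \<Rightarrow> complex mat" where
  "F_mat d m R = uniform_block_matrix d 1 m m (\<lambda>i _. R (d + 1 - i))"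

definition G_mat :: "nat \<Rightarrow> nat \<Rightarrow> (nat \<Rightarrow> complex mat) \<Rightarrow> complex mat" where
  "G_mat d m R = uniform_block_matrix d 1 m m (\<lambda>i _. mat_adjoint (R (d + 1 - i)))"

text \<open>The common shape of $\widehat L_\lambda$ (with $M_\lambda, F, G$) and $L_c$ (with
  $A_c, F_c, G_c$).\<close>

definition structured_pencil ::
    "ratfun mat \<Rightarrow> complex mat \<Rightarrow> complex mat \<Rightarrow> complex mat \<Rightarrow> ratfun mat" where
  "structured_pencil M F G R0 = block_matrix
     [[0\<^sub>m (dim_row M) (dim_row M), M, cmat F],
      [rev1 (mat_star M), 0\<^sub>m (dim_col M) (dim_col M), (1 + zvar) \<cdot>\<^sub>m cmat G],
      [zvar \<cdot>\<^sub>m cmat (mat_adjoint F), (1 + zvar) \<cdot>\<^sub>m cmat (mat_adjoint G), (1 + zvar) \<cdot>\<^sub>m cmat R0]]"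

end

theory Submission
  imports Defs
begin

text \<open>
  Let \<open>P\<close> be the block down-shift and \<open>E\<close> the last block unit. The block Hankel matrix satisfies
  \<open>S := P H = H P\<^sup>*\<close>, \<open>F = H E\<close> and \<open>G\<^sup>* = E\<^sup>* H\<close>, and \<open>M = ((lam - z) I + P) H\<close>. Since
  \<open>U\<^sub>2 U\<^sub>2\<^sup>* H = H = H V\<^sub>2 V\<^sub>2\<^sup>*\<close>, compressing with \<open>U\<^sub>2\<close>, \<open>V\<^sub>2\<close> loses nothing:
  \<open>A\<^sub>c = (lam - z) U\<^sub>2\<^sup>* H V\<^sub>2 + U\<^sub>2\<^sup>* S V\<^sub>2\<close>, and a kernel vector \<open>y\<close> of \<open>A\<^sub>c(z)\<close> yields
  \<open>u = H V\<^sub>2 y\<close> with \<open>((lam - z) I + P) u = 0\<close>. As \<open>P\<close> is nilpotent, \<open>u = 0\<close> if \<open>z\<close> differs from \<open>lam\<close>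
  or if \<open>E\<^sup>* u = 0\<close>; this gives regularity and the rank conditions on each anti-diagonal block.
  The other block is singular only at \<open>1 / cnj lam\<close>, which is neither \<open>lam\<close> nor \<open>-1\<close>, so the two
  combine. For the transfer function, let \<open>W\<close> be the row with
  \<open>W ((lam - z) I + P) = E\<^sup>*\<close>; then
  \<open>G\<^sub>c\<^sup>* A\<^sub>c\<^sup>-\<^sup>1 F\<^sub>c = W M V\<^sub>2 A\<^sub>c\<^sup>-\<^sup>1 F\<^sub>c = W U\<^sub>2 F\<^sub>c = W F\<close>, which is minus the polar part.
\<close>

section \<open>Rational functions\<close>

text \<open>The rank conditions concern both anti-diagonal blocks at once, while the kernel argument
  handles one block at one point. The unit circle separates the two: lam lies inside, 1 / cnj lam
  outside (at infinity if lam = 0). So at every z at least one block is invertible and kills its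
  half of a kernel vector, and the other half faces a Hautus test for a single block. The factors z
  and 1 + z in front of F and G can spoil this test only at 0 and -1, where the block concerned
  turns out to be invertible too. At infinity the leading coefficients take over: that of
  \<open>Ac\<close> is invertible, and that of the reversed block is the adjoint of
  \<open>Ac\<close> at 0.

  Both expressions for S are needed: \<open>P H\<close> gives the kernel equation, and the adjoint
  of \<open>H P\<^sup>*\<close> gives the same equation for the rows, with the adjoint of H in place
  of H.

  Only half of the transfer function is computed. The reversed block is z times the image of
  \<open>Ac\<close> under Q(z) -> Q^*(1/z), its inverse therefore carries 1/z, and this cancels the
  z in z F^*. The second half is the image of the first.\<close>

lemma rconst_simps [simp]:
  "rconst 0 = 0" "rconst 1 = 1" "rconst (a + b) = rconst a + rconst b"
  "rconst (a * b) = rconst a * rconst b" "rconst (- a) = - rconst a"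
  "rconst (a - b) = rconst a - rconst b" "rconst a = rconst b \<longleftrightarrow> a = b"
  "rconst a = 0 \<longleftrightarrow> a = 0"
  by (simp_all add: rconst_def flip: one_pCons to_fract_add to_fract_mult to_fract_uminus to_fract_diff)

interpretation rconst: inj_comm_ring_hom rconst
  by unfold_locales simp_all

lemma zvar_nonzero [simp]: "zvar \<noteq> 0"
  by (simp add: zvar_def)

lemma zvar_neq_rconst: "zvar \<noteq> rconst c"
  by (simp add: zvar_def rconst_def)

text \<open>Expresses that \<open>zvar\<close> is transcendental over the constants: evaluation at
  \<open>zvar\<close> is just the embedding of polynomials and therefore kills no nonzero
  polynomial.\<close>

lemma to_fract_eq_poly_zvar: "to_fract p = poly (map_poly rconst p) zvar"
proof (induction p)
  case (pCons c p)
  have "to_fract (pCons c p) = to_fract ([:c:] + [:0, 1:] * p)" by simp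
  also have "\<dots> = rconst c + zvar * to_fract p"
    by (simp only: to_fract_add to_fract_mult rconst_def zvar_def)
  finally show ?case
    using pCons by (simp add: map_poly_pCons)
qed simp

text \<open>\<open>rat_recip\<close> and \<open>rat_cnj\<close> are defined through the reduced
  representative, and sums or products of reduced fractions need not be reduced. Injectivity of
  \<phi> makes \<phi> p / \<phi> q the same for every representative (fact \<open>quot\<close>),
  after which the field operations can be checked on arbitrary ones.\<close>

lemma fract_hom:
  fixes \<phi> :: "complex poly \<Rightarrow> ratfun"
  assumes add: "\<And>p q. \<phi> (p + q) = \<phi> p + \<phi> q"
    and mult: "\<And>p q. \<phi> (p * q) = \<phi> p * \<phi> q" and one: "\<phi> 1 = 1"
    and inj: "\<And>p. \<phi> p = 0 \<Longrightarrow> p = 0"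
    and f: "\<And>x. f x = (case quot_of_fract x of (p, q) \<Rightarrow> \<phi> p / \<phi> q)"
  shows "f (x + y) = f x + f y" "f (x * y) = f x * f y" "f 0 = 0" "f 1 = 1"
    "f (to_fract p) = \<phi> p"
proof -
  have zero: "\<phi> 0 = 0"
    by (metis add add.right_neutral add_left_cancel)
  have quot: "f (to_fract p / to_fract q) = \<phi> p / \<phi> q" if q: "q \<noteq> 0" for p q
  proof -
    obtain a b where ab: "quot_of_fract (to_fract p / to_fract q) = (a, b)" by fastforce
    have b: "b \<noteq> 0"
      using snd_quot_of_fract_nonzero[of "to_fract p / to_fract q"] ab by simp
    have "to_fract p / to_fract q = to_fract a / to_fract b"
      using Fract_quot_of_fract[of "to_fract p / to_fract q"] ab by (simp add: Fract_conv_to_fract)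
    hence "to_fract (p * b) = to_fract (a * q)"
      using b q by (simp add: field_simps)
    hence "p * b = a * q" by (simp only: to_fract_eq_iff)
    hence "\<phi> p * \<phi> b = \<phi> a * \<phi> q" by (metis mult)
    moreover have "\<phi> b \<noteq> 0" "\<phi> q \<noteq> 0" using b q inj by auto
    ultimately show ?thesis
      by (simp add: f ab field_simps)
  qed
  have rep: "\<exists>p q. q \<noteq> 0 \<and> z = to_fract p / to_fract q" for z :: ratfun
    by (cases z) (auto simp: Fract_conv_to_fract)
  obtain p q where x: "q \<noteq> 0" "x = to_fract p / to_fract q" using rep by blast
  obtain p' q' where y: "q' \<noteq> 0" "y = to_fract p' / to_fract q'" using rep by blast
  have nz: "\<phi> q \<noteq> 0" "\<phi> q' \<noteq> 0" using x y inj by auto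
  have sum: "x + y = to_fract (p * q' + p' * q) / to_fract (q * q')"
    and prod: "x * y = to_fract (p * p') / to_fract (q * q')"
    unfolding x(2) y(2) using x(1) y(1) by (simp_all add: field_simps)
  have "q * q' \<noteq> 0" using x y by simp
  hence fs: "f (x + y) = \<phi> (p * q' + p' * q) / \<phi> (q * q')"
    "f (x * y) = \<phi> (p * p') / \<phi> (q * q')"
    unfolding sum prod by (rule quot)+
  have fxy: "f x = \<phi> p / \<phi> q" "f y = \<phi> p' / \<phi> q'"
    using x y quot by blast+
  show "f (x + y) = f x + f y" "f (x * y) = f x * f y"
    unfolding fs fxy using nz by (simp_all add: add mult field_simps)
  show "f 0 = 0" "f 1 = 1" "f (to_fract p) = \<phi> p" for p
    using quot[of 1 0] quot[of 1 1] quot[of 1 p] by (simp_all add: one zero)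
qed

interpretation rconst_poly: map_poly_inj_comm_ring_hom rconst ..

lemma rat_recip_hom:
  "rat_recip (x + y) = rat_recip x + rat_recip y" "rat_recip (x * y) = rat_recip x * rat_recip y"
  "rat_recip 0 = 0" "rat_recip 1 = 1"
  "rat_recip (to_fract p) = poly (map_poly rconst p) (1 / zvar)"
proof -
  have inj: "p = 0" if "poly (map_poly rconst p) (1 / zvar) = 0" for p
  proof -
    let ?p = "map_poly rconst p"
    \<comment> \<open>Multiplying p(1/z) by a power of z gives the reflected polynomial at z, which
      is an embedded polynomial and so must itself be zero.\<close>
    have "poly (reflect_poly ?p) zvar = 0"
      using that poly_reflect_poly_nz[of zvar ?p] by (simp add: field_simps)
    moreover have "reflect_poly ?p = map_poly rconst (reflect_poly p)"
      by (intro poly_eqI) (simp add: coeff_reflect_poly coeff_map_poly)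
    ultimately show ?thesis
      by (simp flip: to_fract_eq_poly_zvar)
  qed
  note h = fract_hom[of "\<lambda>p. poly (map_poly rconst p) (1 / zvar)", OF _ _ _ inj rat_recip_def]
  show "rat_recip (x + y) = rat_recip x + rat_recip y" "rat_recip (x * y) = rat_recip x * rat_recip y"
    "rat_recip 0 = 0" "rat_recip 1 = 1"
    "rat_recip (to_fract p) = poly (map_poly rconst p) (1 / zvar)"
    by (rule h; simp add: rconst_poly.hom_mult rconst_poly.hom_add)+
qed

lemma rat_cnj_hom:
  "rat_cnj (x + y) = rat_cnj x + rat_cnj y" "rat_cnj (x * y) = rat_cnj x * rat_cnj y"
  "rat_cnj 0 = 0" "rat_cnj 1 = 1" "rat_cnj (to_fract p) = to_fract (map_poly cnj p)"
proof -
  interpret cnj: comm_ring_hom cnj by unfold_locales simp_all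
  interpret cnj_poly: map_poly_comm_ring_hom cnj ..
  have inj: "p = 0" if "to_fract (map_poly cnj p) = 0" for p
    using that by (simp add: map_poly_eq_0_iff)
  note h = fract_hom[of "\<lambda>p. to_fract (map_poly cnj p)", OF _ _ _ inj rat_cnj_def]
  show "rat_cnj (x + y) = rat_cnj x + rat_cnj y" "rat_cnj (x * y) = rat_cnj x * rat_cnj y"
    "rat_cnj 0 = 0" "rat_cnj 1 = 1" "rat_cnj (to_fract p) = to_fract (map_poly cnj p)"
    by (rule h; simp add: cnj_poly.hom_mult cnj_poly.hom_add)+
qed

interpretation rat_recip: comm_ring_hom rat_recip
  by unfold_locales (simp_all add: rat_recip_hom)

interpretation rat_cnj: comm_ring_hom rat_cnj
  by unfold_locales (simp_all add: rat_cnj_hom)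

lemma rat_recip_simps [simp]: "rat_recip (rconst c) = rconst c" "rat_recip zvar = 1 / zvar"
  by (simp_all add: rconst_def zvar_def rat_recip_hom rconst.map_poly_pCons_hom flip: one_pCons)

lemma rat_cnj_simps [simp]: "rat_cnj (rconst c) = rconst (cnj c)" "rat_cnj zvar = zvar"
proof -
  interpret cnj: comm_ring_hom cnj by unfold_locales simp_all
  show "rat_cnj (rconst c) = rconst (cnj c)" "rat_cnj zvar = zvar"
    by (simp_all add: rconst_def zvar_def rat_cnj_hom cnj.map_poly_pCons_hom flip: one_pCons)
qed

text \<open>The entries of a pencil have exactly this form; as polynomials they have denominator 1,
  so evaluation is the literal substitution.\<close>

lemma rat_eval_linear [simp]: "rat_eval (zvar * rconst a + rconst b) z = z * a + b"
proof -
  have "zvar * rconst a + rconst b = to_fract [:b, a:]"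
    by (simp add: zvar_def rconst_def flip: to_fract_mult to_fract_add)
  thus ?thesis by (simp add: rat_eval_def)
qed

section \<open>Constant matrices\<close>

lemma dim_mat_adjoint [simp]:
  "dim_row (mat_adjoint A) = dim_col A" "dim_col (mat_adjoint A) = dim_row A"
  by (simp_all add: mat_adjoint_def)

lemma index_mat_adjoint [simp]:
  fixes A :: "complex mat"
  assumes "i < dim_col A" "j < dim_row A"
  shows "mat_adjoint A $$ (i, j) = cnj (A $$ (j, i))"
  using assms by (simp add: mat_adjoint_def mat_of_rows_def)

lemma mat_adjoint_carrier [simp, intro]:
  "A \<in> carrier_mat n m \<Longrightarrow> mat_adjoint A \<in> carrier_mat m n"
  by (rule carrier_matI) auto

lemma mat_adjoint_mat_adjoint [simp]: "mat_adjoint (mat_adjoint A) = (A :: complex mat)"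
  by (rule eq_matI) auto

lemma mat_adjoint_mult:
  fixes A :: "complex mat"
  assumes "A \<in> carrier_mat n k" "B \<in> carrier_mat k m"
  shows "mat_adjoint (A * B) = mat_adjoint B * mat_adjoint A"
  using assms by (intro eq_matI) (simp_all add: scalar_prod_def mult.commute)

lemma mat_adjoint_add:
  fixes A :: "complex mat"
  assumes "A \<in> carrier_mat n m" "B \<in> carrier_mat n m"
  shows "mat_adjoint (A + B) = mat_adjoint A + mat_adjoint B"
  using assms by (intro eq_matI) auto

lemma mat_adjoint_smult [simp]:
  "mat_adjoint (c \<cdot>\<^sub>m A) = cnj c \<cdot>\<^sub>m mat_adjoint (A :: complex mat)"
  by (intro eq_matI) auto

lemma mat_adjoint_uminus [simp]: "mat_adjoint (- A) = - mat_adjoint (A :: complex mat)"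
  by (intro eq_matI) auto

lemma mat_adjoint_zero [simp]: "mat_adjoint (0\<^sub>m n m :: complex mat) = 0\<^sub>m m n"
  by (intro eq_matI) auto

lemma mat_adjoint_one [simp]: "mat_adjoint (1\<^sub>m n :: complex mat) = 1\<^sub>m n"
  by (intro eq_matI) auto

lemma mult_mat_adjoint_inner:
  fixes A :: "complex mat"
  assumes "A \<in> carrier_mat n k" "v \<in> carrier_vec n" "w \<in> carrier_vec k"
  shows "(mat_adjoint A *\<^sub>v v) \<bullet>c w = v \<bullet>c (A *\<^sub>v w)"
proof -
  have "(mat_adjoint A *\<^sub>v v) \<bullet>c w = (\<Sum>i<k. \<Sum>j<n. cnj (A $$ (j, i)) * v $ j * cnj (w $ i))"
    using assms by (simp add: scalar_prod_def sum_distrib_right lessThan_atLeast0)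
  also have "\<dots> = (\<Sum>j<n. \<Sum>i<k. cnj (A $$ (j, i)) * v $ j * cnj (w $ i))"
    by (rule sum.swap)
  also have "\<dots> = v \<bullet>c (A *\<^sub>v w)"
    using assms by (simp add: scalar_prod_def sum_distrib_left lessThan_atLeast0 mult_ac)
  finally show ?thesis .
qed

lemma det_nonzero_obtain_inverse:
  fixes A :: "'a :: field mat"
  assumes "A \<in> carrier_mat n n" "det A \<noteq> 0"
  obtains X where "X \<in> carrier_mat n n" "A * X = 1\<^sub>m n" "X * A = 1\<^sub>m n"
  using det_non_zero_imp_unit[OF assms, of "()"] that
  by (auto simp: Units_def ring_mat_simps)

lemma full_col_rankI:
  assumes inj: "\<And>x. x \<in> carrier_vec (dim_col M) \<Longrightarrow> M *\<^sub>v x = 0\<^sub>v (dim_row M) \<Longrightarrow> x = 0\<^sub>v (dim_col M)"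
  shows "full_col_rank M"
proof -
  interpret vec_space "TYPE(complex)" "dim_row M" .
  have M: "M \<in> carrier_mat (dim_row M) (dim_col M)" by simp
  \<comment> \<open>The rank refers to the set of columns, in which a repeated column would go
    unnoticed. Two equal columns give the kernel vector e_i - e_j.\<close>
  have "distinct (cols M)"
  proof (rule ccontr)
    assume "\<not> distinct (cols M)"
    then obtain i j where ij: "i < dim_col M" "j < dim_col M" "i \<noteq> j" "col M i = col M j"
      by (auto simp: distinct_conv_nth)
    have unit: "M *\<^sub>v unit_vec (dim_col M) i = col M i" if "i < dim_col M" for i
      using that by (intro eq_vecI) (auto simp: scalar_prod_right_unit)
    have "M *\<^sub>v (unit_vec (dim_col M) i - unit_vec (dim_col M) j) = col M i - col M j"
      using ij by (simp add: mult_minus_distrib_mat_vec[OF M] unit)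
    hence "(unit_vec (dim_col M) i :: complex vec) - unit_vec (dim_col M) j = 0\<^sub>v (dim_col M)"
      using ij by - (rule inj, simp_all)
    hence "(unit_vec (dim_col M) i - unit_vec (dim_col M) j) $ i = (0 :: complex)"
      using ij by simp
    thus False using ij by simp
  qed
  moreover have "lin_indpt (set (cols M))"
    using lin_depE[OF M _ \<open>distinct (cols M)\<close>] inj by metis
  ultimately show ?thesis
    unfolding full_col_rank_def by (rule lin_indpt_full_rank[OF M])
qed

text \<open>If the rows of \<open>M\<close> are independent then \<open>M M\<^sup>*\<close> is invertible, so the columns of \<open>M\<close> span
  the whole space.\<close>

lemma full_row_rankI:
  assumes inj: "\<And>x. x \<in> carrier_vec (dim_row M) \<Longrightarrow> mat_adjoint M *\<^sub>v x = 0\<^sub>v (dim_col M) \<Longrightarrow> x = 0\<^sub>v (dim_row M)"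
  shows "full_row_rank M"
proof -
  define n where "n = dim_row M"
  define k where "k = dim_col M"
  interpret vec_space "TYPE(complex)" n .
  have M: "M \<in> carrier_mat n k" by (simp add: n_def k_def)
  note M' = mat_adjoint_carrier[OF M]
  define N where "N = M * mat_adjoint M"
  have N: "N \<in> carrier_mat n n" using M M' by (simp add: N_def)
  have "det N \<noteq> 0"
  proof
    assume "det N = 0"
    then obtain v where v: "v \<in> carrier_vec n" "v \<noteq> 0\<^sub>v n" "N *\<^sub>v v = 0\<^sub>v n"
      using det_0_iff_vec_prod_zero_field[OF N] by blast
    define w where "w = mat_adjoint M *\<^sub>v v"
    have w: "w \<in> carrier_vec k" using M' v by (simp add: w_def)
    \<comment> \<open>With the adjoint instead of the transpose this is a squared norm, which
      vanishes only for w = 0.\<close>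
    have "w \<bullet>c w = v \<bullet>c (M *\<^sub>v w)"
      using mult_mat_adjoint_inner[OF M v(1) w] by (simp add: w_def)
    also have "M *\<^sub>v w = 0\<^sub>v n"
      using v M M' by (simp add: w_def N_def)
    finally have "w \<bullet>c w = 0" using v by simp
    hence "w = 0\<^sub>v k" using w by simp
    thus False using inj[of v] v by (simp add: w_def n_def k_def)
  qed
  then obtain X where X: "X \<in> carrier_mat n n" "N * X = 1\<^sub>m n"
    using det_nonzero_obtain_inverse[OF N] by metis
  have cols: "set (cols M) \<subseteq> carrier_vec n" using M cols_dim by blast
  have "v \<in> span (set (cols M))" if v: "v \<in> carrier_vec n" for v
  proof -
    define w where "w = mat_adjoint M *\<^sub>v (X *\<^sub>v v)"
    have w: "w \<in> carrier_vec k" using X v M' by (auto simp: w_def)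
    have "v = (N * X) *\<^sub>v v" using X v by simp
    also have "\<dots> = N *\<^sub>v (X *\<^sub>v v)" by (rule assoc_mult_mat_vec[OF N X(1) v])
    also have "\<dots> = M *\<^sub>v w" unfolding w_def N_def using M M' X v
      by (intro assoc_mult_mat_vec) auto
    also have "\<dots> = lincomb_list (\<lambda>i. w $ i) (cols M)"
    proof -
      have "mat_of_cols n (cols M) = M" "vec k (($) w) = w"
        using M w mat_of_cols_cols[of M] by auto
      thus ?thesis
        using M cols by (subst lincomb_list_as_mat_mult) auto
    qed
    finally have "v \<in> span_list (cols M)" by (auto simp: span_list_def)
    thus ?thesis using span_list_as_span[OF cols] by simp
  qed
  hence "span (set (cols M)) = carrier_vec n"
    using span_is_subset2[OF cols] by blast
  hence "rank M = vectorspace.dim class_ring (vs (carrier_vec n))" by (simp add: rank_def)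
  also have "vs (carrier_vec n) = module_vec TYPE(complex) n"
    by (simp add: module_vec_def)
  finally have "rank M = dim" .
  thus ?thesis using dim_is_n by (simp add: full_row_rank_def n_def)
qed

section \<open>Block matrices\<close>

lemma dim_append [simp]:
  "dim_row (A @\<^sub>c B) = dim_row A" "dim_col (A @\<^sub>c B) = dim_col A + dim_col B"
  "dim_row (A @\<^sub>r B) = dim_row A + dim_row B" "dim_col (A @\<^sub>r B) = dim_col A"
  by (simp_all add: append_cols_def append_rows_def)

lemma index_append_cols [simp]:
  "i < dim_row A \<Longrightarrow> j < dim_col A + dim_col B \<Longrightarrow>
    (A @\<^sub>c B) $$ (i, j) = (if j < dim_col A then A $$ (i, j) else B $$ (i, j - dim_col A))"
  by (simp add: append_cols_def)

lemma index_append_rows [simp]: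
  "i < dim_row A + dim_row B \<Longrightarrow> j < dim_col A \<Longrightarrow>
    (A @\<^sub>r B) $$ (i, j) = (if i < dim_row A then A $$ (i, j) else B $$ (i - dim_row A, j))"
  by (simp add: append_rows_def)

lemma append_cols_carrier [simp, intro]:
  "A \<in> carrier_mat n k \<Longrightarrow> B \<in> carrier_mat n l \<Longrightarrow> A @\<^sub>c B \<in> carrier_mat n (k + l)"
  by (rule carrier_matI) auto

lemma append_cols_assoc: "(A @\<^sub>c B) @\<^sub>c C = A @\<^sub>c B @\<^sub>c C"
  if "dim_row A = dim_row B"
  using that by (intro eq_matI) auto

lemma append_rows_assoc: "(A @\<^sub>r B) @\<^sub>r C = A @\<^sub>r B @\<^sub>r C"
  if "dim_col A = dim_col B"
  using that by (intro eq_matI) auto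

text \<open>Lets the three block rows of \<open>structured_pencil\<close> be regrouped into the two
  by two partition of a system matrix.\<close>

lemma append_interchange:
  assumes "dim_row A = dim_row B" "dim_row C = dim_row D"
    "dim_col A = dim_col C" "dim_col B = dim_col D"
  shows "(A @\<^sub>r C) @\<^sub>c (B @\<^sub>r D) = (A @\<^sub>c B) @\<^sub>r (C @\<^sub>c D)"
  using assms by (intro eq_matI) auto

lemma mult_append_cols:
  assumes "A \<in> carrier_mat n k" "B \<in> carrier_mat k l" "C \<in> carrier_mat k m"
  shows "A * (B @\<^sub>c C) = A * B @\<^sub>c A * C"
  using assms by (intro eq_matI) (auto simp: scalar_prod_def)

lemma append_rows_mult:
  assumes "A \<in> carrier_mat n k" "B \<in> carrier_mat l k" "C \<in> carrier_mat k m"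
  shows "(A @\<^sub>r B) * C = A * C @\<^sub>r B * C"
  using assms by (intro eq_matI) (auto simp: scalar_prod_def)

lemma append_cols_mult_append_rows:
  fixes A :: "'a :: semiring_0 mat"
  assumes "A \<in> carrier_mat n k" "B \<in> carrier_mat n l" "C \<in> carrier_mat k m" "D \<in> carrier_mat l m"
  shows "(A @\<^sub>c B) * (C @\<^sub>r D) = A * C + B * D"
proof (rule eq_matI)
  fix i j assume "i < dim_row (A * C + B * D)" "j < dim_col (A * C + B * D)"
  moreover have "{0..<k + l} = {0..<k} \<union> {k..<k + l}" by auto
  moreover have "sum f {k..<k + l} = (\<Sum>x = 0..<l. f (x + k))" for f :: "nat \<Rightarrow> 'a"
    using sum.shift_bounds_nat_ivl[of f 0 k l] by (simp add: add.commute)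
  ultimately show "((A @\<^sub>c B) * (C @\<^sub>r D)) $$ (i, j) = (A * C + B * D) $$ (i, j)"
    using assms by (simp add: scalar_prod_def sum.union_disjoint)
qed (use assms in auto)

lemma mat_adjoint_append_cols:
  fixes A B :: "complex mat"
  assumes "dim_row A = dim_row B"
  shows "mat_adjoint (A @\<^sub>c B) = mat_adjoint A @\<^sub>r mat_adjoint B"
  using assms by (intro eq_matI) auto

lemma mat_adjoint_append_rows:
  fixes A B :: "complex mat"
  assumes "dim_col A = dim_col B"
  shows "mat_adjoint (A @\<^sub>r B) = mat_adjoint A @\<^sub>c mat_adjoint B"
  using assms by (intro eq_matI) auto

lemma mult_vec_append_cols:
  fixes A B :: "'a :: semiring_0 mat"
  assumes "A \<in> carrier_mat n k" "B \<in> carrier_mat n l" "x \<in> carrier_vec k" "y \<in> carrier_vec l"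
  shows "(A @\<^sub>c B) *\<^sub>v (x @\<^sub>v y) = A *\<^sub>v x + B *\<^sub>v y"
proof (rule eq_vecI)
  fix i assume "i < dim_vec (A *\<^sub>v x + B *\<^sub>v y)"
  moreover have "{0..<k + l} = {0..<k} \<union> {k..<k + l}" by auto
  moreover have "sum f {k..<k + l} = (\<Sum>x = 0..<l. f (x + k))" for f :: "nat \<Rightarrow> 'a"
    using sum.shift_bounds_nat_ivl[of f 0 k l] by (simp add: add.commute)
  ultimately show "((A @\<^sub>c B) *\<^sub>v (x @\<^sub>v y)) $ i = (A *\<^sub>v x + B *\<^sub>v y) $ i"
    using assms by (simp add: scalar_prod_def sum.union_disjoint)
qed (use assms in auto)

section \<open>Pencils\<close>

lemma dim_pencil [simp]: "dim_row (pencil L1 L0) = dim_row L0" "dim_col (pencil L1 L0) = dim_col L0"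
  by (simp_all add: pencil_def)

lemma pencil_carrier [simp, intro]: "L0 \<in> carrier_mat n k \<Longrightarrow> pencil L1 L0 \<in> carrier_mat n k"
  by (rule carrier_matI) auto

lemma index_pencil [simp]:
  assumes "i < dim_row L0" "j < dim_col L0" "dim_row L1 = dim_row L0" "dim_col L1 = dim_col L0"
  shows "pencil L1 L0 $$ (i, j) = zvar * rconst (L1 $$ (i, j)) + rconst (L0 $$ (i, j))"
  using assms by (simp add: pencil_def)

lemma cmat_mult_pencil:
  assumes "A \<in> carrier_mat p n" "L1 \<in> carrier_mat n k" "L0 \<in> carrier_mat n k"
  shows "cmat A * pencil L1 L0 = pencil (A * L1) (A * L0)"
proof -
  have "cmat A * pencil L1 L0 = cmat A * (zvar \<cdot>\<^sub>m cmat L1) + cmat A * cmat L0"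
    unfolding pencil_def using assms by (intro mult_add_distrib_mat) auto
  also have "cmat A * (zvar \<cdot>\<^sub>m cmat L1) = zvar \<cdot>\<^sub>m (cmat A * cmat L1)"
    using assms by (intro mult_smult_distrib) auto
  finally show ?thesis
    using assms by (simp add: pencil_def rconst.mat_hom_mult)
qed

lemma pencil_mult_cmat:
  assumes "L1 \<in> carrier_mat n k" "L0 \<in> carrier_mat n k" "A \<in> carrier_mat k p"
  shows "pencil L1 L0 * cmat A = pencil (L1 * A) (L0 * A)"
proof -
  have "pencil L1 L0 * cmat A = (zvar \<cdot>\<^sub>m cmat L1) * cmat A + cmat L0 * cmat A"
    unfolding pencil_def using assms by (intro add_mult_distrib_mat) auto
  also have "(zvar \<cdot>\<^sub>m cmat L1) * cmat A = zvar \<cdot>\<^sub>m (cmat L1 * cmat A)"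
    using assms by (intro mult_smult_assoc_mat) auto
  finally show ?thesis
    using assms by (simp add: pencil_def rconst.mat_hom_mult)
qed

text \<open>The factor z absorbs the 1/z, so both operations together take adjoints of the
  coefficients and swap them. Palindromicity of a pencil thus becomes an identity between constant
  matrices.\<close>

lemma rev1_mat_star_pencil:
  assumes "L1 \<in> carrier_mat n k" "L0 \<in> carrier_mat n k"
  shows "rev1 (mat_star (pencil L1 L0)) = pencil (mat_adjoint L0) (mat_adjoint L1)"
proof (rule eq_matI)
  fix i j assume "i < dim_row (pencil (mat_adjoint L0) (mat_adjoint L1))"
    "j < dim_col (pencil (mat_adjoint L0) (mat_adjoint L1))"
  thus "rev1 (mat_star (pencil L1 L0)) $$ (i, j) = pencil (mat_adjoint L0) (mat_adjoint L1) $$ (i, j)"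
    using assms by (simp add: rev1_def mat_star_def mat_recip_def rat_cnj.hom_add rat_cnj.hom_mult
        rat_recip.hom_add rat_recip.hom_mult field_simps)
qed (use assms in \<open>auto simp: rev1_def mat_star_def mat_recip_def\<close>)

lemma mat_eval_pencil:
  assumes "L1 \<in> carrier_mat n k" "L0 \<in> carrier_mat n k"
  shows "mat_eval (pencil L1 L0) z = z \<cdot>\<^sub>m L1 + L0"
  using assms by (intro eq_matI) (auto simp: mat_eval_def)

lemma uminus_pencil:
  assumes "L1 \<in> carrier_mat n k" "L0 \<in> carrier_mat n k"
  shows "- pencil L1 L0 = pencil (- L1) (- L0)"
  using assms by (intro eq_matI) auto

lemma pencil_append_cols:
  assumes "L1 \<in> carrier_mat n k" "L0 \<in> carrier_mat n k" "K1 \<in> carrier_mat n l" "K0 \<in> carrier_mat n l"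
  shows "pencil L1 L0 @\<^sub>c pencil K1 K0 = pencil (L1 @\<^sub>c K1) (L0 @\<^sub>c K0)"
  using assms by (intro eq_matI) auto

lemma pencil_append_rows:
  assumes "L1 \<in> carrier_mat n k" "L0 \<in> carrier_mat n k" "K1 \<in> carrier_mat l k" "K0 \<in> carrier_mat l k"
  shows "pencil L1 L0 @\<^sub>r pencil K1 K0 = pencil (L1 @\<^sub>r K1) (L0 @\<^sub>r K0)"
  using assms by (intro eq_matI) auto

lemma cmat_eq_pencil:
  assumes "A \<in> carrier_mat n k"
  shows "cmat A = pencil (0\<^sub>m n k) A" "zvar \<cdot>\<^sub>m cmat A = pencil A (0\<^sub>m n k)"
    "(1 + zvar) \<cdot>\<^sub>m cmat A = pencil A A"
  using assms by (auto intro!: eq_matI simp: algebra_simps)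

lemma pencil_coeffs_pencil:
  assumes "L1 \<in> carrier_mat n k" "L0 \<in> carrier_mat n k"
  shows "pencil_coeffs (pencil L1 L0) L1 L0"
  using assms by (simp add: pencil_coeffs_def)

lemma is_pencil_pencil:
  assumes "L1 \<in> carrier_mat n k" "L0 \<in> carrier_mat n k"
  shows "is_pencil (pencil L1 L0)"
  using pencil_coeffs_pencil[OF assms] by (auto simp: is_pencil_def)

text \<open>Evaluation at a point is no ring homomorphism on the field of fractions. The determinant
  is therefore formed over the polynomials, from where homomorphisms lead both to the pencil and to
  its value at z.\<close>

lemma det_pencil_nonzero:
  assumes "L1 \<in> carrier_mat n n" "L0 \<in> carrier_mat n n" "det (z \<cdot>\<^sub>m L1 + L0) \<noteq> 0"
  shows "det (pencil L1 L0) \<noteq> 0"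
proof -
  define Q where "Q = mat n n (\<lambda>ij. [:L0 $$ ij, L1 $$ ij:])"
  have ev: "comm_ring_hom (\<lambda>p. poly p z)" by unfold_locales simp_all
  have tf: "comm_ring_hom (to_fract :: complex poly \<Rightarrow> ratfun)" by unfold_locales simp_all
  have "map_mat (\<lambda>p. poly p z) Q = z \<cdot>\<^sub>m L1 + L0"
    using assms by (intro eq_matI) (auto simp: Q_def)
  hence "poly (det Q) z \<noteq> 0"
    using assms comm_ring_hom.hom_det[OF ev, of Q] by simp
  hence "det Q \<noteq> 0" by auto
  moreover have "pencil L1 L0 = map_mat to_fract Q"
    using assms by (intro eq_matI)
      (auto simp: Q_def zvar_def rconst_def simp flip: to_fract_mult to_fract_add)
  ultimately show ?thesis by (simp add: comm_ring_hom.hom_det[OF tf])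
qed

section \<open>Para-conjugation\<close>

text \<open>Q^*(1/z), which on the unit circle is the ordinary adjoint of Q(z). Without the factor z
  of \<open>rev1\<close> it reverses products, and hence sends inverses to inverses.\<close>

definition para_conj :: "ratfun mat \<Rightarrow> ratfun mat" where
  "para_conj Q = mat_recip (mat_star Q)"

lemma dim_para_conj [simp]:
  "dim_row (para_conj Q) = dim_col Q" "dim_col (para_conj Q) = dim_row Q"
  by (simp_all add: para_conj_def mat_recip_def mat_star_def)

lemma index_para_conj [simp]:
  "i < dim_col Q \<Longrightarrow> j < dim_row Q \<Longrightarrow> para_conj Q $$ (i, j) = rat_recip (rat_cnj (Q $$ (j, i)))"
  by (simp add: para_conj_def mat_recip_def mat_star_def)

lemma para_conj_carrier [simp, intro]:
  "Q \<in> carrier_mat n k \<Longrightarrow> para_conj Q \<in> carrier_mat k n"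
  by (rule carrier_matI) auto

lemma para_conj_mult:
  assumes "P \<in> carrier_mat n k" "Q \<in> carrier_mat k l"
  shows "para_conj (P * Q) = para_conj Q * para_conj P"
  using assms by (intro eq_matI) (auto simp: scalar_prod_def rat_cnj.hom_sum rat_recip.hom_sum
      rat_cnj.hom_mult rat_recip.hom_mult intro!: sum.cong)

lemma para_conj_cmat [simp]: "para_conj (cmat A) = cmat (mat_adjoint A)"
  by (intro eq_matI) auto

lemma para_conj_one [simp]: "para_conj (1\<^sub>m n) = 1\<^sub>m n"
  by (intro eq_matI) auto

lemma para_conj_uminus: "para_conj (- Q) = - para_conj Q"
  by (intro eq_matI) (auto simp: rat_cnj.hom_uminus rat_recip.hom_uminus)

lemma rev1_mat_star: "rev1 (mat_star Q) = zvar \<cdot>\<^sub>m para_conj Q"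
  by (simp add: rev1_def para_conj_def)

section \<open>Antidiagonal system matrices\<close>

lemma append_rows_eq_four_block_mat:
  assumes "A \<in> carrier_mat n k" "B \<in> carrier_mat n l" "C \<in> carrier_mat p k" "D \<in> carrier_mat p l"
  shows "(A @\<^sub>c B) @\<^sub>r (C @\<^sub>c D) = four_block_mat A B C D"
  using assms by (intro eq_matI) auto

lemma zero_append_zero_vec: "0\<^sub>v n @\<^sub>v 0\<^sub>v k = 0\<^sub>v (n + k)"
  by (rule eq_vecI) auto

text \<open>X sees only the second half of v and Y only the first; the bottom block row is the only
  place where the halves meet.\<close>

lemma antidiagonal_kernel:
  fixes X Y P Q :: "complex mat"
  assumes "X \<in> carrier_mat r r" "Y \<in> carrier_mat r r" "P \<in> carrier_mat m r" "Q \<in> carrier_mat m r"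
    and v: "v \<in> carrier_vec (r + r)"
    and 0: "(((0\<^sub>m r r @\<^sub>c X) @\<^sub>r (Y @\<^sub>c 0\<^sub>m r r)) @\<^sub>r (P @\<^sub>c Q)) *\<^sub>v v = 0\<^sub>v (r + r + m)"
  obtains x y where "v = x @\<^sub>v y" "x \<in> carrier_vec r" "y \<in> carrier_vec r"
    "X *\<^sub>v y = 0\<^sub>v r" "Y *\<^sub>v x = 0\<^sub>v r" "P *\<^sub>v x + Q *\<^sub>v y = 0\<^sub>v m"
proof -
  define x where "x = vec_first v r"
  define y where "y = vec_last v r"
  have xy: "v = x @\<^sub>v y" "x \<in> carrier_vec r" "y \<in> carrier_vec r"
    using v by (simp_all add: x_def y_def)
  have z: "0\<^sub>m r r *\<^sub>v w = 0\<^sub>v r" if "w \<in> carrier_vec r" for w :: "complex vec"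
    using that by (intro eq_vecI) auto
  have c: "0\<^sub>m r r @\<^sub>c X \<in> carrier_mat r (r + r)" "Y @\<^sub>c 0\<^sub>m r r \<in> carrier_mat r (r + r)"
    "P @\<^sub>c Q \<in> carrier_mat m (r + r)"
    using assms(1-4) by simp_all
  have Xy: "X *\<^sub>v y \<in> carrier_vec r" and Yx: "Y *\<^sub>v x \<in> carrier_vec r"
    using assms(1,2) xy by (auto intro!: mult_mat_vec_carrier)
  have "(((0\<^sub>m r r @\<^sub>c X) @\<^sub>r (Y @\<^sub>c 0\<^sub>m r r)) @\<^sub>r (P @\<^sub>c Q)) *\<^sub>v v
      = ((0\<^sub>m r r @\<^sub>c X) *\<^sub>v v @\<^sub>v (Y @\<^sub>c 0\<^sub>m r r) *\<^sub>v v) @\<^sub>v (P @\<^sub>c Q) *\<^sub>v v"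
    unfolding mat_mult_append[OF carrier_append_rows[OF c(1,2)] c(3) v] mat_mult_append[OF c(1,2) v] ..
  also have "(0\<^sub>m r r @\<^sub>c X) *\<^sub>v v = X *\<^sub>v y"
    unfolding xy(1) mult_vec_append_cols[OF zero_carrier_mat assms(1) xy(2,3)] z[OF xy(2)]
    by (rule left_zero_vec[OF Xy])
  also have "(Y @\<^sub>c 0\<^sub>m r r) *\<^sub>v v = Y *\<^sub>v x"
    unfolding xy(1) mult_vec_append_cols[OF assms(2) zero_carrier_mat xy(2,3)] z[OF xy(3)]
    by (rule right_zero_vec[OF Yx])
  also have "(P @\<^sub>c Q) *\<^sub>v v = P *\<^sub>v x + Q *\<^sub>v y"
    unfolding xy(1) by (rule mult_vec_append_cols[OF assms(3,4) xy(2,3)])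
  finally have "(X *\<^sub>v y @\<^sub>v Y *\<^sub>v x) @\<^sub>v (P *\<^sub>v x + Q *\<^sub>v y) = (0\<^sub>v r @\<^sub>v 0\<^sub>v r) @\<^sub>v 0\<^sub>v m"
    unfolding 0 zero_append_zero_vec ..
  hence *: "X *\<^sub>v y @\<^sub>v Y *\<^sub>v x = 0\<^sub>v r @\<^sub>v 0\<^sub>v r" "P *\<^sub>v x + Q *\<^sub>v y = 0\<^sub>v m"
    using append_vec_eq[OF append_carrier_vec[OF Xy Yx], of "0\<^sub>v r @\<^sub>v 0\<^sub>v r"] by simp_all
  have "X *\<^sub>v y = 0\<^sub>v r" "Y *\<^sub>v x = 0\<^sub>v r"
    using *(1) append_vec_eq[OF Xy, of "0\<^sub>v r"] by simp_all
  thus ?thesis using that[OF xy _ _ *(2)] by blast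
qed

lemma antidiagonal_full_col_rank:
  fixes X Y P Q :: "complex mat"
  assumes c: "X \<in> carrier_mat r r" "Y \<in> carrier_mat r r" "P \<in> carrier_mat m r" "Q \<in> carrier_mat m r"
    and inj: "\<And>x y. x \<in> carrier_vec r \<Longrightarrow> y \<in> carrier_vec r \<Longrightarrow> X *\<^sub>v y = 0\<^sub>v r \<Longrightarrow> Y *\<^sub>v x = 0\<^sub>v r \<Longrightarrow>
      P *\<^sub>v x + Q *\<^sub>v y = 0\<^sub>v m \<Longrightarrow> x = 0\<^sub>v r \<and> y = 0\<^sub>v r"
  shows "full_col_rank (((0\<^sub>m r r @\<^sub>c X) @\<^sub>r (Y @\<^sub>c 0\<^sub>m r r)) @\<^sub>r (P @\<^sub>c Q))" (is "full_col_rank ?M")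
proof (rule full_col_rankI)
  fix v assume "v \<in> carrier_vec (dim_col ?M)" "?M *\<^sub>v v = 0\<^sub>v (dim_row ?M)"
  hence v: "v \<in> carrier_vec (r + r)" and 0: "?M *\<^sub>v v = 0\<^sub>v (r + r + m)"
    using c by auto
  obtain x y where "v = x @\<^sub>v y" "x = 0\<^sub>v r" "y = 0\<^sub>v r"
    using antidiagonal_kernel[OF c v 0] inj by metis
  thus "v = 0\<^sub>v (dim_col ?M)" using c by (auto simp: zero_append_zero_vec)
qed

lemma antidiagonal_full_row_rank:
  fixes X Y P Q :: "complex mat"
  assumes c: "X \<in> carrier_mat r r" "Y \<in> carrier_mat r r" "P \<in> carrier_mat r m" "Q \<in> carrier_mat r m"
    and inj: "\<And>x y. x \<in> carrier_vec r \<Longrightarrow> y \<in> carrier_vec r \<Longrightarrow>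
      mat_adjoint X *\<^sub>v x = 0\<^sub>v r \<Longrightarrow> mat_adjoint Y *\<^sub>v y = 0\<^sub>v r \<Longrightarrow>
      mat_adjoint P *\<^sub>v x + mat_adjoint Q *\<^sub>v y = 0\<^sub>v m \<Longrightarrow> x = 0\<^sub>v r \<and> y = 0\<^sub>v r"
  shows "full_row_rank (((0\<^sub>m r r @\<^sub>c X) @\<^sub>r (Y @\<^sub>c 0\<^sub>m r r)) @\<^sub>c (P @\<^sub>r Q))" (is "full_row_rank ?M")
proof (rule full_row_rankI)
  fix v assume v: "v \<in> carrier_vec (dim_row ?M)" and 0: "mat_adjoint ?M *\<^sub>v v = 0\<^sub>v (dim_col ?M)"
  \<comment> \<open>The adjoint of an anti-diagonal matrix has its blocks adjoined and exchanged, so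
    \<open>antidiagonal_kernel\<close> is applied with the adjoint of Y in the role of X.\<close>
  have adj: "mat_adjoint ?M = ((0\<^sub>m r r @\<^sub>c mat_adjoint Y) @\<^sub>r (mat_adjoint X @\<^sub>c 0\<^sub>m r r)) @\<^sub>r
      (mat_adjoint P @\<^sub>c mat_adjoint Q)"
    using c by (simp add: mat_adjoint_append_cols mat_adjoint_append_rows append_interchange)
  have v: "v \<in> carrier_vec (r + r)" using v c by auto
  note 0 = 0[unfolded adj]
  have 0: "(((0\<^sub>m r r @\<^sub>c mat_adjoint Y) @\<^sub>r (mat_adjoint X @\<^sub>c 0\<^sub>m r r)) @\<^sub>r
      (mat_adjoint P @\<^sub>c mat_adjoint Q)) *\<^sub>v v = 0\<^sub>v (r + r + m)"
    using 0 c by auto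
  obtain x y where "v = x @\<^sub>v y" "x = 0\<^sub>v r" "y = 0\<^sub>v r"
    using antidiagonal_kernel[OF _ _ _ _ v 0] inj c by (metis mat_adjoint_carrier)
  thus "v = 0\<^sub>v (dim_row ?M)" using c by (auto simp: zero_append_zero_vec)
qed

section \<open>Minimality of the palindromic system\<close>

lemma smult_zero_vec_right [simp]: "c \<cdot>\<^sub>v 0\<^sub>v n = (0\<^sub>v n :: 'a :: semiring_0 vec)"
  by (rule eq_vecI) auto

lemma smult_mat_mult_vec:
  fixes A :: "'a :: semiring_0 mat"
  assumes "A \<in> carrier_mat n k" "x \<in> carrier_vec k"
  shows "(c \<cdot>\<^sub>m A) *\<^sub>v x = c \<cdot>\<^sub>v (A *\<^sub>v x)"
  using assms by (intro eq_vecI) (simp_all add: scalar_prod_def sum_distrib_left mult.assoc)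

text \<open>Dividing by w shows that the reversed pencil at w and the pencil at 1 / w have the same
  kernel.\<close>

lemma reversed_pencil_kernel:
  fixes B1 B0 :: "complex mat"
  assumes "B1 \<in> carrier_mat n k" "B0 \<in> carrier_mat n k" "x \<in> carrier_vec k"
    "(w \<cdot>\<^sub>m B0 + B1) *\<^sub>v x = 0\<^sub>v n" "w \<noteq> 0"
  shows "((1 / w) \<cdot>\<^sub>m B1 + B0) *\<^sub>v x = 0\<^sub>v n"
proof -
  have "(1 / w) \<cdot>\<^sub>m B1 + B0 = (1 / w) \<cdot>\<^sub>m (w \<cdot>\<^sub>m B0 + B1)"
    using assms(1,2,5) by (intro eq_matI) (simp_all add: distrib_left add.commute)
  also have "\<dots> *\<^sub>v x = (1 / w) \<cdot>\<^sub>v ((w \<cdot>\<^sub>m B0 + B1) *\<^sub>v x)"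
    using assms(1-3) by (intro smult_mat_mult_vec) auto
  finally show ?thesis using assms by simp
qed

lemma smult_mat_mult_vec_eq_0:
  fixes B :: "complex mat"
  assumes "(c \<cdot>\<^sub>m B) *\<^sub>v x = 0\<^sub>v n" "c \<noteq> 0" "B \<in> carrier_mat n k" "x \<in> carrier_vec k"
  shows "B *\<^sub>v x = 0\<^sub>v n"
proof -
  have "(c \<cdot>\<^sub>m B) *\<^sub>v x = c \<cdot>\<^sub>v (B *\<^sub>v x)"
    using assms(3,4) by (intro smult_mat_mult_vec) auto
  hence "(1 / c) \<cdot>\<^sub>v (c \<cdot>\<^sub>v (B *\<^sub>v x)) = (1 / c) \<cdot>\<^sub>v 0\<^sub>v n" using assms by simp
  thus ?thesis using assms by (simp add: smult_smult_assoc)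
qed

lemma add_mat_mult_vec_zero:
  fixes A B :: "complex mat"
  assumes "A \<in> carrier_mat n k" "B \<in> carrier_mat n l" "x \<in> carrier_vec k"
  shows "A *\<^sub>v x + B *\<^sub>v 0\<^sub>v l = A *\<^sub>v x" "B *\<^sub>v 0\<^sub>v l + A *\<^sub>v x = A *\<^sub>v x"
proof -
  have "B *\<^sub>v 0\<^sub>v l = 0\<^sub>v n" using assms(2) by (intro eq_vecI) auto
  moreover have "A *\<^sub>v x \<in> carrier_vec n" using assms by simp
  ultimately show "A *\<^sub>v x + B *\<^sub>v 0\<^sub>v l = A *\<^sub>v x" "B *\<^sub>v 0\<^sub>v l + A *\<^sub>v x = A *\<^sub>v x"
    by simp_all
qed

text \<open>\<open>A1\<close> and \<open>A0\<close> are the coefficients of the block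
  \<open>Ac\<close>. The kernel hypotheses are Hautus tests: \<open>Ac\<close> can be singular only
  at lam, \<open>observable\<close> and \<open>controllable\<close> compensate for this there, and
  the two \<open>lead\<close> conditions exclude a singularity at infinity. How \<open>Ac\<close>
  interacts with its mirror image is settled here without reference to Hankel matrices.\<close>

locale palindromic_system =
  fixes r m :: nat and lam :: complex and A1 A0 F G R0 :: "complex mat"
  assumes A1: "A1 \<in> carrier_mat r r" and A0: "A0 \<in> carrier_mat r r"
    and F: "F \<in> carrier_mat r m" and G: "G \<in> carrier_mat r m"
    and R0: "R0 \<in> carrier_mat m m" "mat_adjoint R0 = R0"
    and lam: "cmod lam < 1"
    and col_inj: "\<And>z y. z \<noteq> lam \<Longrightarrow> y \<in> carrier_vec r \<Longrightarrow> (z \<cdot>\<^sub>m A1 + A0) *\<^sub>v y = 0\<^sub>v r \<Longrightarrow> y = 0\<^sub>v r"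
    and observable: "\<And>z y. y \<in> carrier_vec r \<Longrightarrow> (z \<cdot>\<^sub>m A1 + A0) *\<^sub>v y = 0\<^sub>v r \<Longrightarrow>
      mat_adjoint G *\<^sub>v y = 0\<^sub>v m \<Longrightarrow> y = 0\<^sub>v r"
    and row_inj: "\<And>z x. z \<noteq> lam \<Longrightarrow> x \<in> carrier_vec r \<Longrightarrow>
      mat_adjoint (z \<cdot>\<^sub>m A1 + A0) *\<^sub>v x = 0\<^sub>v r \<Longrightarrow> x = 0\<^sub>v r"
    and controllable: "\<And>z x. x \<in> carrier_vec r \<Longrightarrow> mat_adjoint (z \<cdot>\<^sub>m A1 + A0) *\<^sub>v x = 0\<^sub>v r \<Longrightarrow>
      mat_adjoint F *\<^sub>v x = 0\<^sub>v m \<Longrightarrow> x = 0\<^sub>v r"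
    and lead_col_inj: "\<And>y. y \<in> carrier_vec r \<Longrightarrow> A1 *\<^sub>v y = 0\<^sub>v r \<Longrightarrow> y = 0\<^sub>v r"
    and lead_row_inj: "\<And>x. x \<in> carrier_vec r \<Longrightarrow> mat_adjoint A1 *\<^sub>v x = 0\<^sub>v r \<Longrightarrow> x = 0\<^sub>v r"
begin

lemmas carriers = A1 A0 F G R0(1) A1[THEN mat_adjoint_carrier] A0[THEN mat_adjoint_carrier]
  F[THEN mat_adjoint_carrier] G[THEN mat_adjoint_carrier]

text \<open>Suffix 1 marks the coefficient of z and suffix 0 the constant coefficient. The state
  matrices describe the top left block, which is -A; hence the negations wherever A itself is
  required.\<close>

definition "state1 = (0\<^sub>m r r @\<^sub>c A1) @\<^sub>r (mat_adjoint A0 @\<^sub>c 0\<^sub>m r r)"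
definition "state0 = (0\<^sub>m r r @\<^sub>c A0) @\<^sub>r (mat_adjoint A1 @\<^sub>c 0\<^sub>m r r)"
definition "input1 = 0\<^sub>m r m @\<^sub>r G"
definition "input0 = F @\<^sub>r G"
definition "output1 = mat_adjoint F @\<^sub>c mat_adjoint G"
definition "output0 = 0\<^sub>m m r @\<^sub>c mat_adjoint G"

lemma system_carriers [simp, intro]:
  "state1 \<in> carrier_mat (r + r) (r + r)" "state0 \<in> carrier_mat (r + r) (r + r)"
  "input1 \<in> carrier_mat (r + r) m" "input0 \<in> carrier_mat (r + r) m"
  "output1 \<in> carrier_mat m (r + r)" "output0 \<in> carrier_mat m (r + r)"
  unfolding state1_def state0_def input1_def input0_def output1_def output0_def
  using carriers by auto

text \<open>lam lies inside the unit circle, its reflection 1 / cnj lam outside, and -1 on the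
  circle.\<close>

lemma lam_facts: "1 + lam \<noteq> 0" "lam \<noteq> - 1" "w \<noteq> 0 \<Longrightarrow> w = cnj lam \<Longrightarrow> 1 / w \<noteq> lam"
  "lam \<noteq> 0 \<Longrightarrow> cnj (1 / lam) \<noteq> lam"
proof -
  show "lam \<noteq> - 1" using lam by force
  thus "1 + lam \<noteq> 0" by (simp add: add_eq_0_iff)
  have *: "1 / cnj lam \<noteq> lam" if "lam \<noteq> 0"
  proof
    assume "1 / cnj lam = lam"
    hence "cmod lam * cmod lam = 1"
      using that by (metis complex_cnj_zero_iff complex_mod_cnj nonzero_eq_divide_eq norm_mult norm_one)
    moreover have "cmod lam * cmod lam < 1 * 1"
      using lam by (intro mult_strict_mono') auto
    ultimately show False by simp
  qed
  show "1 / w \<noteq> lam" if "w \<noteq> 0" "w = cnj lam"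
    using * that by (metis complex_cnj_zero_iff)
  show "cnj (1 / lam) \<noteq> lam" if "lam \<noteq> 0"
    using *[OF that] by simp
qed

text \<open>The point w = 0 corresponds to infinity for the original pencil, where the reversed one
  has the value \<open>A1\<close>. It is listed separately because 1 / 0 = 0 in HOL, which would
  wrongly exclude it when lam = 0.\<close>

lemma rev_col_inj:
  assumes "w = 0 \<or> 1 / w \<noteq> lam" "y \<in> carrier_vec r" "(w \<cdot>\<^sub>m A0 + A1) *\<^sub>v y = 0\<^sub>v r"
  shows "y = 0\<^sub>v r"
proof (cases "w = 0")
  case True
  have "w \<cdot>\<^sub>m A0 + A1 = A1" using True carriers by (intro eq_matI) auto
  thus ?thesis using assms lead_col_inj by simp
next
  case False
  thus ?thesis
    using col_inj[OF _ assms(2) reversed_pencil_kernel[OF A1 A0 assms(2,3) False]] assms(1) by blast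
qed

lemma rev_observable:
  assumes "y \<in> carrier_vec r" "(w \<cdot>\<^sub>m A0 + A1) *\<^sub>v y = 0\<^sub>v r" "mat_adjoint G *\<^sub>v y = 0\<^sub>v m"
  shows "y = 0\<^sub>v r"
proof (cases "w = 0")
  case True
  thus ?thesis using rev_col_inj assms by blast
next
  case False
  thus ?thesis
    using observable[OF assms(1) reversed_pencil_kernel[OF A1 A0 assms(1,2) False] assms(3)] by blast
qed

lemma rev_row_inj:
  assumes "z = 0 \<or> cnj (1 / z) \<noteq> lam" "x \<in> carrier_vec r"
    "(z \<cdot>\<^sub>m mat_adjoint A0 + mat_adjoint A1) *\<^sub>v x = 0\<^sub>v r"
  shows "x = 0\<^sub>v r"
proof (cases "z = 0")
  case True
  have "z \<cdot>\<^sub>m mat_adjoint A0 + mat_adjoint A1 = mat_adjoint A1"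
    using True carriers by (intro eq_matI) auto
  thus ?thesis using assms lead_row_inj by simp
next
  case False
  \<comment> \<open>Adjoining a value of the pencil conjugates the scalar, so the adjoint reversed
    pencil at z belongs to the point cnj (1 / z) of the original one.\<close>
  have "mat_adjoint (cnj (1 / z) \<cdot>\<^sub>m A1 + A0) = (1 / z) \<cdot>\<^sub>m mat_adjoint A1 + mat_adjoint A0"
    using carriers by (subst mat_adjoint_add[of _ r r]) auto
  hence "mat_adjoint (cnj (1 / z) \<cdot>\<^sub>m A1 + A0) *\<^sub>v x = 0\<^sub>v r"
    using reversed_pencil_kernel[OF carriers(6,7) assms(2,3) False] by simp
  thus ?thesis
    using row_inj[OF _ assms(2)] False assms(1) by blast
qed

lemma rev_controllable:
  assumes "x \<in> carrier_vec r" "(z \<cdot>\<^sub>m mat_adjoint A0 + mat_adjoint A1) *\<^sub>v x = 0\<^sub>v r"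
    "mat_adjoint F *\<^sub>v x = 0\<^sub>v m"
  shows "x = 0\<^sub>v r"
proof (cases "z = 0")
  case True
  thus ?thesis using rev_row_inj assms by blast
next
  case False
  have "mat_adjoint (cnj (1 / z) \<cdot>\<^sub>m A1 + A0) = (1 / z) \<cdot>\<^sub>m mat_adjoint A1 + mat_adjoint A0"
    using carriers by (subst mat_adjoint_add[of _ r r]) auto
  hence "mat_adjoint (cnj (1 / z) \<cdot>\<^sub>m A1 + A0) *\<^sub>v x = 0\<^sub>v r"
    using reversed_pencil_kernel[OF carriers(6,7) assms(1,2) False] by simp
  thus ?thesis
    using controllable[OF assms(1) _ assms(3)] by blast
qed

lemma uminus_state_eval:
  "- mat_eval (pencil (- state1) (- state0)) z =
    (0\<^sub>m r r @\<^sub>c (z \<cdot>\<^sub>m A1 + A0)) @\<^sub>r ((z \<cdot>\<^sub>m mat_adjoint A0 + mat_adjoint A1) @\<^sub>c 0\<^sub>m r r)"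
  using carriers by (subst mat_eval_pencil[of _ "r + r" "r + r"])
    (auto intro!: eq_matI simp: state1_def state0_def)

lemma input_eval: "mat_eval (pencil input1 input0) z = F @\<^sub>r ((1 + z) \<cdot>\<^sub>m G)"
  using carriers by (subst mat_eval_pencil[of _ "r + r" m])
    (auto intro!: eq_matI simp: input1_def input0_def algebra_simps)

lemma output_eval:
  "mat_eval (pencil output1 output0) z = (z \<cdot>\<^sub>m mat_adjoint F) @\<^sub>c ((1 + z) \<cdot>\<^sub>m mat_adjoint G)"
  using carriers by (subst mat_eval_pencil[of _ m "r + r"])
    (auto intro!: eq_matI simp: output1_def output0_def algebra_simps)

text \<open>The blocks are never singular at the same point. At z = lam the reversed block is
  injective and removes its half of the vector; at every other z the block \<open>Ac\<close> removes
  the other half. The coupling equation then involves F or G alone, and the observability or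
  controllability hypothesis finishes, unless its scalar factor vanishes.\<close>

lemma minimal:
  "minimal_system (pencil (- state1) (- state0)) (pencil input1 input0) (pencil output1 output0)"
  unfolding minimal_system_def uminus_state_eval input_eval output_eval
proof (intro allI conjI)
  fix z
  show "full_row_rank (((0\<^sub>m r r @\<^sub>c (z \<cdot>\<^sub>m A1 + A0)) @\<^sub>r
      ((z \<cdot>\<^sub>m mat_adjoint A0 + mat_adjoint A1) @\<^sub>c 0\<^sub>m r r)) @\<^sub>c (F @\<^sub>r ((1 + z) \<cdot>\<^sub>m G)))"
  proof (rule antidiagonal_full_row_rank)
    fix x y
    assume xy: "x \<in> carrier_vec r" "y \<in> carrier_vec r"
      and x: "mat_adjoint (z \<cdot>\<^sub>m A1 + A0) *\<^sub>v x = 0\<^sub>v r"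
      and y: "mat_adjoint (z \<cdot>\<^sub>m mat_adjoint A0 + mat_adjoint A1) *\<^sub>v y = 0\<^sub>v r"
      and c: "mat_adjoint F *\<^sub>v x + mat_adjoint ((1 + z) \<cdot>\<^sub>m G) *\<^sub>v y = 0\<^sub>v m"
    have "mat_adjoint (z \<cdot>\<^sub>m mat_adjoint A0 + mat_adjoint A1) = cnj z \<cdot>\<^sub>m A0 + A1"
      using carriers by (subst mat_adjoint_add[of _ r r]) auto
    note y = y[unfolded this]
    have cG: "mat_adjoint ((1 + z) \<cdot>\<^sub>m G) \<in> carrier_mat m r" using carriers by auto
    show "x = 0\<^sub>v r \<and> y = 0\<^sub>v r"
    proof (cases "z = lam")
      case True
      have "cnj z = 0 \<or> 1 / cnj z \<noteq> lam"
        using lam_facts(3)[of "cnj z"] unfolding True by blast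
      hence y0: "y = 0\<^sub>v r" using rev_col_inj[OF _ xy(2) y] by blast
      hence "mat_adjoint F *\<^sub>v x = 0\<^sub>v m"
        using c unfolding y0 add_mat_mult_vec_zero(1)[OF carriers(8) cG xy(1)] by simp
      thus ?thesis using y0 controllable[OF xy(1) x] by simp
    next
      case False
      have x0: "x = 0\<^sub>v r" using row_inj[OF False xy(1) x] .
      hence "mat_adjoint ((1 + z) \<cdot>\<^sub>m G) *\<^sub>v y = 0\<^sub>v m"
        using c unfolding x0 add_mat_mult_vec_zero(2)[OF cG carriers(8) xy(2)] by simp
      hence G0: "(cnj (1 + z) \<cdot>\<^sub>m mat_adjoint G) *\<^sub>v y = 0\<^sub>v m" by simp
      show ?thesis
      proof (cases "z = -1")
        case True
        \<comment> \<open>At z = -1 the factor 1 + z deletes G from the coupling equation, but the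
          reversed block is injective at this point by itself.\<close>
        hence "1 / cnj z \<noteq> lam" using lam_facts(2) by force
        thus ?thesis using rev_col_inj[OF _ xy(2) y] x0 by blast
      next
        case False
        hence "1 + z \<noteq> 0" by (simp add: add_eq_0_iff)
        hence "cnj (1 + z) \<noteq> 0" by (simp only: complex_cnj_zero_iff not_False_eq_True)
        hence "mat_adjoint G *\<^sub>v y = 0\<^sub>v m"
          by (rule smult_mat_mult_vec_eq_0[OF G0 _ G[THEN mat_adjoint_carrier] xy(2)])
        thus ?thesis using rev_observable[OF xy(2) y] x0 by simp
      qed
    qed
  qed (simp_all add: carriers)
  show "full_col_rank (((0\<^sub>m r r @\<^sub>c (z \<cdot>\<^sub>m A1 + A0)) @\<^sub>r
      ((z \<cdot>\<^sub>m mat_adjoint A0 + mat_adjoint A1) @\<^sub>c 0\<^sub>m r r)) @\<^sub>r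
      ((z \<cdot>\<^sub>m mat_adjoint F) @\<^sub>c ((1 + z) \<cdot>\<^sub>m mat_adjoint G)))"
  proof (rule antidiagonal_full_col_rank)
    fix x y
    assume xy: "x \<in> carrier_vec r" "y \<in> carrier_vec r"
      and y: "(z \<cdot>\<^sub>m A1 + A0) *\<^sub>v y = 0\<^sub>v r"
      and x: "(z \<cdot>\<^sub>m mat_adjoint A0 + mat_adjoint A1) *\<^sub>v x = 0\<^sub>v r"
      and c: "(z \<cdot>\<^sub>m mat_adjoint F) *\<^sub>v x + ((1 + z) \<cdot>\<^sub>m mat_adjoint G) *\<^sub>v y = 0\<^sub>v m"
    have cc: "z \<cdot>\<^sub>m mat_adjoint F \<in> carrier_mat m r" "(1 + z) \<cdot>\<^sub>m mat_adjoint G \<in> carrier_mat m r"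
      using carriers by auto
    show "x = 0\<^sub>v r \<and> y = 0\<^sub>v r"
    proof (cases "z = lam")
      case True
      have "z = 0 \<or> cnj (1 / z) \<noteq> lam" using lam_facts(4) unfolding True by blast
      hence x0: "x = 0\<^sub>v r" using rev_row_inj[OF _ xy(1) x] by blast
      hence "((1 + z) \<cdot>\<^sub>m mat_adjoint G) *\<^sub>v y = 0\<^sub>v m"
        using c unfolding x0 add_mat_mult_vec_zero(2)[OF cc(2,1) xy(2)] by simp
      hence "mat_adjoint G *\<^sub>v y = 0\<^sub>v m"
        using lam_facts(1) True
        by (intro smult_mat_mult_vec_eq_0[OF _ _ G[THEN mat_adjoint_carrier] xy(2)]) simp_all
      thus ?thesis using x0 observable[OF xy(2) y] by simp
    next
      case False
      have y0: "y = 0\<^sub>v r" using col_inj[OF False xy(2) y] .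
      hence F0: "(z \<cdot>\<^sub>m mat_adjoint F) *\<^sub>v x = 0\<^sub>v m"
        using c unfolding y0 add_mat_mult_vec_zero(1)[OF cc xy(1)] by simp
      show ?thesis
      proof (cases "z = 0")
        case True
        \<comment> \<open>At z = 0 the factor z deletes F, but the reversed block is then the
          adjoint of \<open>A1\<close>, which is injective.\<close>
        thus ?thesis using rev_row_inj[OF _ xy(1) x] y0 by simp
      next
        case False
        hence "mat_adjoint F *\<^sub>v x = 0\<^sub>v m"
          by (rule smult_mat_mult_vec_eq_0[OF F0 _ F[THEN mat_adjoint_carrier] xy(1)])
        thus ?thesis using rev_controllable[OF xy(1) x] y0 by simp
      qed
    qed
  qed (simp_all add: carriers)
qed

text \<open>The leading coefficients of the two blocks are \<open>A1\<close>, injective from both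
  sides, and the adjoint of \<open>A0\<close>. Since \<open>A0\<close> is the value of the pencil at
  0, which is singular if lam = 0 is a pole, the second block is covered by the observability and
  controllability hypotheses at 0.\<close>

lemma minimal_at_infinity:
  "minimal_system_at_infinity (pencil (- state1) (- state0)) (pencil input1 input0) (pencil output1 output0)"
proof -
  have A0': "0 \<cdot>\<^sub>m A1 + A0 = A0" using carriers by (intro eq_matI) auto
  have cz: "0\<^sub>m m r \<in> carrier_mat m r" by simp
  have z: "0\<^sub>m m r *\<^sub>v w = 0\<^sub>v m" if "w \<in> carrier_vec r" for w :: "complex vec"
    using that by (intro eq_vecI) auto
  have "full_row_rank (- (- state1) @\<^sub>c input1)"
    unfolding state1_def input1_def uminus_uminus_mat
  proof (rule antidiagonal_full_row_rank)
    fix x y assume xy: "x \<in> carrier_vec r" "y \<in> carrier_vec r" "mat_adjoint A1 *\<^sub>v x = 0\<^sub>v r"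
      "mat_adjoint (mat_adjoint A0) *\<^sub>v y = 0\<^sub>v r"
      "mat_adjoint (0\<^sub>m r m) *\<^sub>v x + mat_adjoint G *\<^sub>v y = 0\<^sub>v m"
    hence "mat_adjoint G *\<^sub>v y = 0\<^sub>v m" using carriers by (simp add: z)
    hence "y = 0\<^sub>v r" using xy(2,4) observable[of y 0, unfolded A0'] by simp
    thus "x = 0\<^sub>v r \<and> y = 0\<^sub>v r" using xy(1,3) lead_row_inj by blast
  qed (simp_all add: carriers)
  moreover have "full_col_rank (- (- state1) @\<^sub>r output1)"
    unfolding state1_def output1_def uminus_uminus_mat
  proof (rule antidiagonal_full_col_rank)
    fix x y assume xy: "x \<in> carrier_vec r" "y \<in> carrier_vec r" "A1 *\<^sub>v y = 0\<^sub>v r"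
      "mat_adjoint A0 *\<^sub>v x = 0\<^sub>v r" "mat_adjoint F *\<^sub>v x + mat_adjoint G *\<^sub>v y = 0\<^sub>v m"
    have y0: "y = 0\<^sub>v r" using xy(2,3) by (rule lead_col_inj)
    hence "mat_adjoint F *\<^sub>v x = 0\<^sub>v m"
      using xy(5) unfolding y0 add_mat_mult_vec_zero(1)[OF carriers(8,9) xy(1)] by simp
    thus "x = 0\<^sub>v r \<and> y = 0\<^sub>v r"
      using controllable[OF xy(1), of 0, unfolded A0', OF xy(4)] y0 by blast
  qed (simp_all add: carriers)
  moreover have "pencil_coeffs (pencil (- state1) (- state0)) (- state1) (- state0)"
    "pencil_coeffs (pencil input1 input0) input1 (- (- input0))"
    "pencil_coeffs (pencil output1 output0) output1 (- (- output0))"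
    unfolding uminus_uminus_mat
    by (rule pencil_coeffs_pencil[OF uminus_carrier_mat uminus_carrier_mat] pencil_coeffs_pencil;
        rule system_carriers)+
  ultimately show ?thesis
    unfolding minimal_system_at_infinity_def by blast
qed

end

section \<open>The transfer function of the palindromic system\<close>

lemma uminus_mult_uminus_mat:
  fixes A B :: "'a :: comm_ring_1 mat"
  assumes "A \<in> carrier_mat n k" "B \<in> carrier_mat k l"
  shows "(- A) * (- B) = A * B"
  using assms by (intro eq_matI) (simp_all add: scalar_prod_def)

lemma antidiagonal_mult:
  fixes X Y X' Y' :: "'a :: comm_ring_1 mat"
  assumes "X \<in> carrier_mat r r" "Y \<in> carrier_mat r r" "X' \<in> carrier_mat r r" "Y' \<in> carrier_mat r r"
  shows "four_block_mat (0\<^sub>m r r) X Y (0\<^sub>m r r) * four_block_mat (0\<^sub>m r r) X' Y' (0\<^sub>m r r) =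
    four_block_mat (X * Y') (0\<^sub>m r r) (0\<^sub>m r r) (Y * X')"
  using assms by (subst mult_four_block_mat[of _ r r _ r _ r _ _ r _ r]) simp_all

lemma the_mat_inverse_eq:
  fixes A :: "'a :: field mat"
  assumes A: "A \<in> carrier_mat n n" and Y: "Y \<in> carrier_mat n n" and AY: "A * Y = 1\<^sub>m n" "Y * A = 1\<^sub>m n"
  shows "the (mat_inverse A) = Y"
proof (cases "mat_inverse A")
  case None
  moreover have "A \<in> Units (ring_mat TYPE('a) n ())"
    using assms by (auto simp: Units_def ring_mat_simps)
  ultimately show ?thesis using mat_inverse(1)[OF A, of "()"] by blast
next
  case (Some B)
  hence B: "B * A = 1\<^sub>m n" "B \<in> carrier_mat n n" using mat_inverse(2)[OF A] by auto
  have "B = B * (A * Y)" using B AY by simp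
  also have "\<dots> = (B * A) * Y" by (rule assoc_mult_mat[OF B(2) A Y, symmetric])
  also have "\<dots> = Y" using B Y by simp
  finally show ?thesis using Some by simp
qed

context palindromic_system
begin

abbreviation (input) "Ac \<equiv> pencil A1 A0"
abbreviation (input) "Ar \<equiv> pencil (mat_adjoint A0) (mat_adjoint A1)"

lemma pencil_state: "pencil state1 state0 = (0\<^sub>m r r @\<^sub>c Ac) @\<^sub>r (Ar @\<^sub>c 0\<^sub>m r r)"
  using carriers by (intro eq_matI) (auto simp: state1_def state0_def)

lemma pencil_input: "pencil input1 input0 = cmat F @\<^sub>r ((1 + zvar) \<cdot>\<^sub>m cmat G)"
  using carriers by (intro eq_matI) (auto simp: input1_def input0_def algebra_simps)

lemma pencil_output:
  "pencil output1 output0 = (zvar \<cdot>\<^sub>m cmat (mat_adjoint F)) @\<^sub>c ((1 + zvar) \<cdot>\<^sub>m cmat (mat_adjoint G))"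
  using carriers by (intro eq_matI) (auto simp: output1_def output0_def algebra_simps)

lemma pencil_feedthrough: "pencil R0 R0 = (1 + zvar) \<cdot>\<^sub>m cmat R0"
  using cmat_eq_pencil(3)[OF R0(1)] by simp

lemma uminus_pencil_uminus_state: "- pencil (- state1) (- state0) = pencil state1 state0"
  using uminus_pencil[of "- state1" "r + r" "r + r" "- state0"] by (simp add: uminus_uminus_mat)

lemma structured_pencil_eq:
  "structured_pencil Ac F G R0 = (pencil state1 state0 @\<^sub>c pencil input1 input0) @\<^sub>r
    (pencil output1 output0 @\<^sub>c pencil R0 R0)"
  unfolding structured_pencil_def rev1_mat_star_pencil[OF A1 A0] block_matrix_def
    pencil_state pencil_input pencil_output pencil_feedthrough
  using carriers by (simp add: append_interchange append_cols_assoc append_rows_assoc)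

lemma structured_pencil_system_matrix:
  "structured_pencil Ac F G R0 = block_matrix
    [[- pencil (- state1) (- state0), pencil input1 input0], [pencil output1 output0, pencil R0 R0]]"
  unfolding structured_pencil_eq uminus_pencil_uminus_state by (simp add: block_matrix_def)

lemma mat_adjoint_state: "mat_adjoint state1 = state0" "mat_adjoint input1 = output0"
  "mat_adjoint output1 = input0"
  using carriers by (simp_all add: state1_def state0_def input1_def input0_def output1_def output0_def
      mat_adjoint_append_cols mat_adjoint_append_rows append_interchange)

text \<open>The constant coefficient of the whole pencil is the adjoint of its leading coefficient:
  the state block is its own mirror image, input and output are mirror images of each other, and
  \<open>R0\<close> is self-adjoint.\<close>

lemma star_palindromic_structured_pencil: "star_palindromic (structured_pencil Ac F G R0)"
proof -
  define T1 where "T1 = (state1 @\<^sub>c input1) @\<^sub>r (output1 @\<^sub>c R0)"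
  define T0 where "T0 = (state0 @\<^sub>c input0) @\<^sub>r (output0 @\<^sub>c R0)"
  note sc = system_carriers R0(1)
  have c: "T1 \<in> carrier_mat (r + r + m) (r + r + m)" "T0 \<in> carrier_mat (r + r + m) (r + r + m)"
    unfolding T1_def T0_def by (intro carrier_append_rows append_cols_carrier sc)+
  have "pencil state1 state0 @\<^sub>c pencil input1 input0 = pencil (state1 @\<^sub>c input1) (state0 @\<^sub>c input0)"
    "pencil output1 output0 @\<^sub>c pencil R0 R0 = pencil (output1 @\<^sub>c R0) (output0 @\<^sub>c R0)"
    by (rule pencil_append_cols; rule sc)+
  hence "structured_pencil Ac F G R0 = pencil (state1 @\<^sub>c input1) (state0 @\<^sub>c input0) @\<^sub>r
      pencil (output1 @\<^sub>c R0) (output0 @\<^sub>c R0)"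
    unfolding structured_pencil_eq by simp
  also have "\<dots> = pencil T1 T0"
    unfolding T1_def T0_def by (rule pencil_append_rows[of _ "r + r" "r + r + m" _ _ m]; intro append_cols_carrier sc)
  finally have L: "structured_pencil Ac F G R0 = pencil T1 T0" .
  have "mat_adjoint T1 = T0"
    unfolding T1_def T0_def using sc[THEN carrier_matD(1)] sc[THEN carrier_matD(2)] R0(2)
    by (simp add: mat_adjoint_append_cols mat_adjoint_append_rows mat_adjoint_state append_interchange)
  moreover from this have "mat_adjoint T0 = T1" by auto
  ultimately show ?thesis
    unfolding star_palindromic_def L using is_pencil_pencil[OF c] rev1_mat_star_pencil[OF c] c by simp
qed

text \<open>The inverse of an anti-diagonal block matrix is anti-diagonal, so the product of output,
  inverse and input splits into one term through X and one through its para-conjugate. The sign in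
  the hypothesis on Q compensates for the state block being -A.\<close>

lemma
  assumes X: "X \<in> carrier_mat r r" and AX: "Ac * X = 1\<^sub>m r" "X * Ac = 1\<^sub>m r"
    and Q: "cmat (mat_adjoint G) * X * cmat F = - Q"
  shows det_state_nonzero: "det (pencil (- state1) (- state0)) \<noteq> 0"
    and transfer_function_eq:
      "transfer_function (pencil (- state1) (- state0)) (pencil input1 input0)
        (pencil output1 output0) (pencil R0 R0) = (1 + zvar) \<cdot>\<^sub>m (Q + cmat R0 + para_conj Q)"
proof -
  let ?A = "pencil (- state1) (- state0)"
  \<comment> \<open>The inverse of the reversed block, which equals z times the para-conjugate of
    \<open>Ac\<close>.\<close>
  define Z where "Z = (1 / zvar) \<cdot>\<^sub>m para_conj X"
  define Y where "Y = four_block_mat (0\<^sub>m r r) (- Z) (- X) (0\<^sub>m r r)"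
  have Z: "Z \<in> carrier_mat r r" using X by (simp add: Z_def)
  have Ac: "Ac \<in> carrier_mat r r" and Ar: "Ar \<in> carrier_mat r r" using carriers by auto
  have pX: "para_conj X \<in> carrier_mat r r" "para_conj Ac \<in> carrier_mat r r" using X Ac by auto
  have Ar_eq: "Ar = zvar \<cdot>\<^sub>m para_conj Ac"
    using rev1_mat_star_pencil[OF A1 A0] rev1_mat_star by simp
  have scal: "(zvar \<cdot>\<^sub>m M) * ((1 / zvar) \<cdot>\<^sub>m N) = M * N" "((1 / zvar) \<cdot>\<^sub>m N) * (zvar \<cdot>\<^sub>m M) = N * M"
    if "M \<in> carrier_mat r r" "N \<in> carrier_mat r r" for M N
    using that
    by (simp_all add: mult_smult_assoc_mat[of _ r r _ r] mult_smult_distrib[of _ r r _ r])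
      (auto intro!: eq_matI)
  have "Ar * Z = para_conj Ac * para_conj X" "Z * Ar = para_conj X * para_conj Ac"
    unfolding Ar_eq Z_def using scal[OF pX(2,1)] by simp_all
  hence ArZ: "Ar * Z = 1\<^sub>m r" "Z * Ar = 1\<^sub>m r"
    unfolding para_conj_mult[OF X Ac, symmetric] para_conj_mult[OF Ac X, symmetric] AX by simp_all
  have A: "?A = four_block_mat (0\<^sub>m r r) (- Ac) (- Ar) (0\<^sub>m r r)"
  proof -
    have "?A = - (- ?A)" by (simp add: uminus_uminus_mat)
    also have "\<dots> = - ((0\<^sub>m r r @\<^sub>c Ac) @\<^sub>r (Ar @\<^sub>c 0\<^sub>m r r))"
      unfolding uminus_pencil_uminus_state pencil_state ..
    also have "\<dots> = four_block_mat (0\<^sub>m r r) (- Ac) (- Ar) (0\<^sub>m r r)"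
      using carriers by (intro eq_matI) auto
    finally show ?thesis .
  qed
  have c: "?A \<in> carrier_mat (r + r) (r + r)" "Y \<in> carrier_mat (r + r) (r + r)"
    unfolding A Y_def using Ac Ar Z X by (intro four_block_carrier_mat; simp)+
  have one: "four_block_mat (1\<^sub>m r) (0\<^sub>m r r) (0\<^sub>m r r) (1\<^sub>m r) = (1\<^sub>m (r + r) :: ratfun mat)"
    by (intro eq_matI) auto
  note um = uminus_carrier_mat[OF Ac] uminus_carrier_mat[OF Ar] uminus_carrier_mat[OF X] uminus_carrier_mat[OF Z]
  have AY: "?A * Y = 1\<^sub>m (r + r)"
    unfolding A Y_def antidiagonal_mult[OF um(1,2,4,3)] uminus_mult_uminus_mat[OF Ac X]
      uminus_mult_uminus_mat[OF Ar Z] AX ArZ one ..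
  have YA: "Y * ?A = 1\<^sub>m (r + r)"
    unfolding A Y_def antidiagonal_mult[OF um(4,3,1,2)] uminus_mult_uminus_mat[OF X Ac]
      uminus_mult_uminus_mat[OF Z Ar] AX ArZ one ..
  have "det ?A * det Y = 1" using det_mult[OF c] AY by simp
  thus "det ?A \<noteq> 0" by auto
  have inv: "the (mat_inverse ?A) = Y" by (rule the_mat_inverse_eq[OF c AY YA])
  have Fc: "cmat F \<in> carrier_mat r m" "cmat G \<in> carrier_mat r m"
    "cmat (mat_adjoint F) \<in> carrier_mat m r" "cmat (mat_adjoint G) \<in> carrier_mat m r"
    "cmat R0 \<in> carrier_mat m m"
    using carriers by auto
  let ?Gs = "cmat (mat_adjoint G)" and ?Fs = "cmat (mat_adjoint F)"
  have Qc: "Q \<in> carrier_mat m m"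
  proof -
    have "- Q \<in> carrier_mat m m" unfolding Q[symmetric] using Fc X by auto
    thus ?thesis by simp
  qed
  \<comment> \<open>Para-conjugation reverses the product and exchanges F and G, so the second term
    follows from the hypothesis on the first.\<close>
  have Q': "?Fs * para_conj X * cmat G = - para_conj Q"
  proof -
    have "para_conj (?Gs * X * cmat F) = ?Fs * (para_conj X * cmat G)"
      unfolding para_conj_mult[OF mult_carrier_mat[OF Fc(4) X] Fc(1)] para_conj_mult[OF Fc(4) X] by simp
    thus ?thesis unfolding Q para_conj_uminus using Fc pX by (simp add: assoc_mult_mat[of _ m r _ r])
  qed
  have "pencil output1 output0 * Y * pencil input1 input0 =
      ((zvar \<cdot>\<^sub>m ?Fs) @\<^sub>c ((1 + zvar) \<cdot>\<^sub>m ?Gs)) * ((0\<^sub>m r r @\<^sub>c - Z) @\<^sub>r (- X @\<^sub>c 0\<^sub>m r r)) *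
      (cmat F @\<^sub>r ((1 + zvar) \<cdot>\<^sub>m cmat G))"
    unfolding Y_def pencil_output pencil_input
      append_rows_eq_four_block_mat[OF zero_carrier_mat um(4,3) zero_carrier_mat] ..
  also have "((zvar \<cdot>\<^sub>m ?Fs) @\<^sub>c ((1 + zvar) \<cdot>\<^sub>m ?Gs)) * ((0\<^sub>m r r @\<^sub>c - Z) @\<^sub>r (- X @\<^sub>c 0\<^sub>m r r)) =
      (zvar \<cdot>\<^sub>m ?Fs) * (0\<^sub>m r r @\<^sub>c - Z) + ((1 + zvar) \<cdot>\<^sub>m ?Gs) * (- X @\<^sub>c 0\<^sub>m r r)"
    using Fc um by (intro append_cols_mult_append_rows) auto
  also have "(zvar \<cdot>\<^sub>m ?Fs) * (0\<^sub>m r r @\<^sub>c - Z) = 0\<^sub>m m r @\<^sub>c (zvar \<cdot>\<^sub>m ?Fs) * (- Z)"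
    using Fc um by (subst mult_append_cols[of _ m r _ r _ r]) auto
  also have "((1 + zvar) \<cdot>\<^sub>m ?Gs) * (- X @\<^sub>c 0\<^sub>m r r) = ((1 + zvar) \<cdot>\<^sub>m ?Gs) * (- X) @\<^sub>c 0\<^sub>m m r"
    using Fc um by (subst mult_append_cols[of _ m r _ r _ r]) auto
  also have "(0\<^sub>m m r @\<^sub>c (zvar \<cdot>\<^sub>m ?Fs) * (- Z)) + (((1 + zvar) \<cdot>\<^sub>m ?Gs) * (- X) @\<^sub>c 0\<^sub>m m r) =
      ((1 + zvar) \<cdot>\<^sub>m ?Gs) * (- X) @\<^sub>c (zvar \<cdot>\<^sub>m ?Fs) * (- Z)"
    using Fc um by (intro eq_matI) auto
  also have "\<dots> * (cmat F @\<^sub>r ((1 + zvar) \<cdot>\<^sub>m cmat G)) =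
      ((1 + zvar) \<cdot>\<^sub>m ?Gs) * (- X) * cmat F + (zvar \<cdot>\<^sub>m ?Fs) * (- Z) * ((1 + zvar) \<cdot>\<^sub>m cmat G)"
    using Fc um by (intro append_cols_mult_append_rows) auto
  also have "((1 + zvar) \<cdot>\<^sub>m ?Gs) * (- X) * cmat F = (1 + zvar) \<cdot>\<^sub>m Q"
  proof -
    have GX: "- (?Gs * X) \<in> carrier_mat m r"
      by (rule uminus_carrier_mat[OF mult_carrier_mat[OF Fc(4) X]])
    have "((1 + zvar) \<cdot>\<^sub>m ?Gs) * (- X) = (1 + zvar) \<cdot>\<^sub>m (- (?Gs * X))"
      using Fc X by (intro eq_matI) (auto simp: scalar_prod_def sum_distrib_left sum_negf mult.assoc)
    hence "((1 + zvar) \<cdot>\<^sub>m ?Gs) * (- X) * cmat F = (1 + zvar) \<cdot>\<^sub>m (- (?Gs * X) * cmat F)"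
      using mult_smult_assoc_mat[OF GX Fc(1)] by simp
    also have "- (?Gs * X) * cmat F = Q"
      using Fc X Q by (simp add: uminus_uminus_mat)
    finally show ?thesis .
  qed
  also have "(zvar \<cdot>\<^sub>m ?Fs) * (- Z) * ((1 + zvar) \<cdot>\<^sub>m cmat G) = (1 + zvar) \<cdot>\<^sub>m para_conj Q"
  proof -
    have "(zvar \<cdot>\<^sub>m ?Fs) * (- Z) = - (?Fs * para_conj X)"
      using Fc pX by (intro eq_matI)
        (auto simp: Z_def scalar_prod_def sum_negf sum_distrib_left intro!: sum.cong)
    moreover have "- (?Fs * para_conj X) * ((1 + zvar) \<cdot>\<^sub>m cmat G) =
        (1 + zvar) \<cdot>\<^sub>m (- (?Fs * para_conj X) * cmat G)"
      by (rule mult_smult_distrib[OF uminus_carrier_mat[OF mult_carrier_mat[OF Fc(3) pX(1)]] Fc(2)])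
    moreover have "- (?Fs * para_conj X) * cmat G = para_conj Q"
      using Fc X Q' by (simp add: uminus_uminus_mat)
    ultimately show ?thesis by simp
  qed
  finally have "transfer_function ?A (pencil input1 input0) (pencil output1 output0) (pencil R0 R0) =
      (1 + zvar) \<cdot>\<^sub>m cmat R0 + ((1 + zvar) \<cdot>\<^sub>m Q + (1 + zvar) \<cdot>\<^sub>m para_conj Q)"
    unfolding transfer_function_def inv pencil_feedthrough by simp
  also have "\<dots> = (1 + zvar) \<cdot>\<^sub>m (Q + cmat R0 + para_conj Q)"
    using Qc Fc by (intro eq_matI) (auto simp: algebra_simps)
  finally show "transfer_function ?A (pencil input1 input0) (pencil output1 output0) (pencil R0 R0) =
    (1 + zvar) \<cdot>\<^sub>m (Q + cmat R0 + para_conj Q)" .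
qed

lemma strongly_minimal_linearization_structured_pencil:
  assumes "X \<in> carrier_mat r r" "Ac * X = 1\<^sub>m r" "X * Ac = 1\<^sub>m r"
    and "cmat (mat_adjoint G) * X * cmat F = - Q"
  shows "strongly_minimal_linearization (2 * r) (structured_pencil Ac F G R0)
    ((1 + zvar) \<cdot>\<^sub>m (Q + cmat R0 + para_conj Q))"
proof -
  note sc = system_carriers
  have cA: "pencil (- state1) (- state0) \<in> carrier_mat (r + r) (r + r)"
    by (intro pencil_carrier uminus_carrier_mat sc)
  have "is_pencil (pencil (- state1) (- state0))" "is_pencil (pencil input1 input0)"
    "is_pencil (pencil output1 output0)" "is_pencil (pencil R0 R0)"
    by (rule is_pencil_pencil[OF uminus_carrier_mat uminus_carrier_mat] is_pencil_pencil; rule sc R0)+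
  hence "linear_system_matrix (pencil (- state1) (- state0)) (pencil input1 input0)
      (pencil output1 output0) (pencil R0 R0)"
    using det_state_nonzero[OF assms] cA sc[THEN carrier_matD(1)] sc[THEN carrier_matD(2)]
      R0(1)[THEN carrier_matD(1)] R0(1)[THEN carrier_matD(2)]
    unfolding linear_system_matrix_def regular_pencil_def by simp
  thus ?thesis
    unfolding strongly_minimal_linearization_def mult_2
    using cA structured_pencil_system_matrix minimal minimal_at_infinity transfer_function_eq[OF assms]
    by blast
qed

end

section \<open>The block shift\<close>

text \<open>One block step is a shift by m scalar positions, which avoids division with remainder in
  this definition.\<close>

definition block_shift :: "nat \<Rightarrow> nat \<Rightarrow> complex mat" where
  "block_shift n m = mat n n (\<lambda>(i, j). if i = j + m then 1 else 0)"

definition last_block :: "nat \<Rightarrow> nat \<Rightarrow> complex mat" where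
  "last_block n m = mat n m (\<lambda>(i, j). if i = n - m + j then 1 else 0)"

lemma block_shift_carrier [simp]: "block_shift n m \<in> carrier_mat n n"
  by (simp add: block_shift_def)

lemma dim_block_shift [simp]: "dim_row (block_shift n m) = n" "dim_col (block_shift n m) = n"
  by (simp_all add: block_shift_def)

lemma last_block_carrier [simp]: "last_block n m \<in> carrier_mat n m"
  by (simp add: last_block_def)

lemma cnj_if: "cnj (if b then 1 else 0) = (if b then 1 else 0)"
  by simp

lemma sum_single:
  fixes f :: "nat \<Rightarrow> 'a :: semiring_1"
  shows "(\<Sum>k = 0..<n. (if k = a then 1 else 0) * f k) = (if a < n then f a else 0)"
    "(\<Sum>k = 0..<n. f k * (if k = a then 1 else 0)) = (if a < n then f a else 0)"
proof -
  have "(if k = a then 1 else 0) * f k = (if k = a then f k else 0)"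
    "f k * (if k = a then 1 else 0) = (if k = a then f k else 0)" for k by simp_all
  thus "(\<Sum>k = 0..<n. (if k = a then 1 else 0) * f k) = (if a < n then f a else 0)"
    "(\<Sum>k = 0..<n. f k * (if k = a then 1 else 0)) = (if a < n then f a else 0)"
    by (simp_all only:) (simp_all add: sum.delta)
qed

lemma sum_shift:
  fixes f :: "nat \<Rightarrow> 'a :: semiring_1"
  assumes "i < n"
  shows "(\<Sum>k = 0..<n. (if i = k + m then 1 else 0) * f k) = (if m \<le> i then f (i - m) else 0)"
    "(\<Sum>k = 0..<n. f k * (if i = k + m then 1 else 0)) = (if m \<le> i then f (i - m) else 0)"
proof -
  have *: "i = k + m \<longleftrightarrow> m \<le> i \<and> k = i - m" for k by linarith
  show "(\<Sum>k = 0..<n. (if i = k + m then 1 else 0) * f k) = (if m \<le> i then f (i - m) else 0)"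
    unfolding * using assms less_imp_diff_less[OF assms, of m]
    by (cases "m \<le> i") (simp_all only: simp_thms sum_single, simp_all)
  show "(\<Sum>k = 0..<n. f k * (if i = k + m then 1 else 0)) = (if m \<le> i then f (i - m) else 0)"
    unfolding * using assms less_imp_diff_less[OF assms, of m]
    by (cases "m \<le> i") (simp_all only: simp_thms sum_single, simp_all)
qed

lemma index_block_shift_mult:
  assumes "A \<in> carrier_mat n k" "i < n" "j < k"
  shows "(block_shift n m * A) $$ (i, j) = (if m \<le> i then A $$ (i - m, j) else 0)"
  using assms by (simp add: block_shift_def scalar_prod_def sum_shift)

lemma index_mult_adjoint_block_shift:
  assumes "A \<in> carrier_mat k n" "i < k" "j < n"
  shows "(A * mat_adjoint (block_shift n m)) $$ (i, j) = (if m \<le> j then A $$ (i, j - m) else 0)"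
  using assms by (simp add: block_shift_def scalar_prod_def sum_shift cnj_if)

lemma index_mult_last_block:
  assumes "A \<in> carrier_mat k n" "i < k" "j < m" "m \<le> n"
  shows "(A * last_block n m) $$ (i, j) = A $$ (i, n - m + j)"
  using assms by (simp add: last_block_def scalar_prod_def sum_single)

lemma index_adjoint_last_block_mult:
  assumes "A \<in> carrier_mat n k" "i < m" "j < k" "m \<le> n"
  shows "(mat_adjoint (last_block n m) * A) $$ (i, j) = A $$ (n - m + i, j)"
  using assms by (simp add: last_block_def scalar_prod_def sum_single cnj_if)

lemma index_block_shift_mult_vec:
  assumes "u \<in> carrier_vec n" "i < n"
  shows "(block_shift n m *\<^sub>v u) $ i = (if m \<le> i then u $ (i - m) else 0)"
  using assms by (simp add: block_shift_def scalar_prod_def sum_shift)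

lemma index_adjoint_last_block_mult_vec:
  assumes "u \<in> carrier_vec n" "i < m" "m \<le> n"
  shows "(mat_adjoint (last_block n m) *\<^sub>v u) $ i = u $ (n - m + i)"
  using assms by (simp add: last_block_def scalar_prod_def sum_single cnj_if)

text \<open>The block shift is nilpotent, and the last block is a cyclic observation for it.\<close>

lemma block_shift_eigenvector:
  assumes u: "u \<in> carrier_vec n" and m: "0 < m" "m \<le> n"
    and eq: "\<mu> \<cdot>\<^sub>v u + block_shift n m *\<^sub>v u = 0\<^sub>v n"
    and "\<mu> \<noteq> 0 \<or> mat_adjoint (last_block n m) *\<^sub>v u = 0\<^sub>v m"
  shows "u = 0\<^sub>v n"
proof -
  have eq: "\<mu> * u $ i + (if m \<le> i then u $ (i - m) else 0) = 0" if "i < n" for i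
  proof -
    have "(\<mu> \<cdot>\<^sub>v u + block_shift n m *\<^sub>v u) $ i = 0" using eq that by simp
    thus ?thesis using u that by (simp add: index_block_shift_mult_vec del: index_mult_mat_vec)
  qed
  have "u $ i = 0" if "i < n" for i
  proof (cases "\<mu> = 0")
    case False
    show ?thesis using that
    \<comment> \<open>Forward substitution: the equation in position i determines \<mu> u_i from the
      entry one block earlier.\<close>
    proof (induction i rule: less_induct)
      case (less i)
      have "(if m \<le> i then u $ (i - m) else 0) = 0"
        using less.IH[of "i - m"] less.prems m by auto
      thus ?case using eq[OF less.prems] False by simp
    qed
  next
    case True
    hence last: "u $ (n - m + j) = 0" if "j < m" for j
    proof -
      have "(mat_adjoint (last_block n m) *\<^sub>v u) $ j = 0" using assms(5) True that by simp
      thus ?thesis unfolding index_adjoint_last_block_mult_vec[OF u that m(2)] .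
    qed
    show ?thesis
    proof (cases "n - m \<le> i")
      case True
      thus ?thesis using last[of "i - (n - m)"] that m by simp
    next
      case False
      \<comment> \<open>For \<mu> = 0 the equation one block further down reads u_i = 0; only the
        last block has no such equation.\<close>
      thus ?thesis using eq[of "i + m"] \<open>\<mu> = 0\<close> by simp
    qed
  qed
  thus ?thesis using u by (intro eq_vecI) auto
qed

text \<open>H and S are kept abstract and only the relation S = P H is assumed, so that the lemma
  serves twice: for the columns of the compressed pencil, and for its rows with U and V exchanged
  and H and S replaced by their adjoints.\<close>

lemma compressed_pencil_kernel:
  fixes H S U V :: "complex mat"
  assumes c: "H \<in> carrier_mat n n" "U \<in> carrier_mat n r" "V \<in> carrier_mat n r"
    and m: "0 < m" "m \<le> n"
    and S: "S \<in> carrier_mat n n" "S = block_shift n m * H" "U * mat_adjoint U * H = H" "U * mat_adjoint U * S = S"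
    and y: "y \<in> carrier_vec r"
      "(\<mu> \<cdot>\<^sub>m (mat_adjoint U * H * V) + mat_adjoint U * S * V) *\<^sub>v y = 0\<^sub>v r"
    and inj: "\<And>y. y \<in> carrier_vec r \<Longrightarrow> (mat_adjoint U * H * V) *\<^sub>v y = 0\<^sub>v r \<Longrightarrow> y = 0\<^sub>v r"
    and obs: "\<mu> \<noteq> 0 \<or> (mat_adjoint (last_block n m) * H * V) *\<^sub>v y = 0\<^sub>v m"
  shows "y = 0\<^sub>v r"
proof -
  note cU = mat_adjoint_carrier[OF c(2)]
  note cE = mat_adjoint_carrier[OF last_block_carrier[of n m]]
  define u where "u = H *\<^sub>v (V *\<^sub>v y)"
  have Vy: "V *\<^sub>v y \<in> carrier_vec n" using c y by simp
  have u: "u \<in> carrier_vec n" using c Vy by (simp add: u_def)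
  have assoc: "(A * B * V) *\<^sub>v y = A *\<^sub>v (B *\<^sub>v (V *\<^sub>v y))"
    if "A \<in> carrier_mat k n" "B \<in> carrier_mat n n" for A B k
    unfolding assoc_mult_mat_vec[OF mult_carrier_mat[OF that] c(3) y(1)]
    by (rule assoc_mult_mat_vec[OF that Vy])
  have proj: "U *\<^sub>v (mat_adjoint U *\<^sub>v (B *\<^sub>v (V *\<^sub>v y))) = B *\<^sub>v (V *\<^sub>v y)"
    if "B \<in> carrier_mat n n" "U * mat_adjoint U * B = B" for B
  proof -
    have "B *\<^sub>v (V *\<^sub>v y) = (U * mat_adjoint U * B) *\<^sub>v (V *\<^sub>v y)" using that by simp
    also have "\<dots> = U *\<^sub>v (mat_adjoint U *\<^sub>v (B *\<^sub>v (V *\<^sub>v y)))"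
      unfolding assoc_mult_mat_vec[OF mult_carrier_mat[OF c(2) cU] that(1) Vy]
      by (rule assoc_mult_mat_vec[OF c(2) cU mult_mat_vec_carrier[OF that(1) Vy]])
    finally show ?thesis ..
  qed
  have Su: "S *\<^sub>v (V *\<^sub>v y) = block_shift n m *\<^sub>v u"
    using c Vy unfolding S(2) u_def by (intro assoc_mult_mat_vec[of _ n n _ n]) simp_all
  have "0\<^sub>v r = \<mu> \<cdot>\<^sub>v (mat_adjoint U *\<^sub>v u) + mat_adjoint U *\<^sub>v (S *\<^sub>v (V *\<^sub>v y))"
  proof -
    have cc: "mat_adjoint U * H * V \<in> carrier_mat r r" "mat_adjoint U * S * V \<in> carrier_mat r r"
      by (rule mult_carrier_mat[OF mult_carrier_mat[OF cU] c(3)], fact c S)+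
    have "(\<mu> \<cdot>\<^sub>m (mat_adjoint U * H * V) + mat_adjoint U * S * V) *\<^sub>v y =
      \<mu> \<cdot>\<^sub>v ((mat_adjoint U * H * V) *\<^sub>v y) + (mat_adjoint U * S * V) *\<^sub>v y"
      using cc y by (simp add: add_mult_distrib_mat_vec[of _ r r] smult_mat_mult_vec[of _ r r])
    thus ?thesis using y(2) assoc[OF cU c(1)] assoc[OF cU S(1)] by (simp add: u_def)
  qed
  hence "U *\<^sub>v 0\<^sub>v r = U *\<^sub>v (\<mu> \<cdot>\<^sub>v (mat_adjoint U *\<^sub>v u) + mat_adjoint U *\<^sub>v (S *\<^sub>v (V *\<^sub>v y)))"
    by simp
  also have "\<dots> = \<mu> \<cdot>\<^sub>v (U *\<^sub>v (mat_adjoint U *\<^sub>v u)) + U *\<^sub>v (mat_adjoint U *\<^sub>v (S *\<^sub>v (V *\<^sub>v y)))"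
  proof -
    have Uu: "mat_adjoint U *\<^sub>v u \<in> carrier_vec r" "mat_adjoint U *\<^sub>v (S *\<^sub>v (V *\<^sub>v y)) \<in> carrier_vec r"
      using cU S(1) u Vy by simp_all
    show ?thesis
      unfolding mult_add_distrib_mat_vec[OF c(2) smult_carrier_vec[THEN iffD2, OF Uu(1)] Uu(2)]
        mult_mat_vec[OF c(2) Uu(1)] ..
  qed
  also have "\<dots> = \<mu> \<cdot>\<^sub>v u + block_shift n m *\<^sub>v u"
    using proj[OF c(1) S(3)] proj[OF S(1,4)] Su by (simp add: u_def)
  finally have "U *\<^sub>v 0\<^sub>v r = \<mu> \<cdot>\<^sub>v u + block_shift n m *\<^sub>v u" .
  moreover have "U *\<^sub>v 0\<^sub>v r = 0\<^sub>v n" using c by (intro eq_vecI) auto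
  ultimately have eq: "\<mu> \<cdot>\<^sub>v u + block_shift n m *\<^sub>v u = 0\<^sub>v n" by simp
  have "\<mu> \<noteq> 0 \<or> mat_adjoint (last_block n m) *\<^sub>v u = 0\<^sub>v m"
    using obs assoc[OF cE c(1)] by (simp add: u_def)
  hence "u = 0\<^sub>v n" by (rule block_shift_eigenvector[OF u m eq])
  \<comment> \<open>The compressed Hankel matrix maps y to the image of u = 0 under the adjoint of
    U, and it is injective.\<close>
  hence "(mat_adjoint U * H * V) *\<^sub>v y = 0\<^sub>v r"
    using assoc[OF cU c(1)] c(2) by (auto simp flip: u_def intro!: eq_vecI)
  thus ?thesis using inj y by blast
qed

section \<open>The block Hankel matrix\<close>

locale block_hankel =
  fixes d m :: nat and R :: "nat \<Rightarrow> complex mat"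
  assumes d: "0 < d" and m: "0 < m" and R: "\<And>j. j \<le> d \<Longrightarrow> R j \<in> carrier_mat m m"
begin

abbreviation (input) "H \<equiv> hankel_mat d m R"
abbreviation (input) "n \<equiv> d * m"
definition "S = block_shift n m * H"

lemma hankel_carrier [simp]: "H \<in> carrier_mat n n"
  by (simp add: hankel_mat_def uniform_block_matrix_def)

lemma S_carrier [simp]: "S \<in> carrier_mat n n"
  unfolding S_def by (rule mult_carrier_mat[OF block_shift_carrier hankel_carrier])

lemma m_le_n: "m \<le> n" using d by simp

lemma coef_carrier: "coef d m R k \<in> carrier_mat m m"
  using R by (simp add: coef_def)

lemma index_hankel:
  assumes "i < n" "j < n"
  shows "H $$ (i, j) = coef d m R (2 * d - 1 - i div m - j div m) $$ (i mod m, j mod m)"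
proof -
  have "2 * d + 1 - (i div m + 1) - (j div m + 1) = 2 * d - 1 - i div m - j div m" by simp
  thus ?thesis using assms by (simp add: hankel_mat_def uniform_block_matrix_def)
qed

lemma div_less: "i < n \<Longrightarrow> i div m < d"
  by (simp add: less_mult_imp_div_less)

lemma div_mod_diff:
  assumes "m \<le> i"
  shows "(i - m) div m = i div m - 1" "(i - m) mod m = i mod m" "1 \<le> i div m"
  using assms m by (simp_all add: le_div_geq le_mod_geq)

text \<open>Moving the block rows down by one raises every index by one. With blocks counted from 0
  this is the coefficient
  \<open>R\<^sub>2\<^sub>d\<^sub>+\<^sub>2\<^sub>-\<^sub>i\<^sub>-\<^sub>j\<close> of the definition
  of M.\<close>

lemma index_S:
  assumes "i < n" "j < n"
  shows "S $$ (i, j) = coef d m R (2 * d - i div m - j div m) $$ (i mod m, j mod m)"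
proof (cases "m \<le> i")
  case True
  have "2 * d - 1 - (i div m - 1) - j div m = 2 * d - i div m - j div m"
    using div_mod_diff[OF True] div_less[OF assms(1)] div_less[OF assms(2)] by simp
  thus ?thesis
    using True assms index_hankel[of "i - m" j] div_mod_diff[OF True]
    by (simp add: S_def index_block_shift_mult[of _ n n])
next
  case False
  \<comment> \<open>The shift leaves zeros in the first block row; there the index exceeds d, so the
    convention \<open>R\<^sub>k = 0\<close> for k > d yields the same.\<close>
  hence "d < 2 * d - i div m - j div m" using div_less[OF assms(2)] by simp
  thus ?thesis
    using False assms m by (simp add: S_def index_block_shift_mult[of _ n n] coef_def)
qed

text \<open>Moving the block rows down and moving the block columns right both shift the anti-diagonals
  of \<open>H\<close> by one block.\<close>

lemma S_eq_mult_adjoint: "S = H * mat_adjoint (block_shift n m)"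
proof (rule eq_matI)
  fix i j assume "i < dim_row (H * mat_adjoint (block_shift n m))"
    "j < dim_col (H * mat_adjoint (block_shift n m))"
  hence ij: "i < n" "j < n" by (simp_all add: block_shift_def hankel_mat_def uniform_block_matrix_def)
  show "S $$ (i, j) = (H * mat_adjoint (block_shift n m)) $$ (i, j)"
  proof (cases "m \<le> j")
    case True
    have "2 * d - 1 - i div m - (j div m - 1) = 2 * d - i div m - j div m"
      using div_mod_diff[OF True] div_less[OF ij(1)] div_less[OF ij(2)] by simp
    thus ?thesis
      using True ij index_hankel[of i "j - m"] div_mod_diff[OF True]
      by (simp add: index_S index_mult_adjoint_block_shift[of _ n n])
  next
    case False
    hence "d < 2 * d - i div m - j div m" using div_less[OF ij(1)] by simp
    thus ?thesis
      using False ij m by (simp add: index_S index_mult_adjoint_block_shift[of _ n n] coef_def)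
  qed
qed (use hankel_carrier S_carrier in \<open>simp_all add: block_shift_def del: S_carrier hankel_carrier\<close>)

lemma M_pencil_eq: "M_pencil lam d m R = pencil (- H) (lam \<cdot>\<^sub>m H + S)"
proof (rule eq_matI)
  have dims: "dim_row H = n" "dim_col H = n" "dim_row S = n" "dim_col S = n"
    using hankel_carrier S_carrier by blast+
  fix i j assume "i < dim_row (pencil (- H) (lam \<cdot>\<^sub>m H + S))" "j < dim_col (pencil (- H) (lam \<cdot>\<^sub>m H + S))"
  hence ij: "i < n" "j < n" by (simp_all add: dims)
  have e: "2 * d + 1 - (i div m + 1) - (j div m + 1) = 2 * d - 1 - i div m - j div m"
    "2 * d + 2 - (i div m + 1) - (j div m + 1) = 2 * d - i div m - j div m" by simp_all
  have mm: "i mod m < m" "j mod m < m" using m by simp_all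
  have "M_pencil lam d m R $$ (i, j) = rconst (S $$ (i, j)) + (rconst lam - zvar) * rconst (H $$ (i, j))"
    unfolding M_pencil_def uniform_block_matrix_def e
    using ij mm coef_carrier e by (simp add: index_S index_hankel carrier_matD[OF coef_carrier])
  thus "M_pencil lam d m R $$ (i, j) = pencil (- H) (lam \<cdot>\<^sub>m H + S) $$ (i, j)"
    using ij by (simp add: dims algebra_simps)
qed (use hankel_carrier S_carrier in \<open>auto simp: M_pencil_def uniform_block_matrix_def carrier_matD[OF S_carrier]\<close>)

text \<open>The last block column of H consists of \<open>R\<^sub>d\<close>, ...,
  \<open>R\<^sub>1\<close>, and so does its last block row, which \<open>G_mat_eq\<close> uses.
  Hence every projection that fixes H, and every matrix that annihilates it on the relevant side,
  does the same for F and for the adjoint of G.\<close>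

lemma F_mat_eq: "F_mat d m R = H * last_block n m"
proof (rule eq_matI)
  fix i j assume "i < dim_row (H * last_block n m)" "j < dim_col (H * last_block n m)"
  hence ij: "i < n" "j < m" by (simp_all add: last_block_def hankel_mat_def uniform_block_matrix_def)
  have "n - m + j = (d - 1) * m + j" by (simp add: diff_mult_distrib)
  hence *: "(n - m + j) div m = d - 1" "(n - m + j) mod m = j" using ij m by simp_all
  have "n - m + j < n" using ij m_le_n by simp
  moreover have "2 * d - 1 - i div m - (d - 1) = d - i div m"
    using div_less[OF ij(1)] by simp
  ultimately have "(H * last_block n m) $$ (i, j) = R (d - i div m) $$ (i mod m, j)"
    using ij m_le_n index_hankel[of i "n - m + j"] *
    by (simp add: index_mult_last_block[of _ n n] coef_def)
  moreover have "d + 1 - (i div m + 1) = d - i div m" by simp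
  ultimately show "F_mat d m R $$ (i, j) = (H * last_block n m) $$ (i, j)"
    using ij by (simp add: F_mat_def uniform_block_matrix_def)
qed (simp_all add: F_mat_def last_block_def hankel_mat_def uniform_block_matrix_def)

lemma G_mat_eq: "mat_adjoint (G_mat d m R) = mat_adjoint (last_block n m) * H"
proof (rule eq_matI)
  fix i j assume "i < dim_row (mat_adjoint (last_block n m) * H)" "j < dim_col (mat_adjoint (last_block n m) * H)"
  hence ij: "i < m" "j < n" by (simp_all add: last_block_def hankel_mat_def uniform_block_matrix_def)
  have "n - m + i = (d - 1) * m + i" by (simp add: diff_mult_distrib)
  hence *: "(n - m + i) div m = d - 1" "(n - m + i) mod m = i" using ij m by simp_all
  have "n - m + i < n" using ij m_le_n by simp
  moreover have "2 * d - 1 - (d - 1) - j div m = d - j div m"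
    using div_less[OF ij(2)] by simp
  ultimately have "(mat_adjoint (last_block n m) * H) $$ (i, j) = R (d - j div m) $$ (i, j mod m)"
    using ij m_le_n index_hankel[of "n - m + i" j] *
    by (simp add: index_adjoint_last_block_mult[of _ n n] coef_def)
  moreover have "d + 1 - (j div m + 1) = d - j div m" by simp
  moreover have "R (d - j div m) \<in> carrier_mat m m" using R by simp
  ultimately show "mat_adjoint (G_mat d m R) $$ (i, j) = (mat_adjoint (last_block n m) * H) $$ (i, j)"
    using ij m by (simp add: G_mat_def uniform_block_matrix_def)
qed (simp_all add: G_mat_def last_block_def hankel_mat_def uniform_block_matrix_def)

end

section \<open>The resolvent of the block shift and the polar part\<close>

context block_hankel
begin

text \<open>The last block row of the inverse of \<open>(lam - z) I + P\<close>, where \<open>P\<close> is the block shift.\<close>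

definition resolvent_row :: "complex \<Rightarrow> ratfun mat" where
  "resolvent_row lam = mat m n (\<lambda>(b, a).
     if a mod m = b then - 1 / (zvar - rconst lam) ^ (d - a div m) else 0)"

lemma resolvent_row_carrier [simp]: "resolvent_row lam \<in> carrier_mat m n"
  by (simp add: resolvent_row_def)

text \<open>With x = z - lam, column c of the product is -x W(c) + W(c + m). The powers of x in
  consecutive blocks differ by one, so both terms cancel; in the last block the second term is
  absent and -x (-1/x) = 1 remains.\<close>

lemma resolvent_row_mult_shift:
  "resolvent_row lam * pencil (- 1\<^sub>m n) (lam \<cdot>\<^sub>m 1\<^sub>m n + block_shift n m) =
    cmat (mat_adjoint (last_block n m))"
proof (rule eq_matI)
  let ?W = "resolvent_row lam"
  define x where "x = zvar - rconst lam"
  have x: "x \<noteq> 0" using zvar_neq_rconst by (simp add: x_def)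
  fix b c assume "b < dim_row (cmat (mat_adjoint (last_block n m)))"
    "c < dim_col (cmat (mat_adjoint (last_block n m)))"
  hence bc: "b < m" "c < n" by (simp_all add: last_block_def)
  have J: "pencil (- 1\<^sub>m n) (lam \<cdot>\<^sub>m 1\<^sub>m n + block_shift n m) $$ (a, c) =
      - x * (if a = c then 1 else 0) + (if a = c + m then 1 else 0)" if "a < n" for a
    using that bc m by (simp add: block_shift_def x_def)
  have "(?W * pencil (- 1\<^sub>m n) (lam \<cdot>\<^sub>m 1\<^sub>m n + block_shift n m)) $$ (b, c) =
      (\<Sum>a = 0..<n. ?W $$ (b, a) * pencil (- 1\<^sub>m n) (lam \<cdot>\<^sub>m 1\<^sub>m n + block_shift n m) $$ (a, c))"
    using bc by (simp add: scalar_prod_def resolvent_row_def)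
  also have "\<dots> = (\<Sum>a = 0..<n. - x * (?W $$ (b, a) * (if a = c then 1 else 0)) +
      ?W $$ (b, a) * (if a = c + m then 1 else 0))"
    by (intro sum.cong refl) (simp only: J atLeastLessThan_iff distrib_left mult_ac)
  also have "\<dots> = - x * ?W $$ (b, c) + (if c + m < n then ?W $$ (b, c + m) else 0)"
    using bc by (simp only: sum.distrib sum_distrib_left[symmetric] sum_single if_True)
  also have "\<dots> = (if c = n - m + b then 1 else 0)"
  proof (cases "c + m < n")
    case True
    define k where "k = d - Suc (c div m)"
    have "(c + m) div m = Suc (c div m)" "(c + m) mod m = c mod m" using m by simp_all
    moreover from this have "d - c div m = Suc k" using div_less[OF True] by (simp add: k_def)
    moreover have "d - Suc (c div m) = k" by (simp add: k_def)
    ultimately have "- x * ?W $$ (b, c) + ?W $$ (b, c + m) = 0"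
      using bc True x by (simp add: resolvent_row_def flip: x_def)
    thus ?thesis using True by simp
  next
    case False
    have nm: "n = (d - 1) * m + m" using d by (cases d) simp_all
    define t where "t = c - (d - 1) * m"
    have t: "c = (d - 1) * m + t" "t < m" using False bc nm by (auto simp: t_def)
    hence "c div m = d - 1" "c mod m = t" by simp_all
    thus ?thesis
      using False bc x d t nm by (auto simp: resolvent_row_def simp flip: x_def)
  qed
  also have "\<dots> = cmat (mat_adjoint (last_block n m)) $$ (b, c)"
    using bc by (simp add: last_block_def)
  finally show "(?W * pencil (- 1\<^sub>m n) (lam \<cdot>\<^sub>m 1\<^sub>m n + block_shift n m)) $$ (b, c) =
    cmat (mat_adjoint (last_block n m)) $$ (b, c)" .
qed (simp_all add: resolvent_row_def last_block_def)

lemma resolvent_row_mult_M: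
  "resolvent_row lam * pencil (- H) (lam \<cdot>\<^sub>m H + S) = cmat (mat_adjoint (last_block n m) * H)"
proof -
  let ?J = "pencil (- 1\<^sub>m n) (lam \<cdot>\<^sub>m 1\<^sub>m n + block_shift n m)"
  have J: "?J \<in> carrier_mat n n" by (intro pencil_carrier) simp
  have "?J * cmat H = pencil (- 1\<^sub>m n * H) ((lam \<cdot>\<^sub>m 1\<^sub>m n + block_shift n m) * H)"
    by (rule pencil_mult_cmat[of _ n n _ _ n]) simp_all
  also have "- 1\<^sub>m n * H = - H" by (simp add: carrier_matD[OF hankel_carrier])
  also have "(lam \<cdot>\<^sub>m 1\<^sub>m n + block_shift n m) * H = lam \<cdot>\<^sub>m H + S"
    using hankel_carrier
    by (simp add: add_mult_distrib_mat[of _ n n _ _ n] mult_smult_assoc_mat[of _ n n _ n] S_def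
        left_mult_one_mat[OF hankel_carrier])
  finally have "pencil (- H) (lam \<cdot>\<^sub>m H + S) = ?J * cmat H" ..
  hence "resolvent_row lam * pencil (- H) (lam \<cdot>\<^sub>m H + S) = (resolvent_row lam * ?J) * cmat H"
    using assoc_mult_mat[OF resolvent_row_carrier J, of "cmat H" n] hankel_carrier by simp
  also have "\<dots> = cmat (mat_adjoint (last_block n m) * H)"
    unfolding resolvent_row_mult_shift
    by (rule rconst.mat_hom_mult[OF mat_adjoint_carrier[OF last_block_carrier] hankel_carrier, symmetric])
  finally show ?thesis .
qed

text \<open>Counting blocks from 0, block i of the row carries the power d - i of z - lam and block
  i of F is \<open>R\<^sub>d\<^sub>-\<^sub>i\<close>, so index and exponent agree as in the polar
  part.\<close>

lemma resolvent_row_mult_F: "resolvent_row lam * cmat (F_mat d m R) = - polar_part lam d m R"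
proof (rule eq_matI)
  let ?x = "zvar - rconst lam"
  fix b c assume "b < dim_row (- polar_part lam d m R)" "c < dim_col (- polar_part lam d m R)"
  hence bc: "b < m" "c < m" by (simp_all add: polar_part_def)
  define f where "f a = resolvent_row lam $$ (b, a) * rconst (F_mat d m R $$ (a, c))" for a
  define g where "g j = rconst (R j $$ (b, c)) / ?x ^ j" for j
  \<comment> \<open>Row b of a block of \<open>resolvent_row\<close> has its only nonzero entry at
    offset b.\<close>
  have block: "sum f {i * m..<i * m + m} = - g (d - i)" if i: "i < d" for i
  proof -
    have f: "f (i * m + t) = (if t = b then - g (d - i) else 0)" if t: "t < m" for t
    proof -
      have e: "(i * m + t) div m = i" "(i * m + t) mod m = t" using t by simp_all
      have "i * m + t < Suc i * m" using t by simp
      also have "\<dots> \<le> n" using i by (intro mult_le_mono1) simp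
      finally show ?thesis
        using bc i e by (simp add: f_def g_def resolvent_row_def F_mat_def uniform_block_matrix_def)
    qed
    have "sum f {i * m..<i * m + m} = sum f {i * m + b}"
    proof (rule sum.mono_neutral_right)
      show "\<forall>a\<in>{i * m..<i * m + m} - {i * m + b}. f a = 0"
      proof
        fix a assume a: "a \<in> {i * m..<i * m + m} - {i * m + b}"
        hence "a - i * m < m" "a - i * m \<noteq> b" "i * m + (a - i * m) = a" by auto
        thus "f a = 0" using f[of "a - i * m"] by simp
      qed
    qed (use bc in auto)
    thus ?thesis using f[OF bc(1)] by simp
  qed
  have "(resolvent_row lam * cmat (F_mat d m R)) $$ (b, c) = sum f {..<n}"
    using bc by (simp add: scalar_prod_def f_def resolvent_row_def F_mat_def uniform_block_matrix_def
        lessThan_atLeast0)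
  also have "\<dots> = (\<Sum>i<d. sum f {i * m..<i * m + m})" by (rule sum.nat_group[symmetric])
  also have "\<dots> = (\<Sum>i<d. - g (d - i))" using block by (intro sum.cong) auto
  \<comment> \<open>The order of summation is reversed by j = d - i.\<close>
  also have "\<dots> = - (\<Sum>j = 1..d. g j)"
    unfolding sum_negf
    by (intro arg_cong[of _ _ uminus] sum.reindex_bij_witness[of _ "\<lambda>j. d - j" "\<lambda>i. d - i"]) auto
  also have "\<dots> = (- polar_part lam d m R) $$ (b, c)"
    using bc by (simp add: polar_part_def g_def)
  finally show "(resolvent_row lam * cmat (F_mat d m R)) $$ (b, c) = (- polar_part lam d m R) $$ (b, c)" .
qed (simp_all add: resolvent_row_def F_mat_def uniform_block_matrix_def polar_part_def)

end

section \<open>The compressed Hankel data as a palindromic system\<close>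

lemma mult_assoc_dim:
  fixes A B C :: "'a :: semiring_0 mat"
  assumes "dim_col A = dim_row B" "dim_col B = dim_row C"
  shows "A * B * C = A * (B * C)"
  using assms by (intro assoc_mult_mat) auto

lemma mat_adjoint_mult_dim:
  fixes A B :: "complex mat"
  assumes "dim_col A = dim_row B"
  shows "mat_adjoint (A * B) = mat_adjoint B * mat_adjoint A"
  using assms by (intro mat_adjoint_mult) auto

text \<open>U and V stand for the blocks \<open>U\<^sub>2\<close> and \<open>V\<^sub>2\<close> of
  the theorem. What the argument retains of the unitary decomposition is that the two projections
  fix H and that the compression of H is invertible.\<close>

locale compressed_hankel = block_hankel +
  fixes r :: nat and lam :: complex and U V R0 :: "complex mat"
  assumes U: "U \<in> carrier_mat (d * m) r" and V: "V \<in> carrier_mat (d * m) r"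
    and range: "U * mat_adjoint U * hankel_mat d m R = hankel_mat d m R"
    and corange: "hankel_mat d m R * (V * mat_adjoint V) = hankel_mat d m R"
    and invertible: "invertible_mat (mat_adjoint U * hankel_mat d m R * V)"
    and lam: "cmod lam < 1" and R0: "R0 \<in> carrier_mat m m" "mat_adjoint R0 = R0"
begin

abbreviation (input) "Hc \<equiv> mat_adjoint U * H * V"
abbreviation (input) "Sc \<equiv> mat_adjoint U * S * V"
abbreviation (input) "Fc \<equiv> mat_adjoint U * F_mat d m R"
abbreviation (input) "Gc \<equiv> mat_adjoint V * G_mat d m R"
abbreviation (input) "Ac \<equiv> pencil (- Hc) (lam \<cdot>\<^sub>m Hc + Sc)"

lemma F_mat_carrier [simp]: "F_mat d m R \<in> carrier_mat n m"
  by (simp add: F_mat_def uniform_block_matrix_def)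

lemma G_mat_carrier [simp]: "G_mat d m R \<in> carrier_mat n m"
  by (simp add: G_mat_def uniform_block_matrix_def)

lemmas dims [simp] = U[THEN carrier_matD(1)] U[THEN carrier_matD(2)] V[THEN carrier_matD(1)]
  V[THEN carrier_matD(2)] hankel_carrier[THEN carrier_matD(1)] hankel_carrier[THEN carrier_matD(2)]
  S_carrier[THEN carrier_matD(1)] S_carrier[THEN carrier_matD(2)]
  F_mat_carrier[THEN carrier_matD(1)] F_mat_carrier[THEN carrier_matD(2)]
  G_mat_carrier[THEN carrier_matD(1)] G_mat_carrier[THEN carrier_matD(2)]
  last_block_carrier[THEN carrier_matD(1)] last_block_carrier[THEN carrier_matD(2)]

lemma compressed_carriers:
  "Hc \<in> carrier_mat r r" "Sc \<in> carrier_mat r r" "Fc \<in> carrier_mat r m" "Gc \<in> carrier_mat r m"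
  "lam \<cdot>\<^sub>m Hc + Sc \<in> carrier_mat r r"
  by (auto intro!: carrier_matI)

text \<open>Each side uses its own factorization of S: with H as the left factor S inherits the
  range of H, and with H as the right factor, in \<open>corange_S\<close>, it inherits the
  projection on the right.\<close>

lemma range_S: "U * mat_adjoint U * S = S"
  unfolding S_eq_mult_adjoint
  by (subst mult_assoc_dim[of _ H, symmetric]) (simp_all add: range)

lemma corange_S: "S * (V * mat_adjoint V) = S"
  unfolding S_def by (subst mult_assoc_dim) (simp_all add: corange)

lemma range_F: "U * mat_adjoint U * F_mat d m R = F_mat d m R"
  unfolding F_mat_eq by (subst mult_assoc_dim[of _ H, symmetric]) (simp_all add: range)

text \<open>These are the hypotheses of \<open>compressed_pencil_kernel\<close> for the adjoints of
  H and S, with V in the role of U.\<close>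

lemma adjoint_relations:
  "mat_adjoint S = block_shift n m * mat_adjoint H"
  "V * mat_adjoint V * mat_adjoint H = mat_adjoint H"
  "V * mat_adjoint V * mat_adjoint S = mat_adjoint S"
  using arg_cong[OF S_eq_mult_adjoint, of mat_adjoint] arg_cong[OF corange, of mat_adjoint]
    arg_cong[OF corange_S, of mat_adjoint]
  by (simp_all add: mat_adjoint_mult_dim)

lemma Hc_inj:
  shows "y \<in> carrier_vec r \<Longrightarrow> Hc *\<^sub>v y = 0\<^sub>v r \<Longrightarrow> y = 0\<^sub>v r"
    and "y \<in> carrier_vec r \<Longrightarrow> mat_adjoint Hc *\<^sub>v y = 0\<^sub>v r \<Longrightarrow> y = 0\<^sub>v r"
proof -
  obtain B where B: "Hc * B = 1\<^sub>m r" "B * Hc = 1\<^sub>m (dim_row B)"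
    using invertible by (auto simp: invertible_mat_def inverts_mat_def)
  \<comment> \<open>\<open>inverts_mat\<close> does not prescribe the size of B, which is read off
    from the two products.\<close>
  have dB: "dim_col B = r" using arg_cong[OF B(1), of dim_col] by simp
  have dB': "dim_row B = r" using arg_cong[OF B(2), of dim_col] by simp
  have Bc: "B \<in> carrier_mat r r" using dB dB' by auto
  have *: "y = 0\<^sub>v r" if "C * D = 1\<^sub>m r" "C \<in> carrier_mat r r" "D \<in> carrier_mat r r"
    "y \<in> carrier_vec r" "D *\<^sub>v y = 0\<^sub>v r" for C D :: "complex mat" and y
  proof -
    have "y = (C * D) *\<^sub>v y" using that by simp
    also have "\<dots> = C *\<^sub>v (D *\<^sub>v y)" by (rule assoc_mult_mat_vec[OF that(2-4)])
    also have "\<dots> = 0\<^sub>v r" unfolding that(5) using that(2) by (intro eq_vecI) auto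
    finally show ?thesis .
  qed
  show "y \<in> carrier_vec r \<Longrightarrow> Hc *\<^sub>v y = 0\<^sub>v r \<Longrightarrow> y = 0\<^sub>v r"
    using *[OF _ Bc compressed_carriers(1)] B(2) dB' by simp
  have "mat_adjoint B * mat_adjoint Hc = 1\<^sub>m r"
    using arg_cong[OF B(1), of mat_adjoint] mat_adjoint_mult[OF compressed_carriers(1) Bc] by simp
  thus "y \<in> carrier_vec r \<Longrightarrow> mat_adjoint Hc *\<^sub>v y = 0\<^sub>v r \<Longrightarrow> y = 0\<^sub>v r"
    using *[OF _ mat_adjoint_carrier[OF Bc] mat_adjoint_carrier[OF compressed_carriers(1)]] by blast
qed

lemma adjoint_Hc: "mat_adjoint Hc = mat_adjoint V * mat_adjoint H * U"
  "mat_adjoint Sc = mat_adjoint V * mat_adjoint S * U"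
  by (simp_all add: mat_adjoint_mult_dim mult_assoc_dim)

lemma adjoint_Fc: "mat_adjoint Fc = mat_adjoint (last_block n m) * mat_adjoint H * U"
  "mat_adjoint Gc = mat_adjoint (last_block n m) * H * V"
  using G_mat_eq by (simp_all add: F_mat_eq mat_adjoint_mult_dim)

lemma eval_Ac: "z \<cdot>\<^sub>m (- Hc) + (lam \<cdot>\<^sub>m Hc + Sc) = (lam - z) \<cdot>\<^sub>m Hc + Sc"
  "mat_adjoint ((lam - z) \<cdot>\<^sub>m Hc + Sc) = cnj (lam - z) \<cdot>\<^sub>m mat_adjoint Hc + mat_adjoint Sc"
proof -
  show "z \<cdot>\<^sub>m (- Hc) + (lam \<cdot>\<^sub>m Hc + Sc) = (lam - z) \<cdot>\<^sub>m Hc + Sc"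
    using compressed_carriers(1,2) by (intro eq_matI) (simp_all add: algebra_simps)
  show "mat_adjoint ((lam - z) \<cdot>\<^sub>m Hc + Sc) = cnj (lam - z) \<cdot>\<^sub>m mat_adjoint Hc + mat_adjoint Sc"
    using compressed_carriers(1,2) by (subst mat_adjoint_add[of _ r r]) simp_all
qed

lemma compressed_kernel:
  assumes "y \<in> carrier_vec r" "(z \<cdot>\<^sub>m (- Hc) + (lam \<cdot>\<^sub>m Hc + Sc)) *\<^sub>v y = 0\<^sub>v r"
    "z \<noteq> lam \<or> mat_adjoint Gc *\<^sub>v y = 0\<^sub>v m"
  shows "y = 0\<^sub>v r"
  by (rule compressed_pencil_kernel[OF hankel_carrier U V m m_le_n S_carrier S_def range range_S assms(1)
        assms(2)[unfolded eval_Ac] Hc_inj(1)])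
    (use assms(3) in \<open>auto simp: adjoint_Fc\<close>)

text \<open>The adjoint pencil has the same shape with \<mu> = cnj (lam - z), and the observed last
  block of the adjoint of H, compressed by U, is the adjoint of \<open>Fc\<close>.\<close>

lemma compressed_cokernel:
  assumes "y \<in> carrier_vec r" "mat_adjoint (z \<cdot>\<^sub>m (- Hc) + (lam \<cdot>\<^sub>m Hc + Sc)) *\<^sub>v y = 0\<^sub>v r"
    "z \<noteq> lam \<or> mat_adjoint Fc *\<^sub>v y = 0\<^sub>v m"
  shows "y = 0\<^sub>v r"
  by (rule compressed_pencil_kernel[OF mat_adjoint_carrier[OF hankel_carrier] V U m m_le_n
        mat_adjoint_carrier[OF S_carrier] adjoint_relations assms(1)
        assms(2)[unfolded eval_Ac adjoint_Hc] Hc_inj(2)[unfolded adjoint_Hc]])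
    (use assms(3) in \<open>auto simp: adjoint_Fc\<close>)

sublocale system: palindromic_system r m lam "- Hc" "lam \<cdot>\<^sub>m Hc + Sc" Fc Gc R0
proof
  show "z \<noteq> lam \<Longrightarrow> y \<in> carrier_vec r \<Longrightarrow> (z \<cdot>\<^sub>m - Hc + (lam \<cdot>\<^sub>m Hc + Sc)) *\<^sub>v y = 0\<^sub>v r \<Longrightarrow> y = 0\<^sub>v r"
    "y \<in> carrier_vec r \<Longrightarrow> (z \<cdot>\<^sub>m - Hc + (lam \<cdot>\<^sub>m Hc + Sc)) *\<^sub>v y = 0\<^sub>v r \<Longrightarrow>
      mat_adjoint Gc *\<^sub>v y = 0\<^sub>v m \<Longrightarrow> y = 0\<^sub>v r" for z y
    using compressed_kernel by blast+
  show "z \<noteq> lam \<Longrightarrow> y \<in> carrier_vec r \<Longrightarrow>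
      mat_adjoint (z \<cdot>\<^sub>m - Hc + (lam \<cdot>\<^sub>m Hc + Sc)) *\<^sub>v y = 0\<^sub>v r \<Longrightarrow> y = 0\<^sub>v r"
    "y \<in> carrier_vec r \<Longrightarrow> mat_adjoint (z \<cdot>\<^sub>m - Hc + (lam \<cdot>\<^sub>m Hc + Sc)) *\<^sub>v y = 0\<^sub>v r \<Longrightarrow>
      mat_adjoint Fc *\<^sub>v y = 0\<^sub>v m \<Longrightarrow> y = 0\<^sub>v r" for z y
    using compressed_cokernel by blast+
  have neg: "C *\<^sub>v y = 0\<^sub>v r" if "(- C) *\<^sub>v y = 0\<^sub>v r" "C \<in> carrier_mat r r" "y \<in> carrier_vec r"
    for C :: "complex mat" and y
  proof (rule smult_mat_mult_vec_eq_0[OF _ _ that(2,3)])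
    have "(- 1) \<cdot>\<^sub>m C = - C" by (intro eq_matI) auto
    thus "((- 1) \<cdot>\<^sub>m C) *\<^sub>v y = 0\<^sub>v r" using that(1) by simp
  qed simp
  show "y \<in> carrier_vec r \<Longrightarrow> - Hc *\<^sub>v y = 0\<^sub>v r \<Longrightarrow> y = 0\<^sub>v r"
    "y \<in> carrier_vec r \<Longrightarrow> mat_adjoint (- Hc) *\<^sub>v y = 0\<^sub>v r \<Longrightarrow> y = 0\<^sub>v r" for y
    using Hc_inj neg[OF _ compressed_carriers(1)]
      neg[OF _ mat_adjoint_carrier[OF compressed_carriers(1)]] unfolding mat_adjoint_uminus by blast+
qed (use compressed_carriers lam R0 in simp_all)

lemma det_Ac: "det Ac \<noteq> 0"
\<comment> \<open>Any point other than lam serves, since the pencil has trivial kernel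
  there.\<close>
proof (rule det_pencil_nonzero[of _ r _ "lam + 1"])
  let ?E = "(lam + 1) \<cdot>\<^sub>m (- Hc) + (lam \<cdot>\<^sub>m Hc + Sc)"
  have "?E \<in> carrier_mat r r" using compressed_carriers by simp
  thus "det ?E \<noteq> 0" using det_0_iff_vec_prod_zero_field[of ?E r] compressed_kernel[of _ "lam + 1"] by auto
qed (use compressed_carriers in simp_all)

lemma regular_Ac: "regular_pencil Ac"
  using det_Ac is_pencil_pencil[OF uminus_carrier_mat[OF compressed_carriers(1)] compressed_carriers(5)]
  by (simp add: regular_pencil_def)

text \<open>The projection \<open>U * mat_adjoint U\<close> fixes H and S, so it may be inserted in
  front of M V, where its second factor completes the compression to \<open>Ac\<close>. This is what
  makes \<open>Ac\<close> cancel against its inverse in the transfer function.\<close>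

lemma M_mult_V: "pencil (- H) (lam \<cdot>\<^sub>m H + S) * cmat V = cmat U * Ac"
proof -
  have UH: "U * Hc = H * V" "U * Sc = S * V"
    using range range_S by (simp_all add: mult_assoc_dim[symmetric])
  have "pencil (- H) (lam \<cdot>\<^sub>m H + S) * cmat V = pencil (- H * V) ((lam \<cdot>\<^sub>m H + S) * V)"
    by (rule pencil_mult_cmat[of _ n n _ _ r]) (simp_all add: V)
  also have "- H * V = U * (- Hc)" using UH(1) by simp
  also have "(lam \<cdot>\<^sub>m H + S) * V = lam \<cdot>\<^sub>m (H * V) + S * V"
    using V by (simp add: add_mult_distrib_mat[of _ n n _ _ r] mult_smult_assoc_mat[of _ n n _ r])
  also have "\<dots> = U * (lam \<cdot>\<^sub>m Hc + Sc)"
    using U compressed_carriers UH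
    by (simp add: mult_add_distrib_mat[of _ n r _ r] mult_smult_distrib[of _ n r _ r])
  also have "pencil (U * - Hc) (U * (lam \<cdot>\<^sub>m Hc + Sc)) = cmat U * Ac"
    by (rule cmat_mult_pencil[OF U uminus_carrier_mat[OF compressed_carriers(1)] compressed_carriers(5), symmetric])
  finally show ?thesis .
qed

lemma strongly_minimal:
  "strongly_minimal_linearization (2 * r) (structured_pencil Ac Fc Gc R0)
    ((1 + zvar) \<cdot>\<^sub>m (polar_part lam d m R + cmat R0 + para_conj (polar_part lam d m R)))"
proof -
  have cAc: "Ac \<in> carrier_mat r r" using compressed_carriers by simp
  obtain X where X: "X \<in> carrier_mat r r" "Ac * X = 1\<^sub>m r" "X * Ac = 1\<^sub>m r"
    using det_nonzero_obtain_inverse[OF cAc det_Ac] .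
  let ?W = "resolvent_row lam" and ?M = "pencil (- H) (lam \<cdot>\<^sub>m H + S)"
  have dW: "dim_row ?W = m" "dim_col ?W = n" by (simp_all add: resolvent_row_def)
  have dX: "dim_row X = r" "dim_col X = r" using X by auto
  have "cmat (mat_adjoint Gc) = cmat (mat_adjoint (last_block n m) * H) * cmat V"
    unfolding adjoint_Fc by (rule rconst.mat_hom_mult[OF _ V]) (auto intro!: carrier_matI)
  also have "\<dots> = ?W * ?M * cmat V" by (simp only: resolvent_row_mult_M)
  also have "\<dots> = ?W * (?M * cmat V)" by (rule mult_assoc_dim) (simp_all add: dW)
  also have "\<dots> = ?W * (cmat U * Ac)" by (simp only: M_mult_V)
  finally have GW: "cmat (mat_adjoint Gc) = ?W * (cmat U * Ac)" .
  have "?W * (cmat U * A) * X * cmat Fc = ?W * (cmat U * ((A * X) * cmat Fc))"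
    if "A \<in> carrier_mat r r" for A
    using that by (simp add: mult_assoc_dim dW dX)
  hence "cmat (mat_adjoint Gc) * X * cmat Fc = ?W * (cmat U * ((Ac * X) * cmat Fc))"
    unfolding GW using cAc by blast
  also have "(Ac * X) * cmat Fc = cmat Fc"
    unfolding X(2) using compressed_carriers(3) by simp
  also have "cmat U * cmat Fc = cmat (F_mat d m R)"
  proof -
    have "cmat U * cmat Fc = cmat (U * Fc)"
      by (rule rconst.mat_hom_mult[OF U compressed_carriers(3), symmetric])
    also have "U * Fc = F_mat d m R" using range_F by (simp add: mult_assoc_dim)
    finally show ?thesis .
  qed
  also have "?W * cmat (F_mat d m R) = - polar_part lam d m R" by (rule resolvent_row_mult_F)
  finally show ?thesis by (rule system.strongly_minimal_linearization_structured_pencil[OF X])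
qed

end

section \<open>Unitary compression\<close>

lemma diag_mult_append_rows:
  fixes P Q X Y :: "'a :: semiring_0 mat"
  assumes "P \<in> carrier_mat p p" "Q \<in> carrier_mat q q" "X \<in> carrier_mat p k" "Y \<in> carrier_mat q k"
  shows "four_block_mat P (0\<^sub>m p q) (0\<^sub>m q p) Q * (X @\<^sub>r Y) = P * X @\<^sub>r Q * Y"
proof -
  have c: "P @\<^sub>c 0\<^sub>m p q \<in> carrier_mat p (p + q)" "0\<^sub>m q p @\<^sub>c Q \<in> carrier_mat q (p + q)"
    "X @\<^sub>r Y \<in> carrier_mat (p + q) k"
    using assms by auto
  have "four_block_mat P (0\<^sub>m p q) (0\<^sub>m q p) Q * (X @\<^sub>r Y) =
      (P @\<^sub>c 0\<^sub>m p q) * (X @\<^sub>r Y) @\<^sub>r (0\<^sub>m q p @\<^sub>c Q) * (X @\<^sub>r Y)"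
    unfolding append_rows_eq_four_block_mat[OF assms(1) zero_carrier_mat zero_carrier_mat assms(2), symmetric]
    by (rule append_rows_mult[OF c])
  also have "(P @\<^sub>c 0\<^sub>m p q) * (X @\<^sub>r Y) = P * X"
    using assms by (subst append_cols_mult_append_rows[of _ p p _ q _ k]) auto
  also have "(0\<^sub>m q p @\<^sub>c Q) * (X @\<^sub>r Y) = Q * Y"
    using assms by (subst append_cols_mult_append_rows[of _ q p _ q _ k]) auto
  finally show ?thesis .
qed

lemma append_cols_mult_diag:
  fixes P Q X Y :: "'a :: semiring_0 mat"
  assumes "P \<in> carrier_mat p p" "Q \<in> carrier_mat q q" "X \<in> carrier_mat k p" "Y \<in> carrier_mat k q"
  shows "(X @\<^sub>c Y) * four_block_mat P (0\<^sub>m p q) (0\<^sub>m q p) Q = X * P @\<^sub>c Y * Q"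
proof -
  have c: "P @\<^sub>c 0\<^sub>m p q \<in> carrier_mat p (p + q)" "0\<^sub>m q p @\<^sub>c Q \<in> carrier_mat q (p + q)"
    using assms by auto
  have "(X @\<^sub>c Y) * four_block_mat P (0\<^sub>m p q) (0\<^sub>m q p) Q =
      X * (P @\<^sub>c 0\<^sub>m p q) + Y * (0\<^sub>m q p @\<^sub>c Q)"
    unfolding append_rows_eq_four_block_mat[OF assms(1) zero_carrier_mat zero_carrier_mat assms(2), symmetric]
    by (rule append_cols_mult_append_rows[OF assms(3,4) c])
  also have "\<dots> = (X * P @\<^sub>c 0\<^sub>m k q) + (0\<^sub>m k p @\<^sub>c Y * Q)"
    using assms by (simp add: mult_append_cols[of _ k p _ p _ q] mult_append_cols[of _ k q _ p _ q])
  also have "\<dots> = X * P @\<^sub>c Y * Q"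
    using assms by (intro eq_matI) auto
  finally show ?thesis .
qed

section \<open>Block diagonal congruence and zero padding\<close>

lemma diag_block_mat_three:
  "diag_block_mat [P, Q, W] = four_block_mat P (0\<^sub>m (dim_row P) (dim_col Q + dim_col W))
    (0\<^sub>m (dim_row Q + dim_row W) (dim_col P))
    (four_block_mat Q (0\<^sub>m (dim_row Q) (dim_col W)) (0\<^sub>m (dim_row W) (dim_col Q)) W)"
  by (intro eq_matI) (auto simp: Let_def)

lemma diag_block_mat_three_conj:
  fixes P Q W P' Q' W' :: "'a :: semiring_0 mat"
  assumes "P \<in> carrier_mat p p" "Q \<in> carrier_mat q q" "W \<in> carrier_mat s s"
    "P' \<in> carrier_mat p p" "Q' \<in> carrier_mat q q" "W' \<in> carrier_mat s s"
    "A11 \<in> carrier_mat p p" "A12 \<in> carrier_mat p q" "A13 \<in> carrier_mat p s"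
    "A21 \<in> carrier_mat q p" "A22 \<in> carrier_mat q q" "A23 \<in> carrier_mat q s"
    "A31 \<in> carrier_mat s p" "A32 \<in> carrier_mat s q" "A33 \<in> carrier_mat s s"
  shows "diag_block_mat [P, Q, W] * block_matrix [[A11, A12, A13], [A21, A22, A23], [A31, A32, A33]] *
      diag_block_mat [P', Q', W'] = block_matrix
      [[P * A11 * P', P * A12 * Q', P * A13 * W'],
       [Q * A21 * P', Q * A22 * Q', Q * A23 * W'],
       [W * A31 * P', W * A32 * Q', W * A33 * W']]"
proof -
  let ?l = "p + (q + s)"
  let ?D' = "diag_block_mat [P', Q', W']"
  have D: "diag_block_mat [P, Q, W] = four_block_mat P (0\<^sub>m p (q + s)) (0\<^sub>m (q + s) p)
      (four_block_mat Q (0\<^sub>m q s) (0\<^sub>m s q) W)"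
    "?D' = four_block_mat P' (0\<^sub>m p (q + s)) (0\<^sub>m (q + s) p) (four_block_mat Q' (0\<^sub>m q s) (0\<^sub>m s q) W')"
    unfolding diag_block_mat_three using assms(1-6) by simp_all
  have D': "?D' \<in> carrier_mat ?l ?l"
    unfolding D using assms(4-6) by (intro four_block_carrier_mat) auto
  have QW: "four_block_mat Q (0\<^sub>m q s) (0\<^sub>m s q) W \<in> carrier_mat (q + s) (q + s)"
    "four_block_mat Q' (0\<^sub>m q s) (0\<^sub>m s q) W' \<in> carrier_mat (q + s) (q + s)"
    using assms(2,3,5,6) by (auto intro!: four_block_carrier_mat)
  have row: "x @\<^sub>c y @\<^sub>c z \<in> carrier_mat k ?l"
    "B * (x @\<^sub>c y @\<^sub>c z) * ?D' = B * x * P' @\<^sub>c B * y * Q' @\<^sub>c B * z * W'"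
    if "B \<in> carrier_mat k k" "x \<in> carrier_mat k p" "y \<in> carrier_mat k q" "z \<in> carrier_mat k s"
    for B x y z k
  proof -
    have yz: "y @\<^sub>c z \<in> carrier_mat k (q + s)" using that by simp
    show "x @\<^sub>c y @\<^sub>c z \<in> carrier_mat k ?l" using that by simp
    have B: "B * x \<in> carrier_mat k p" "B * y \<in> carrier_mat k q" "B * z \<in> carrier_mat k s"
      using that by auto
    have Bc: "B * y @\<^sub>c B * z \<in> carrier_mat k (q + s)" using B by simp
    show "B * (x @\<^sub>c y @\<^sub>c z) * ?D' = B * x * P' @\<^sub>c B * y * Q' @\<^sub>c B * z * W'"
      unfolding D(2) mult_append_cols[OF that(1,2) yz] mult_append_cols[OF that(1,3,4)]
        append_cols_mult_diag[OF assms(4) QW(2) B(1) Bc] append_cols_mult_diag[OF assms(5,6) B(2,3)] ..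
  qed
  note r1 = row[OF assms(1) assms(7-9)] and r2 = row[OF assms(2) assms(10-12)]
    and r3 = row[OF assms(3) assms(13-15)]
  note r23 = carrier_append_rows[OF r2(1) r3(1)]
  note s1 = mult_carrier_mat[OF assms(1) r1(1)] and s2 = mult_carrier_mat[OF assms(2) r2(1)]
    and s3 = mult_carrier_mat[OF assms(3) r3(1)]
  show ?thesis
    unfolding block_matrix_def list.map hconcat.simps vconcat.simps D(1)
      diag_mult_append_rows[OF assms(1) QW(1) r1(1) r23] diag_mult_append_rows[OF assms(2,3) r2(1) r3(1)]
      append_rows_mult[OF s1 carrier_append_rows[OF s2 s3] D'] append_rows_mult[OF s2 s3 D']
      r1(2) r2(2) r3(2) ..
qed

lemma cmat_diag_block_mat_three:
  "cmat (diag_block_mat [P, Q, W]) = diag_block_mat [cmat P, cmat Q, cmat W]"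
  unfolding diag_block_mat_three by (intro eq_matI) auto

text \<open>The left factor is the adjoint of the right one, so mirror-image blocks are transformed
  by mirror-image formulas and the palindromic shape survives; only the blocks M, F and G have to be
  transformed.\<close>

lemma structured_pencil_conj:
  assumes UV: "U \<in> carrier_mat n n" "V \<in> carrier_mat n n"
    and A: "A1 \<in> carrier_mat n n" "A0 \<in> carrier_mat n n"
    and FG: "F \<in> carrier_mat n m" "G \<in> carrier_mat n m" and R0: "R0 \<in> carrier_mat m m"
  shows "cmat (diag_block_mat [mat_adjoint U, mat_adjoint V, 1\<^sub>m m]) *
      structured_pencil (pencil A1 A0) F G R0 * cmat (diag_block_mat [U, V, 1\<^sub>m m]) =
    structured_pencil (pencil (mat_adjoint U * A1 * V) (mat_adjoint U * A0 * V))
      (mat_adjoint U * F) (mat_adjoint V * G) R0"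
proof -
  let ?U = "mat_adjoint U" and ?V = "mat_adjoint V"
  note adj = UV[THEN mat_adjoint_carrier] A[THEN mat_adjoint_carrier] FG[THEN mat_adjoint_carrier]
  have cU: "cmat ?U \<in> carrier_mat n n" "cmat ?V \<in> carrier_mat n n" "cmat U \<in> carrier_mat n n"
    "cmat V \<in> carrier_mat n n"
    using UV adj by auto
  have dims: "dim_row (pencil A1 A0) = n" "dim_col (pencil A1 A0) = n"
    "dim_row (pencil (?U * A1 * V) (?U * A0 * V)) = n" "dim_col (pencil (?U * A1 * V) (?U * A0 * V)) = n"
    using UV A by auto
  have B: "?U * A1 * V \<in> carrier_mat n n" "?U * A0 * V \<in> carrier_mat n n"
    by (rule mult_carrier_mat[OF mult_carrier_mat[OF adj(1)] UV(2)], fact)+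
  have e12: "cmat ?U * pencil A1 A0 * cmat V = pencil (?U * A1 * V) (?U * A0 * V)"
    unfolding cmat_mult_pencil[OF adj(1) A]
    by (rule pencil_mult_cmat[OF mult_carrier_mat[OF adj(1) A(1)] mult_carrier_mat[OF adj(1) A(2)] UV(2)])
  have "mat_adjoint (?U * A1 * V) = ?V * mat_adjoint A1 * U" "mat_adjoint (?U * A0 * V) = ?V * mat_adjoint A0 * U"
    using UV A by (simp_all add: mat_adjoint_mult_dim mult_assoc_dim)
  hence e21: "cmat ?V * pencil (mat_adjoint A0) (mat_adjoint A1) * cmat U =
      pencil (mat_adjoint (?U * A0 * V)) (mat_adjoint (?U * A1 * V))"
    unfolding cmat_mult_pencil[OF adj(2,4,3)]
    by (simp add: pencil_mult_cmat[OF mult_carrier_mat[OF adj(2,4)] mult_carrier_mat[OF adj(2,3)] UV(1)])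
  have e13: "cmat ?U * cmat F * cmat (1\<^sub>m m) = cmat (?U * F)"
    "cmat ?V * ((1 + zvar) \<cdot>\<^sub>m cmat G) * cmat (1\<^sub>m m) = (1 + zvar) \<cdot>\<^sub>m cmat (?V * G)"
    using FG adj UV
    by (simp_all add: rconst.mat_hom_one rconst.mat_hom_mult[OF adj(1) FG(1)]
        rconst.mat_hom_mult[OF adj(2) FG(2)] mult_smult_distrib[OF cU(2), of _ m]
        right_mult_one_mat[of _ n m])
  have FU: "mat_adjoint (?U * F) = mat_adjoint F * U" "mat_adjoint (?V * G) = mat_adjoint G * V"
    using UV FG by (simp_all add: mat_adjoint_mult_dim)
  have e31: "cmat (1\<^sub>m m) * (zvar \<cdot>\<^sub>m cmat (mat_adjoint F)) * cmat U = zvar \<cdot>\<^sub>m cmat (mat_adjoint (?U * F))"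
    "cmat (1\<^sub>m m) * ((1 + zvar) \<cdot>\<^sub>m cmat (mat_adjoint G)) * cmat V =
      (1 + zvar) \<cdot>\<^sub>m cmat (mat_adjoint (?V * G))"
    unfolding FU using FG adj UV
    by (simp_all add: rconst.mat_hom_one rconst.mat_hom_mult[OF adj(5) UV(1)]
        rconst.mat_hom_mult[OF adj(6) UV(2)] mult_smult_assoc_mat[OF _ cU(3), of _ m]
        mult_smult_assoc_mat[OF _ cU(4), of _ m] left_mult_one_mat[of _ m n])
  have e33: "cmat (1\<^sub>m m) * ((1 + zvar) \<cdot>\<^sub>m cmat R0) * cmat (1\<^sub>m m) = (1 + zvar) \<cdot>\<^sub>m cmat R0"
    using R0 by (simp add: rconst.mat_hom_one left_mult_one_mat[of _ m m] right_mult_one_mat[of _ m m])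
  have e0: "cmat ?U * 0\<^sub>m n n * cmat U = 0\<^sub>m n n" "cmat ?V * 0\<^sub>m n n * cmat V = 0\<^sub>m n n"
    using cU by simp_all
  have one: "cmat (1\<^sub>m m) \<in> carrier_mat m m" by simp
  have pc: "pencil A1 A0 \<in> carrier_mat n n" "pencil (mat_adjoint A0) (mat_adjoint A1) \<in> carrier_mat n n"
    using A(2) adj(3) by (simp_all only: pencil_carrier)
  have cF: "cmat F \<in> carrier_mat n m" "(1 + zvar) \<cdot>\<^sub>m cmat G \<in> carrier_mat n m"
    "zvar \<cdot>\<^sub>m cmat (mat_adjoint F) \<in> carrier_mat m n"
    "(1 + zvar) \<cdot>\<^sub>m cmat (mat_adjoint G) \<in> carrier_mat m n"
    "(1 + zvar) \<cdot>\<^sub>m cmat R0 \<in> carrier_mat m m"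
    using FG R0 by simp_all
  show ?thesis
    unfolding structured_pencil_def cmat_diag_block_mat_three rev1_mat_star_pencil[OF A]
      rev1_mat_star_pencil[OF B] dims
      diag_block_mat_three_conj[OF cU(1,2) one cU(3,4) one zero_carrier_mat pc(1) cF(1) pc(2)
        zero_carrier_mat cF(2-5)] e12 e21 e13 e31 e33 e0 ..
qed

lemma cmat_append_zero_rows: "F \<in> carrier_mat r m \<Longrightarrow> cmat (0\<^sub>m k m @\<^sub>r F) = 0\<^sub>m k m @\<^sub>r cmat F"
  by (intro eq_matI) auto

lemma smult_append_zero_rows:
  fixes F :: "'a :: semiring_0 mat"
  shows "F \<in> carrier_mat r m \<Longrightarrow> c \<cdot>\<^sub>m (0\<^sub>m k m @\<^sub>r F) = 0\<^sub>m k m @\<^sub>r (c \<cdot>\<^sub>m F)"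
  by (intro eq_matI) auto

lemma smult_append_zero_cols:
  fixes F :: "'a :: semiring_0 mat"
  shows "F \<in> carrier_mat m r \<Longrightarrow> c \<cdot>\<^sub>m (0\<^sub>m m k @\<^sub>c F) = 0\<^sub>m m k @\<^sub>c (c \<cdot>\<^sub>m F)"
  by (intro eq_matI) auto

text \<open>Adjoint, reversal and multiplication by a scalar all preserve zero padding, so each
  padded block can be split and the three block rows regrouped into five.\<close>

lemma structured_pencil_padded:
  assumes A: "A1 \<in> carrier_mat r r" "A0 \<in> carrier_mat r r"
    and FG: "F \<in> carrier_mat r m" "G \<in> carrier_mat r m" and R0: "R0 \<in> carrier_mat m m"
  shows "structured_pencil
      (pencil ((0\<^sub>m k k @\<^sub>c 0\<^sub>m k r) @\<^sub>r (0\<^sub>m r k @\<^sub>c A1)) ((0\<^sub>m k k @\<^sub>c 0\<^sub>m k r) @\<^sub>r (0\<^sub>m r k @\<^sub>c A0)))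
      (0\<^sub>m k m @\<^sub>r F) (0\<^sub>m k m @\<^sub>r G) R0 = block_matrix
        [[0\<^sub>m k k, 0\<^sub>m k r, 0\<^sub>m k k, 0\<^sub>m k r, 0\<^sub>m k m],
         [0\<^sub>m r k, 0\<^sub>m r r, 0\<^sub>m r k, pencil A1 A0, cmat F],
         [0\<^sub>m k k, 0\<^sub>m k r, 0\<^sub>m k k, 0\<^sub>m k r, 0\<^sub>m k m],
         [0\<^sub>m r k, rev1 (mat_star (pencil A1 A0)), 0\<^sub>m r k, 0\<^sub>m r r, (1 + zvar) \<cdot>\<^sub>m cmat G],
         [0\<^sub>m m k, zvar \<cdot>\<^sub>m cmat (mat_adjoint F), 0\<^sub>m m k,
          (1 + zvar) \<cdot>\<^sub>m cmat (mat_adjoint G), (1 + zvar) \<cdot>\<^sub>m cmat R0]]"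
proof -
  have pad: "pencil ((0\<^sub>m k k @\<^sub>c 0\<^sub>m k r) @\<^sub>r (0\<^sub>m r k @\<^sub>c B1)) ((0\<^sub>m k k @\<^sub>c 0\<^sub>m k r) @\<^sub>r (0\<^sub>m r k @\<^sub>c B0)) =
      (0\<^sub>m k k @\<^sub>c 0\<^sub>m k r) @\<^sub>r (0\<^sub>m r k @\<^sub>c pencil B1 B0)"
    if "B1 \<in> carrier_mat r r" "B0 \<in> carrier_mat r r" for B1 B0
    using that by (intro eq_matI) auto
  have adj: "mat_adjoint ((0\<^sub>m k k @\<^sub>c 0\<^sub>m k r) @\<^sub>r (0\<^sub>m r k @\<^sub>c B)) =
      (0\<^sub>m k k @\<^sub>c 0\<^sub>m k r) @\<^sub>r (0\<^sub>m r k @\<^sub>c mat_adjoint B)"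
    if "B \<in> carrier_mat r r" for B :: "complex mat"
    using that by (intro eq_matI) auto
  have c: "(0\<^sub>m k k @\<^sub>c 0\<^sub>m k r) @\<^sub>r (0\<^sub>m r k @\<^sub>c B) \<in> carrier_mat (k + r) (k + r)"
    if "B \<in> carrier_mat r r" for B :: "complex mat"
    using that by (intro carrier_append_rows append_cols_carrier) auto
  have z: "0\<^sub>m (k + r) (k + r) = (0\<^sub>m k k @\<^sub>c 0\<^sub>m k r) @\<^sub>r (0\<^sub>m r k @\<^sub>c (0\<^sub>m r r :: ratfun mat))"
    by (intro eq_matI) auto
  have adjF: "mat_adjoint (0\<^sub>m k m @\<^sub>r B) = 0\<^sub>m m k @\<^sub>c mat_adjoint B"
    if "B \<in> carrier_mat r m" for B :: "complex mat"
    using that by (intro eq_matI) auto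
  have cadj: "cmat (0\<^sub>m m k @\<^sub>c mat_adjoint B) = 0\<^sub>m m k @\<^sub>c cmat (mat_adjoint B)"
    if "B \<in> carrier_mat r m" for B
    using that by (intro eq_matI) auto
  have dims: "dim_row (0\<^sub>m k k @\<^sub>c 0\<^sub>m k r @\<^sub>r 0\<^sub>m r k @\<^sub>c A0) = k + r"
    "dim_col (0\<^sub>m k k @\<^sub>c 0\<^sub>m k r @\<^sub>r 0\<^sub>m r k @\<^sub>c A0) = k + r"
    using A by simp_all
  note adjA = A[THEN mat_adjoint_carrier]
  show ?thesis
    unfolding structured_pencil_def rev1_mat_star_pencil[OF c[OF A(1)] c[OF A(2)]]
      rev1_mat_star_pencil[OF A]
    unfolding adj[OF A(1)] adj[OF A(2)] pad[OF A] pad[OF adjA(2,1)]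
      adjF[OF FG(1)] adjF[OF FG(2)] cadj[OF FG(1)] cadj[OF FG(2)] cmat_append_zero_rows[OF FG(1)]
      cmat_append_zero_rows[OF FG(2)] dim_pencil dims z block_matrix_def list.map hconcat.simps vconcat.simps
    using A FG R0
    by (simp add: z append_interchange append_cols_assoc append_rows_assoc dims
        smult_append_zero_rows[of _ r] smult_append_zero_cols[of _ _ r])
qed

section \<open>Projections obtained from the unitary decomposition\<close>

lemma append_rows_inject:
  assumes "A @\<^sub>r B = C @\<^sub>r D" "dim_row A = dim_row C" "dim_col B = dim_col A" "dim_col D = dim_col C"
  shows "A = C" "B = D"
proof -
  have col: "dim_col A = dim_col C" using arg_cong[OF assms(1), of dim_col] by simp
  have row: "dim_row B = dim_row D" using arg_cong[OF assms(1), of dim_row] assms(2) by simp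
  show "A = C"
  proof (rule eq_matI)
    fix i j assume "i < dim_row C" "j < dim_col C"
    thus "A $$ (i, j) = C $$ (i, j)"
      using arg_cong[OF assms(1), of "\<lambda>X. X $$ (i, j)"] assms(2) col by simp
  qed (use assms(2) col in auto)
  show "B = D"
  proof (rule eq_matI)
    fix i j assume "i < dim_row D" "j < dim_col D"
    thus "B $$ (i, j) = D $$ (i, j)"
      using arg_cong[OF assms(1), of "\<lambda>X. X $$ (dim_row C + i, j)"] assms(2-4) col row by simp
  qed (use assms row col in auto)
qed

lemma append_cols_inject:
  assumes "A @\<^sub>c B = C @\<^sub>c D" "dim_col A = dim_col C" "dim_row B = dim_row A" "dim_row D = dim_row C"
  shows "A = C" "B = D"
proof -
  have row: "dim_row A = dim_row C" using arg_cong[OF assms(1), of dim_row] by simp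
  have col: "dim_col B = dim_col D" using arg_cong[OF assms(1), of dim_col] assms(2) by simp
  show "A = C"
  proof (rule eq_matI)
    fix i j assume "i < dim_row C" "j < dim_col C"
    thus "A $$ (i, j) = C $$ (i, j)"
      using arg_cong[OF assms(1), of "\<lambda>X. X $$ (i, j)"] assms(2) row by simp
  qed (use assms(2) row in auto)
  show "B = D"
  proof (rule eq_matI)
    fix i j assume "i < dim_row D" "j < dim_col D"
    thus "B $$ (i, j) = D $$ (i, j)"
      using arg_cong[OF assms(1), of "\<lambda>X. X $$ (i, dim_col C + j)"] assms(2-4) col row by simp
  qed (use assms row col in auto)
qed

text \<open>The zero blocks say that \<open>U\<^sub>1\<^sup>* H V\<close> and
  \<open>U\<^sup>* H V\<^sub>1\<close> vanish; cancelling the full unitary factor gives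
  \<open>U\<^sub>1\<^sup>* H = 0\<close> and \<open>H V\<^sub>1 = 0\<close>. In the decomposition of
  the identity into two projections the first one then contributes nothing next to H.\<close>

lemma unitary_compression:
  fixes H :: "complex mat"
  assumes H: "H \<in> carrier_mat n n"
    and c: "U1 \<in> carrier_mat n k" "U2 \<in> carrier_mat n r" "V1 \<in> carrier_mat n k" "V2 \<in> carrier_mat n r"
    and U: "(U1 @\<^sub>c U2) * mat_adjoint (U1 @\<^sub>c U2) = 1\<^sub>m n"
    and V: "(V1 @\<^sub>c V2) * mat_adjoint (V1 @\<^sub>c V2) = 1\<^sub>m n"
    and eq: "mat_adjoint (U1 @\<^sub>c U2) * H * (V1 @\<^sub>c V2) =
      (0\<^sub>m k k @\<^sub>c 0\<^sub>m k r) @\<^sub>r (0\<^sub>m r k @\<^sub>c Hhat)"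
    and Hhat: "Hhat \<in> carrier_mat r r"
  shows "mat_adjoint U1 * H = 0\<^sub>m k n" "H * V1 = 0\<^sub>m n k"
    "U2 * mat_adjoint U2 * H = H" "H * (V2 * mat_adjoint V2) = H"
proof -
  let ?U = "U1 @\<^sub>c U2" and ?V = "V1 @\<^sub>c V2"
  note adj = c[THEN mat_adjoint_carrier]
  have UV: "?U \<in> carrier_mat n (k + r)" "?V \<in> carrier_mat n (k + r)" using c by simp_all
  note UV' = UV[THEN mat_adjoint_carrier]
  have HV: "H * ?V \<in> carrier_mat n (k + r)" using H UV by auto
  have adjU: "mat_adjoint ?U = mat_adjoint U1 @\<^sub>r mat_adjoint U2"
    using c by (simp add: mat_adjoint_append_cols)
  have "mat_adjoint ?U * H * ?V = mat_adjoint ?U * (H * ?V)"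
    by (rule assoc_mult_mat[OF UV'(1) H UV(2)])
  also have "\<dots> = mat_adjoint U1 * (H * ?V) @\<^sub>r mat_adjoint U2 * (H * ?V)"
    unfolding adjU by (rule append_rows_mult[OF adj(1,2) HV])
  finally have "mat_adjoint U1 * (H * ?V) @\<^sub>r mat_adjoint U2 * (H * ?V) =
      (0\<^sub>m k k @\<^sub>c 0\<^sub>m k r) @\<^sub>r (0\<^sub>m r k @\<^sub>c Hhat)"
    using eq by metis
  hence "mat_adjoint U1 * (H * ?V) = 0\<^sub>m k k @\<^sub>c 0\<^sub>m k r"
    by (rule append_rows_inject(1)) (use c Hhat in simp_all)
  also have "\<dots> = 0\<^sub>m k (k + r)" by (intro eq_matI) auto
  finally have 1: "mat_adjoint U1 * (H * ?V) = 0\<^sub>m k (k + r)" .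
  have "mat_adjoint U1 * H = mat_adjoint U1 * (H * (?V * mat_adjoint ?V))"
    unfolding V using H by simp
  also have "\<dots> = (mat_adjoint U1 * (H * ?V)) * mat_adjoint ?V"
    using c H UV by (simp add: mult_assoc_dim)
  also have "\<dots> = 0\<^sub>m k n"
    unfolding 1 using UV'(2) by (rule left_mult_zero_mat)
  finally show U1: "mat_adjoint U1 * H = 0\<^sub>m k n" .
  have UH: "mat_adjoint ?U * H \<in> carrier_mat (k + r) n" by (rule mult_carrier_mat[OF UV'(1) H])
  have "mat_adjoint ?U * H * V1 @\<^sub>c mat_adjoint ?U * H * V2 =
      (0\<^sub>m k k @\<^sub>r 0\<^sub>m r k) @\<^sub>c (0\<^sub>m k r @\<^sub>r Hhat)"
    using eq Hhat unfolding mult_append_cols[OF UH c(3,4)] by (simp add: append_interchange)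
  hence "mat_adjoint ?U * H * V1 = 0\<^sub>m k k @\<^sub>r 0\<^sub>m r k"
    by (rule append_cols_inject(1)) (use c Hhat in simp_all)
  also have "\<dots> = 0\<^sub>m (k + r) k" by (intro eq_matI) auto
  finally have 2: "mat_adjoint ?U * H * V1 = 0\<^sub>m (k + r) k" .
  have "H * V1 = (?U * mat_adjoint ?U) * (H * V1)"
    unfolding U using H c by simp
  also have "\<dots> = ?U * (mat_adjoint ?U * H * V1)"
    using c H UV by (simp add: mult_assoc_dim)
  also have "\<dots> = 0\<^sub>m n k"
    unfolding 2 using UV(1) by (rule right_mult_zero_mat)
  finally show V1: "H * V1 = 0\<^sub>m n k" .
  have "1\<^sub>m n = U1 * mat_adjoint U1 + U2 * mat_adjoint U2"
    unfolding U[symmetric] using c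
    by (simp add: mat_adjoint_append_cols append_cols_mult_append_rows[OF c(1,2) adj(1,2)])
  hence "H = (U1 * mat_adjoint U1 + U2 * mat_adjoint U2) * H" using H by (metis left_mult_one_mat)
  also have "\<dots> = U1 * mat_adjoint U1 * H + U2 * mat_adjoint U2 * H"
    by (rule add_mult_distrib_mat[OF mult_carrier_mat[OF c(1) adj(1)] mult_carrier_mat[OF c(2) adj(2)] H])
  also have "U1 * mat_adjoint U1 * H = 0\<^sub>m n n"
    unfolding assoc_mult_mat[OF c(1) adj(1) H] U1 by (rule right_mult_zero_mat[OF c(1)])
  also have "0\<^sub>m n n + U2 * mat_adjoint U2 * H = U2 * mat_adjoint U2 * H"
    by (rule left_add_zero_mat[OF mult_carrier_mat[OF mult_carrier_mat[OF c(2) adj(2)] H]])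
  finally show "U2 * mat_adjoint U2 * H = H" ..
  have "1\<^sub>m n = V1 * mat_adjoint V1 + V2 * mat_adjoint V2"
    unfolding V[symmetric] using c
    by (simp add: mat_adjoint_append_cols append_cols_mult_append_rows[OF c(3,4) adj(3,4)])
  hence "H = H * (V1 * mat_adjoint V1 + V2 * mat_adjoint V2)" using H by (metis right_mult_one_mat)
  also have "\<dots> = H * (V1 * mat_adjoint V1) + H * (V2 * mat_adjoint V2)"
    by (rule mult_add_distrib_mat[OF H mult_carrier_mat[OF c(3) adj(3)] mult_carrier_mat[OF c(4) adj(4)]])
  also have "H * (V1 * mat_adjoint V1) = 0\<^sub>m n n"
    unfolding assoc_mult_mat[OF H c(3) adj(3), symmetric] V1 by (rule left_mult_zero_mat[OF adj(3)])
  also have "0\<^sub>m n n + H * (V2 * mat_adjoint V2) = H * (V2 * mat_adjoint V2)"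
    by (rule left_add_zero_mat[OF mult_carrier_mat[OF H mult_carrier_mat[OF c(4) adj(4)]]])
  finally show "H * (V2 * mat_adjoint V2) = H" ..
qed

text \<open>Needed for both coefficients of M. The two annihilation conditions suffice, so a
  decomposition adapted to H can also be applied to combinations of H and S.\<close>

lemma unitary_transform_padded:
  fixes X :: "complex mat"
  assumes X: "X \<in> carrier_mat n n"
    and c: "U1 \<in> carrier_mat n k" "U2 \<in> carrier_mat n r" "V1 \<in> carrier_mat n k" "V2 \<in> carrier_mat n r"
    and 0: "mat_adjoint U1 * X = 0\<^sub>m k n" "X * V1 = 0\<^sub>m n k"
  shows "mat_adjoint (U1 @\<^sub>c U2) * X * (V1 @\<^sub>c V2) =
    (0\<^sub>m k k @\<^sub>c 0\<^sub>m k r) @\<^sub>r (0\<^sub>m r k @\<^sub>c mat_adjoint U2 * X * V2)"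
proof -
  note adj = c[THEN mat_adjoint_carrier]
  have UX: "mat_adjoint U2 * X \<in> carrier_mat r n" by (rule mult_carrier_mat[OF adj(2) X])
  have VV: "V1 @\<^sub>c V2 \<in> carrier_mat n (k + r)" using c by simp
  have "mat_adjoint (U1 @\<^sub>c U2) * X = mat_adjoint U1 * X @\<^sub>r mat_adjoint U2 * X"
    using c by (simp add: mat_adjoint_append_cols append_rows_mult[OF adj(1,2) X])
  also have "\<dots> * (V1 @\<^sub>c V2) = 0\<^sub>m k n * (V1 @\<^sub>c V2) @\<^sub>r mat_adjoint U2 * X * (V1 @\<^sub>c V2)"
    unfolding 0 by (rule append_rows_mult[OF zero_carrier_mat UX VV])
  also have "mat_adjoint U2 * X * (V1 @\<^sub>c V2) = mat_adjoint U2 * X * V1 @\<^sub>c mat_adjoint U2 * X * V2"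
    by (rule mult_append_cols[OF UX c(3,4)])
  also have "mat_adjoint U2 * X * V1 = 0\<^sub>m r k"
    unfolding assoc_mult_mat[OF adj(2) X c(3)] 0 by (rule right_mult_zero_mat[OF adj(2)])
  also have "0\<^sub>m k n * (V1 @\<^sub>c V2) = 0\<^sub>m k k @\<^sub>c 0\<^sub>m k r"
    unfolding left_mult_zero_mat[OF VV] by (intro eq_matI) auto
  finally show ?thesis .
qed

lemma unitary_mat_mult_adjoint:
  assumes "unitary_mat U" "U \<in> carrier_mat n l"
  shows "U * mat_adjoint U = 1\<^sub>m n" "l = n"
  using assms by (auto simp: unitary_mat_def square_mat.simps)

theorem theorem6p5:
  fixes lam :: complex and d m r :: nat
    and R :: "complex poly fract mat" and Rc :: "nat \<Rightarrow> complex mat"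
    and H U U1 U2 V V1 V2 Hhat :: "complex mat"
    and M Lhat Ltilde :: "complex poly fract mat" and F G :: "complex mat"
  assumes "cmod lam < 1" and "d \<ge> 1"
    and "\<And>j. j \<le> d \<Longrightarrow> Rc j \<in> carrier_mat m m"
    and "mat_adjoint (Rc 0) = Rc 0" and "Rc d \<noteq> 0\<^sub>m m m"
    and "R \<in> carrier_mat m m" and "para_hermitian R"
    and "R = polar_part lam d m Rc + cmat (Rc 0) + mat_recip (mat_star (polar_part lam d m Rc))"
    and "H = hankel_mat d m Rc" and "r = vec_space.rank (d * m) H"
    and "U1 \<in> carrier_mat (d * m) (d * m - r)" and "U2 \<in> carrier_mat (d * m) r"
    and "V1 \<in> carrier_mat (d * m) (d * m - r)" and "V2 \<in> carrier_mat (d * m) r"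
    and "U = U1 @\<^sub>c U2" and "unitary_mat U"
    and "V = V1 @\<^sub>c V2" and "unitary_mat V"
    and "Hhat = mat_adjoint U2 * H * V2" and "invertible_mat Hhat"
    and "mat_adjoint U * H * V = block_matrix
           [[0\<^sub>m (d * m - r) (d * m - r), 0\<^sub>m (d * m - r) r],
            [0\<^sub>m r (d * m - r), Hhat]]"
    and "M = M_pencil lam d m Rc" and "F = F_mat d m Rc" and "G = G_mat d m Rc"
    and "Lhat = structured_pencil M F G (Rc 0)"
    and "Ltilde = cmat (diag_block_mat [mat_adjoint U, mat_adjoint V, 1\<^sub>m m]) * Lhat
                  * cmat (diag_block_mat [U, V, 1\<^sub>m m])"
  shows "\<exists>Ac Fc Gc.
     Ac \<in> carrier_mat r r \<and> regular_pencil Ac \<and>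
     Fc \<in> carrier_mat r m \<and> Gc \<in> carrier_mat r m \<and>
     (let n = d * m - r in
      Ltilde = block_matrix
        [[0\<^sub>m n n, 0\<^sub>m n r, 0\<^sub>m n n, 0\<^sub>m n r, 0\<^sub>m n m],
         [0\<^sub>m r n, 0\<^sub>m r r, 0\<^sub>m r n, Ac, cmat Fc],
         [0\<^sub>m n n, 0\<^sub>m n r, 0\<^sub>m n n, 0\<^sub>m n r, 0\<^sub>m n m],
         [0\<^sub>m r n, rev1 (mat_star Ac), 0\<^sub>m r n, 0\<^sub>m r r, (1 + zvar) \<cdot>\<^sub>m cmat Gc],
         [0\<^sub>m m n, zvar \<cdot>\<^sub>m cmat (mat_adjoint Fc), 0\<^sub>m m n,
          (1 + zvar) \<cdot>\<^sub>m cmat (mat_adjoint Gc), (1 + zvar) \<cdot>\<^sub>m cmat (Rc 0)]]) \<and>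
     (let Lc = structured_pencil Ac Fc Gc (Rc 0) in
      strongly_minimal_linearization (2 * r) Lc ((1 + zvar) \<cdot>\<^sub>m R) \<and>
      star_palindromic Lc)"
proof -
  let ?n = "d * m" and ?k = "d * m - r"
  note lam = assms(1) and Rc = assms(3) and H = assms(9) and U1 = assms(11) and U2 = assms(12)
    and V1 = assms(13) and V2 = assms(14) and Ueq = assms(15) and Veq = assms(17) and Hhat = assms(19)
  \<comment> \<open>For m = 0 the coefficient \<open>R\<^sub>d\<close> would be an empty matrix and
    hence zero.\<close>
  have "0 < m" using Rc[of d] assms(5) by (cases "m = 0") (auto intro!: eq_matI)
  then interpret block_hankel d m Rc
    using assms(2) Rc by unfold_locales auto
  have Hc: "H \<in> carrier_mat ?n ?n" unfolding H by simp
  have cU: "U \<in> carrier_mat ?n (?k + r)" "V \<in> carrier_mat ?n (?k + r)"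
    unfolding Ueq Veq using U1 U2 V1 V2 by simp_all
  \<comment> \<open>Subtraction of naturals is truncated; that the block widths add up to d m
    follows from U being square.\<close>
  have kr: "?k + r = ?n" using unitary_mat_mult_adjoint(2)[OF assms(16) cU(1)] .
  have UU: "U * mat_adjoint U = 1\<^sub>m ?n" "V * mat_adjoint V = 1\<^sub>m ?n"
    using unitary_mat_mult_adjoint(1) assms(16,18) cU by blast+
  have Hhatc: "Hhat \<in> carrier_mat r r" unfolding Hhat
    by (rule mult_carrier_mat[OF mult_carrier_mat[OF mat_adjoint_carrier[OF U2] Hc] V2])
  have eq: "mat_adjoint U * H * V = (0\<^sub>m ?k ?k @\<^sub>c 0\<^sub>m ?k r) @\<^sub>r (0\<^sub>m r ?k @\<^sub>c Hhat)"
    using assms(21) by (simp add: block_matrix_def)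
  note comp = unitary_compression[OF Hc U1 U2 V1 V2 UU[unfolded Ueq Veq] eq[unfolded Ueq Veq] Hhatc]
  interpret compressed_hankel d m Rc r lam U2 V2 "Rc 0"
    using U2 V2 comp(3,4) assms(20) lam Rc[of 0] assms(4) unfolding H Hhat
    by unfold_locales simp_all
  define A1 where "A1 = - (mat_adjoint U2 * hankel_mat d m Rc * V2)"
  define A0 where "A0 = lam \<cdot>\<^sub>m (mat_adjoint U2 * hankel_mat d m Rc * V2) + mat_adjoint U2 * S * V2"
  define Fc where "Fc = mat_adjoint U2 * F"
  define Gc where "Gc = mat_adjoint V2 * G"
  note cc = compressed_carriers
  have cA: "A1 \<in> carrier_mat r r" "A0 \<in> carrier_mat r r"
    unfolding A1_def A0_def using cc(1,5) by simp_all
  have cFG: "Fc \<in> carrier_mat r m" "Gc \<in> carrier_mat r m"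
    unfolding Fc_def Gc_def assms(23,24) using cc(3,4) by simp_all
  have cFG': "F \<in> carrier_mat ?n m" "G \<in> carrier_mat ?n m" unfolding assms(23,24) by simp_all
  \<comment> \<open>What annihilates H from the left annihilates \<open>H P\<^sup>*\<close>, and
    what annihilates it from the right annihilates \<open>P H\<close>; both products are S.\<close>
  have U1S: "mat_adjoint U1 * S = 0\<^sub>m ?k ?n"
    unfolding S_eq_mult_adjoint H[symmetric]
      assoc_mult_mat[OF mat_adjoint_carrier[OF U1] Hc mat_adjoint_carrier[OF block_shift_carrier], symmetric] comp(1)
    by (rule left_mult_zero_mat[OF mat_adjoint_carrier[OF block_shift_carrier]])
  have SV1: "S * V1 = 0\<^sub>m ?n ?k"
    unfolding S_def H[symmetric] assoc_mult_mat[OF block_shift_carrier Hc V1] comp(2)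
    by (rule right_mult_zero_mat[OF block_shift_carrier])
  have B1: "mat_adjoint U * (- H) * V = (0\<^sub>m ?k ?k @\<^sub>c 0\<^sub>m ?k r) @\<^sub>r (0\<^sub>m r ?k @\<^sub>c A1)"
  proof -
    have uz: "- 0\<^sub>m a b = (0\<^sub>m a b :: complex mat)" for a b by (intro eq_matI) auto
    have "mat_adjoint U2 * (- H) * V2 = A1"
      unfolding A1_def H[symmetric] using Hc U2 V2 by simp
    moreover have "mat_adjoint U1 * (- H) = 0\<^sub>m ?k ?n" "(- H) * V1 = 0\<^sub>m ?n ?k"
      using comp(1,2) Hc U1 V1 by (simp_all add: uz)
    ultimately show ?thesis
      unfolding Ueq Veq using unitary_transform_padded[OF uminus_carrier_mat[OF Hc] U1 U2 V1 V2] by simp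
  qed
  have X: "lam \<cdot>\<^sub>m H + S \<in> carrier_mat ?n ?n" using Hc by simp
  have B0: "mat_adjoint U * (lam \<cdot>\<^sub>m H + S) * V = (0\<^sub>m ?k ?k @\<^sub>c 0\<^sub>m ?k r) @\<^sub>r (0\<^sub>m r ?k @\<^sub>c A0)"
  proof -
    have left: "W * (lam \<cdot>\<^sub>m H + S) = lam \<cdot>\<^sub>m (W * H) + W * S" if "W \<in> carrier_mat l ?n" for W l
      using that Hc by (simp add: mult_add_distrib_mat[OF that, of _ ?n] mult_smult_distrib[OF that, of _ ?n])
    have right: "(lam \<cdot>\<^sub>m W + W') * Y = lam \<cdot>\<^sub>m (W * Y) + W' * Y"
      if "W \<in> carrier_mat p ?n" "W' \<in> carrier_mat p ?n" "Y \<in> carrier_mat ?n q" for W W' Y p q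
      using that by (simp add: add_mult_distrib_mat[of _ p ?n _ _ q] mult_smult_assoc_mat[of _ p ?n _ q])
    have "mat_adjoint U2 * (lam \<cdot>\<^sub>m H + S) * V2 = A0"
      unfolding A0_def H[symmetric] left[OF mat_adjoint_carrier[OF U2]]
      by (rule right[OF mult_carrier_mat[OF mat_adjoint_carrier[OF U2] Hc]
            mult_carrier_mat[OF mat_adjoint_carrier[OF U2] S_carrier] V2])
    moreover have "mat_adjoint U1 * (lam \<cdot>\<^sub>m H + S) = 0\<^sub>m ?k ?n"
      unfolding left[OF mat_adjoint_carrier[OF U1]] comp(1) U1S by (intro eq_matI) auto
    moreover have "(lam \<cdot>\<^sub>m H + S) * V1 = 0\<^sub>m ?n ?k"
      unfolding right[OF Hc S_carrier V1] comp(2) SV1 by (intro eq_matI) auto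
    ultimately show ?thesis
      unfolding Ueq Veq using unitary_transform_padded[OF X U1 U2 V1 V2] by simp
  qed
  have BF: "mat_adjoint U * F = 0\<^sub>m ?k m @\<^sub>r Fc"
  proof -
    have "mat_adjoint U1 * F = (mat_adjoint U1 * H) * last_block ?n m"
      unfolding assms(23) F_mat_eq H[symmetric]
      by (rule assoc_mult_mat[OF mat_adjoint_carrier[OF U1] Hc last_block_carrier, symmetric])
    also have "\<dots> = 0\<^sub>m ?k m" unfolding comp(1) by (rule left_mult_zero_mat[OF last_block_carrier])
    finally show ?thesis
      unfolding Ueq Fc_def using U1 U2
      by (simp add: mat_adjoint_append_cols
          append_rows_mult[OF mat_adjoint_carrier[OF U1] mat_adjoint_carrier[OF U2] cFG'(1)])
  qed
  have BG: "mat_adjoint V * G = 0\<^sub>m ?k m @\<^sub>r Gc"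
  proof -
    \<comment> \<open>H enters through the adjoint of G, so the vanishing is shown for the adjoint
      of the wanted product.\<close>
    have "mat_adjoint G * V1 = mat_adjoint (last_block ?n m) * (H * V1)"
      unfolding assms(24) G_mat_eq H[symmetric]
      by (rule assoc_mult_mat[OF mat_adjoint_carrier[OF last_block_carrier] Hc V1])
    also have "\<dots> = 0\<^sub>m m ?k"
      unfolding comp(2) by (rule right_mult_zero_mat[OF mat_adjoint_carrier[OF last_block_carrier]])
    finally have "mat_adjoint (mat_adjoint G * V1) = 0\<^sub>m ?k m" by simp
    hence "mat_adjoint V1 * G = 0\<^sub>m ?k m"
      using mat_adjoint_mult[OF mat_adjoint_carrier[OF cFG'(2)] V1] by simp
    thus ?thesis
      unfolding Veq Gc_def using V1 V2
      by (simp add: mat_adjoint_append_cols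
          append_rows_mult[OF mat_adjoint_carrier[OF V1] mat_adjoint_carrier[OF V2] cFG'(2)])
  qed
  have "Lhat = structured_pencil (pencil (- H) (lam \<cdot>\<^sub>m H + S)) F G (Rc 0)"
    unfolding assms(25,22) M_pencil_eq H ..
  hence Lt: "Ltilde = structured_pencil
      (pencil ((0\<^sub>m ?k ?k @\<^sub>c 0\<^sub>m ?k r) @\<^sub>r (0\<^sub>m r ?k @\<^sub>c A1)) ((0\<^sub>m ?k ?k @\<^sub>c 0\<^sub>m ?k r) @\<^sub>r (0\<^sub>m r ?k @\<^sub>c A0)))
      (0\<^sub>m ?k m @\<^sub>r Fc) (0\<^sub>m ?k m @\<^sub>r Gc) (Rc 0)"
    using structured_pencil_conj[OF cU[unfolded kr] uminus_carrier_mat[OF Hc] X cFG' R0(1)]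
    unfolding assms(26) B1 B0 BF BG by simp
  have Req: "R = polar_part lam d m Rc + cmat (Rc 0) + para_conj (polar_part lam d m Rc)"
    using assms(8) by (simp add: para_conj_def)
  have "pencil A1 A0 \<in> carrier_mat r r" using cA by simp
  moreover have "regular_pencil (pencil A1 A0)" unfolding A1_def A0_def by (rule regular_Ac)
  moreover note Lt[unfolded structured_pencil_padded[OF cA cFG R0(1)]]
  moreover have "strongly_minimal_linearization (2 * r) (structured_pencil (pencil A1 A0) Fc Gc (Rc 0))
      ((1 + zvar) \<cdot>\<^sub>m R)"
    unfolding Req A1_def A0_def Fc_def Gc_def assms(23,24) by (rule strongly_minimal)
  moreover have "star_palindromic (structured_pencil (pencil A1 A0) Fc Gc (Rc 0))"
    unfolding A1_def A0_def Fc_def Gc_def assms(23,24) by (rule system.star_palindromic_structured_pencil)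
  ultimately show ?thesis
    unfolding Let_def using cFG by blast
qed

end
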